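(* Let $G=SL(2,\mathbb{R})$, let $\Gamma\subset G$ be a lattice, and let $\mu_{G/\Gamma}$ be the $G$-invariant (Haar) probability measure on $G/\Gamma$. Let $\lambda>0$ and for $n\in\mathbb{N}$ let $t_n=e^{\lambda n}$. Let $$g_n=\begin{pmatrix}1&t_n\\0&1\end{pmatrix},\qquad k_\theta=\begin{pmatrix}\cos\theta&\sin\theta\\-\sin\theta&\cos\theta\end{pmatrix}.$$ Then for every $x\in G/\Gamma$ and for (Lebesgue) almost every $\theta\in[0,2\pi]$ there exists a set (sequence) $A(\theta)\subseteq\mathbb{N}$ of upper density $1$ such that $$\lim_{\substack{N\to\infty\\ N\in A(\theta)}}\frac1N\sum_{n=1}^N\delta_{g_nk_\theta x}=\mu_{G/\Gamma}$$ in the weak-$*$ topology. Moreover, if $G/\Gamma$ is compact then one may take $A(\theta)=\mathbb{N}$.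
   Context: $\delta_y$ is the Dirac measure at $y$; weak-$*$ convergence means convergence of integrals of every continuous compactly supported function. The upper density of $A\subseteq\mathbb{N}$ is $\overline d(A)=\limsup_{N\to\infty}\frac{\#(A\cap[1,N])}{N}$. The set $A(\theta)$ may depend on $x$ as well as on $\theta$. *)

theory Defs
  imports "HOL-Analysis.Analysis" "HOL-Probability.Giry_Monad" "HOL-Algebra.Left_Coset"
begin

definition SL2R :: "(real^2^2) monoid" where
  "SL2R = \<lparr>carrier = {A. det A = 1}, mult = (**), one = mat 1\<rparr>"

lemma SL2R_simps [simp]:
  "carrier SL2R = {A. det A = 1}" "mult SL2R = (**)" "one SL2R = mat 1"
  by (simp_all add: SL2R_def)

lemma group_SL2R: "group SL2R"
proof (rule groupI)
  fix A assume "A \<in> carrier SL2R"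
  then have A: "det A = 1" by simp
  then obtain B where B: "A ** B = mat 1" "B ** A = mat 1"
    using invertible_det_nz[of A] unfolding invertible_def by auto
  then have "det B = 1"
    using A det_mul[of A B] by simp
  with B show "\<exists>B\<in>carrier SL2R. B \<otimes>\<^bsub>SL2R\<^esub> A = \<one>\<^bsub>SL2R\<^esub>" by auto
qed (auto simp: det_mul matrix_mul_assoc)

definition shear :: "real \<Rightarrow> real^2^2" where
  "shear t = vector [vector [1, t], vector [0, 1]]"

definition rot :: "real \<Rightarrow> real^2^2" where
  "rot \<theta> = vector [vector [cos \<theta>, sin \<theta>], vector [- sin \<theta>, cos \<theta>]]"

lemma shear_carrier: "shear t \<in> carrier SL2R"
  by (simp add: shear_def det_2)

lemma rot_carrier: "rot \<theta> \<in> carrier SL2R"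
  by (simp add: rot_def det_2 flip: power2_eq_square)

text \<open>The homogeneous space is the set \<open>lcosets\<^bsub>SL2R\<^esub> \<Gamma>\<close> of left cosets, on which
  \<open>g\<close> acts by \<open>x \<mapsto> g <#\<^bsub>SL2R\<^esub> x\<close>. It carries the quotient of the topology that
  \<open>SL2R\<close> inherits from the space of matrices.\<close>

definition coset_topology :: "(real^2^2) set \<Rightarrow> (real^2^2) set topology" where
  "coset_topology \<Gamma> = topology (\<lambda>U. U \<subseteq> lcosets\<^bsub>SL2R\<^esub> \<Gamma> \<and>
     openin (top_of_set (carrier SL2R)) {g \<in> carrier SL2R. g <#\<^bsub>SL2R\<^esub> \<Gamma> \<in> U})"

lemma openin_coset_topology:
  "openin (coset_topology \<Gamma>) U \<longleftrightarrow> U \<subseteq> lcosets\<^bsub>SL2R\<^esub> \<Gamma> \<and>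
     openin (top_of_set (carrier SL2R)) {g \<in> carrier SL2R. g <#\<^bsub>SL2R\<^esub> \<Gamma> \<in> U}"
proof -
  let ?P = "\<lambda>U. {g \<in> carrier SL2R. g <#\<^bsub>SL2R\<^esub> \<Gamma> \<in> U}"
  have "istopology (\<lambda>U. U \<subseteq> lcosets\<^bsub>SL2R\<^esub> \<Gamma> \<and> openin (top_of_set (carrier SL2R)) (?P U))"
    unfolding istopology_def
  proof (intro conjI allI impI)
    fix S T assume "S \<subseteq> lcosets\<^bsub>SL2R\<^esub> \<Gamma> \<and> openin (top_of_set (carrier SL2R)) (?P S)"
      and "T \<subseteq> lcosets\<^bsub>SL2R\<^esub> \<Gamma> \<and> openin (top_of_set (carrier SL2R)) (?P T)"
    moreover have "?P (S \<inter> T) = ?P S \<inter> ?P T" by auto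
    ultimately show "S \<inter> T \<subseteq> lcosets\<^bsub>SL2R\<^esub> \<Gamma>" "openin (top_of_set (carrier SL2R)) (?P (S \<inter> T))"
      by (blast, simp only: openin_Int)
  next
    fix \<K> assume K: "\<forall>K\<in>\<K>. K \<subseteq> lcosets\<^bsub>SL2R\<^esub> \<Gamma> \<and> openin (top_of_set (carrier SL2R)) (?P K)"
    then show "\<Union>\<K> \<subseteq> lcosets\<^bsub>SL2R\<^esub> \<Gamma>" by blast
    have "?P (\<Union>\<K>) = (\<Union>K\<in>\<K>. ?P K)" by auto
    moreover have "openin (top_of_set (carrier SL2R)) (\<Union>K\<in>\<K>. ?P K)"
      by (rule openin_Union) (use K in blast)
    ultimately show "openin (top_of_set (carrier SL2R)) (?P (\<Union>\<K>))"
      by (simp only:)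
  qed
  then show ?thesis
    by (simp add: coset_topology_def topology_inverse')
qed

lemma topspace_coset_topology [simp]: "topspace (coset_topology \<Gamma>) = lcosets\<^bsub>SL2R\<^esub> \<Gamma>"
proof -
  have "{g \<in> carrier SL2R. g <#\<^bsub>SL2R\<^esub> \<Gamma> \<in> lcosets\<^bsub>SL2R\<^esub> \<Gamma>} = carrier SL2R"
    unfolding LCOSETS_def by blast
  then have "openin (coset_topology \<Gamma>) (lcosets\<^bsub>SL2R\<^esub> \<Gamma>)"
    unfolding openin_coset_topology by (simp only: openin_subtopology_self order_refl simp_thms)
  then have "lcosets\<^bsub>SL2R\<^esub> \<Gamma> \<subseteq> topspace (coset_topology \<Gamma>)"
    by (rule openin_subset)
  moreover have "topspace (coset_topology \<Gamma>) \<subseteq> lcosets\<^bsub>SL2R\<^esub> \<Gamma>"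
    using openin_topspace[of "coset_topology \<Gamma>"] unfolding openin_coset_topology by (rule conjunct1)
  ultimately show ?thesis by (rule subset_antisym[rotated])
qed

definition borel_of :: "'a topology \<Rightarrow> 'a measure" where
  "borel_of X = sigma (topspace X) {U. openin X U}"

lemma space_borel_of [simp]: "space (borel_of X) = topspace X"
  and sets_borel_of: "sets (borel_of X) = sigma_sets (topspace X) {U. openin X U}"
proof -
  have "{U. openin X U} \<subseteq> Pow (topspace X)"
    by (auto dest: openin_subset)
  then show "space (borel_of X) = topspace X"
    "sets (borel_of X) = sigma_sets (topspace X) {U. openin X U}"
    by (simp_all add: borel_of_def space_measure_of sets_measure_of)
qed

definition invariant_prob_measure :: "(real^2^2) set \<Rightarrow> (real^2^2) set measure \<Rightarrow> bool" where
  "invariant_prob_measure \<Gamma> \<mu> \<longleftrightarrow>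
     prob_space \<mu> \<and>
     sets \<mu> = sets (borel_of (coset_topology \<Gamma>)) \<and>
     (\<forall>g\<in>carrier SL2R. distr \<mu> \<mu> (\<lambda>x. g <#\<^bsub>SL2R\<^esub> x) = \<mu>)"

definition is_lattice :: "(real^2^2) set \<Rightarrow> bool" where
  "is_lattice \<Gamma> \<longleftrightarrow> subgroup \<Gamma> SL2R \<and> discrete \<Gamma> \<and> (\<exists>\<mu>. invariant_prob_measure \<Gamma> \<mu>)"

text \<open>The measure \<open>(1/N) (\<delta>\<^bsub>y 1\<^esub> + \<dots> + \<delta>\<^bsub>y N\<^esub>)\<close> on the Borel sets of \<open>X\<close>;
  it is the null measure for \<open>N = 0\<close>.\<close>

definition empirical_measure :: "'a topology \<Rightarrow> (nat \<Rightarrow> 'a) \<Rightarrow> nat \<Rightarrow> 'a measure" where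
  "empirical_measure X y N = measure_of (topspace X) (sets (borel_of X))
     (\<lambda>B. (\<Sum>n=1..N. emeasure (return (borel_of X) (y n)) B) / of_nat N)"

lemma space_empirical_measure [simp]: "space (empirical_measure X y N) = topspace X"
  and sets_empirical_measure [simp]: "sets (empirical_measure X y N) = sets (borel_of X)"
proof -
  have sa: "sigma_algebra (topspace X) (sets (borel_of X))"
    using sets.sigma_algebra_axioms[of "borel_of X"] by simp
  show "space (empirical_measure X y N) = topspace X"
    unfolding empirical_measure_def by (rule sigma_algebra.space_measure_of_eq[OF sa])
  show "sets (empirical_measure X y N) = sets (borel_of X)"
    unfolding empirical_measure_def by (rule sigma_algebra.sets_measure_of_eq[OF sa])
qed

lemma emeasure_empirical_measure:
  assumes B: "B \<in> sets (borel_of X)"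
  shows "emeasure (empirical_measure X y N) B = (\<Sum>n=1..N. indicator B (y n)) / of_nat N"
proof -
  let ?D = "\<lambda>n. return (borel_of X) (y n)"
  let ?m = "\<lambda>B. (\<Sum>n=1..N. emeasure (?D n) B) / of_nat N"
  have "countably_additive (sets (borel_of X)) ?m"
  proof (rule countably_additiveI)
    fix F :: "nat \<Rightarrow> _" assume F: "range F \<subseteq> sets (borel_of X)" "disjoint_family F"
    have "(\<Sum>i. ?m (F i)) = (\<Sum>i. \<Sum>n=1..N. emeasure (?D n) (F i)) / of_nat N"
      by (simp add: divide_ennreal_def)
    also have "(\<Sum>i. \<Sum>n=1..N. emeasure (?D n) (F i)) = (\<Sum>n=1..N. \<Sum>i. emeasure (?D n) (F i))"
      by (rule suminf_sum) simp
    also have "\<dots> = (\<Sum>n=1..N. emeasure (?D n) (\<Union>i. F i))"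
      using F by (intro sum.cong refl suminf_emeasure) simp_all
    finally show "(\<Sum>i. ?m (F i)) = ?m (\<Union>i. F i)" .
  qed
  moreover have "positive (sets (borel_of X)) ?m"
    by (simp add: positive_def)
  moreover have "sigma_algebra (topspace X) (sets (borel_of X))"
    using sets.sigma_algebra_axioms[of "borel_of X"] by simp
  ultimately have "emeasure (empirical_measure X y N) B = ?m B"
    unfolding empirical_measure_def using B by (intro emeasure_measure_of_sigma)
  then show ?thesis
    using B by simp
qed

definition compactly_supported :: "'a topology \<Rightarrow> ('a \<Rightarrow> real) \<Rightarrow> bool" where
  "compactly_supported X f \<longleftrightarrow> compactin X (X closure_of {x \<in> topspace X. f x \<noteq> 0})"

definition weak_star_tendsto ::
  "'a topology \<Rightarrow> ('i \<Rightarrow> 'a measure) \<Rightarrow> 'a measure \<Rightarrow> 'i filter \<Rightarrow> bool" where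
  "weak_star_tendsto X \<nu> \<mu> F \<longleftrightarrow>
     (\<forall>f. continuous_map X euclideanreal f \<and> compactly_supported X f \<longrightarrow>
        ((\<lambda>i. integral\<^sup>L (\<nu> i) f) \<longlongrightarrow> integral\<^sup>L \<mu> f) F)"

definition upper_density :: "nat set \<Rightarrow> ereal" where
  "upper_density A = limsup (\<lambda>N. ereal (card (A \<inter> {1..N}) / N))"

end

theory Submission
  imports Defs
begin

text \<open>
  Write \<open>u s = shear s\<close>, \<open>d r = diag(r, 1/r)\<close> and \<open>c = \<integral> f d\<mu>\<close>, where \<open>f\<close> is bounded and Lipschitz along the
  group action.

  A minimal norm argument and the Mautner phenomenon show that suitable averages of the translates
  \<open>f \<circ> u s\<close> are close to \<open>c\<close> in \<open>L\<^sup>1(\<mu>)\<close>. As \<open>u p\<close> moves the expanding horocycle \<open>d r \<cdot> u [0,b] \<cdot> x\<close>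
  along itself by a vanishing fraction of its length, the averages of \<open>f\<close> over it tend to \<open>c\<close> in
  \<open>L\<^sup>1(\<mu>)\<close>. They are equicontinuous in \<open>x\<close> and nonempty open sets have positive measure, so they
  tend to \<open>c\<close> for every \<open>x\<close>, and uniformly if the space is compact.

  Let \<open>y n \<theta> = u (t n) \<cdot> rot \<theta> \<cdot> x\<close>. Then \<open>u s \<cdot> y n \<theta>\<close> is close to \<open>y n (\<theta> + s / (t n)\<^sup>2)\<close>, which makes the
  correlations of the functions \<open>f (y n \<theta>) - f (u s \<cdot> y n \<theta>)\<close> decay exponentially. Their Cesaro
  averages therefore vanish in the limit, in \<open>L\<^sup>1(d\<theta>)\<close> and almost everywhere, so \<open>f\<close> may be replaced
  by an average of its translates. In the compact case some such average is uniformly close to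
  \<open>c\<close>. In general it is only close in \<open>L\<^sup>1(\<mu>)\<close>, but arcs of the circle \<open>\<theta> \<mapsto> y n \<theta>\<close> are close to
  expanding horocycles, hence equidistribute; this gives convergence in \<open>L\<^sup>1(d\<theta>)\<close>, and almost everywhere
  convergence along a set of upper density one.
\<close>

section \<open>Two by two matrices\<close>

text \<open>The obstacle is the lack of compactness. A finite average of translates of a compactly
  supported \<open>f\<close> is again compactly supported, so on a noncompact space it vanishes
  somewhere and cannot be uniformly close to a nonzero \<open>c\<close>. An average \<open>g\<close>
  close to \<open>c\<close> only in L^1(\<mu>) says nothing about a single orbit, so the integral of
  |g - c| over large circles has to be controlled by its \<mu>-integral. As the latter can be made
  arbitrarily small, an upper bound up to a constant factor suffices, which explains the one-sided
  circle estimate. For n < m the correlations decay because a rotation by s / (t m)^2 turns f(y m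
  \<theta>) into nearly f(u s y m \<theta>) but hardly moves y n \<theta>, which varies on the scale
  (t n)^(-2). Moving the rotation from one factor to the other leaves a bound by a multiple of t n /
  t m. Distances on the quotient are replaced throughout by the size of h - 1 for a group element h
  carrying one point to another, so that the estimates become computations with two by two
  matrices.\<close>

definition mk :: "real \<Rightarrow> real \<Rightarrow> real \<Rightarrow> real \<Rightarrow> real^2^2" where
  "mk a b c d = vector [vector [a, b], vector [c, d]]"

lemma mk_nth [simp]:
  "mk a b c d $ 1 $ 1 = a" "mk a b c d $ 1 $ 2 = b" "mk a b c d $ 2 $ 1 = c" "mk a b c d $ 2 $ 2 = d"
  by (simp_all add: mk_def)

lemma mk_eta: "mk (A$1$1) (A$1$2) (A$2$1) (A$2$2) = A"
  by (simp add: vec_eq_iff forall_2)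

lemma mk_cases: obtains a b c d where "A = mk a b c d"
  using mk_eta[of A] by metis

lemma mk_eq_iff [simp]: "mk a b c d = mk a' b' c' d' \<longleftrightarrow> a = a' \<and> b = b' \<and> c = c' \<and> d = d'"
  by (auto simp: vec_eq_iff forall_2)

lemma mk_mult [simp]: "mk a b c d ** mk a' b' c' d' = mk (a*a' + b*c') (a*b' + b*d') (c*a' + d*c') (c*b' + d*d')"
  by (simp add: vec_eq_iff forall_2 matrix_matrix_mult_def sum_2)

lemma mat_1_mk: "mat 1 = mk 1 0 0 1"
  by (simp add: vec_eq_iff forall_2 mat_def)

lemma det_mk [simp]: "det (mk a b c d) = a * d - b * c"
  by (simp add: det_2)

lemma shear_mk: "shear t = mk 1 t 0 1" by (simp add: shear_def mk_def)
lemma rot_mk: "rot t = mk (cos t) (sin t) (- sin t) (cos t)" by (simp add: rot_def mk_def)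

lemma det_shear [simp]: "det (shear t) = 1" by (simp add: shear_mk)
lemma det_rot [simp]: "det (rot t) = 1" by (simp add: rot_mk flip: power2_eq_square)

lemma shear_0: "shear 0 = mat 1" by (simp add: shear_mk mat_1_mk)
lemma shear_add: "shear (s + t) = shear s ** shear t" by (simp add: shear_mk)
lemma rot_add: "rot (s + t) = rot s ** rot t"
  by (simp add: rot_mk sin_add cos_add algebra_simps)

definition dg :: "real \<Rightarrow> real^2^2" where "dg r = mk r 0 0 (1/r)"

lemma det_dg [simp]: "r \<noteq> 0 \<Longrightarrow> det (dg r) = 1" by (simp add: dg_def)

text \<open>The adjugate. It is the inverse on matrices of determinant one, and being linear in the
  entries it is antimultiplicative and involutive without any hypothesis.\<close>

definition inv2 :: "real^2^2 \<Rightarrow> real^2^2" where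
  "inv2 A = mk (A$2$2) (- (A$1$2)) (- (A$2$1)) (A$1$1)"

lemma inv2_mk [simp]: "inv2 (mk a b c d) = mk d (-b) (-c) a" by (simp add: inv2_def)

lemma det_inv2 [simp]: "det (inv2 A) = det A"
  by (cases A rule: mk_cases) (simp add: mult.commute)

lemma inv2_left: "det A = 1 \<Longrightarrow> inv2 A ** A = mat 1"
  and inv2_right: "det A = 1 \<Longrightarrow> A ** inv2 A = mat 1"
  by (cases A rule: mk_cases; simp add: mat_1_mk algebra_simps)+

lemma inv2_inv2 [simp]: "inv2 (inv2 A) = A"
  by (cases A rule: mk_cases) simp

lemma inv2_mult: "inv2 (A ** B) = inv2 B ** inv2 A"
  by (cases A rule: mk_cases; cases B rule: mk_cases) (simp add: algebra_simps)

definition nrm1 :: "real^2^2 \<Rightarrow> real" where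
  "nrm1 A = \<bar>A$1$1\<bar> + \<bar>A$1$2\<bar> + \<bar>A$2$1\<bar> + \<bar>A$2$2\<bar>"

text \<open>Serves as distance from the identity: a small \<open>dev h\<close> means that
  \<open>h\<close> moves every point of the quotient only a little. The l1 norm of the entries makes
  it invariant under \<open>inv2\<close> and easy to bound by hand.\<close>

definition dev :: "real^2^2 \<Rightarrow> real" where
  "dev A = \<bar>A$1$1 - 1\<bar> + \<bar>A$1$2\<bar> + \<bar>A$2$1\<bar> + \<bar>A$2$2 - 1\<bar>"

lemma dev_mk [simp]: "dev (mk a b c d) = \<bar>a - 1\<bar> + \<bar>b\<bar> + \<bar>c\<bar> + \<bar>d - 1\<bar>"
  and nrm1_mk [simp]: "nrm1 (mk a b c d) = \<bar>a\<bar> + \<bar>b\<bar> + \<bar>c\<bar> + \<bar>d\<bar>"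
  by (simp_all add: dev_def nrm1_def)

lemma dev_nonneg [simp]: "dev A \<ge> 0" and nrm1_nonneg [simp]: "nrm1 A \<ge> 0"
  by (simp_all add: dev_def nrm1_def)

lemma dev_mat_1 [simp]: "dev (mat 1) = 0" by (simp add: mat_1_mk)

lemma dev_inv2 [simp]: "dev (inv2 A) = dev A" by (cases A rule: mk_cases) simp
lemma nrm1_inv2 [simp]: "nrm1 (inv2 A) = nrm1 A" by (cases A rule: mk_cases) simp

lemma dev_eq_nrm1: "dev A = nrm1 (A - mat 1)"
  by (simp add: dev_def nrm1_def mat_def)

lemma nrm1_triangle: "nrm1 (A + B) \<le> nrm1 A + nrm1 B"
  unfolding nrm1_def vector_add_component
  by (rule order.trans[OF add_mono[OF add_mono[OF add_mono[OF abs_triangle_ineq abs_triangle_ineq] abs_triangle_ineq] abs_triangle_ineq]]) simp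

lemma nrm1_mult: "nrm1 (A ** B) \<le> nrm1 A * nrm1 B"
proof (cases A rule: mk_cases; cases B rule: mk_cases)
  fix a b c d a' b' c' d' assume A: "A = mk a b c d" and B: "B = mk a' b' c' d'"
  have "nrm1 (A ** B) \<le> \<bar>a\<bar>*\<bar>a'\<bar> + \<bar>b\<bar>*\<bar>c'\<bar> + (\<bar>a\<bar>*\<bar>b'\<bar> + \<bar>b\<bar>*\<bar>d'\<bar>) + (\<bar>c\<bar>*\<bar>a'\<bar> + \<bar>d\<bar>*\<bar>c'\<bar>) + (\<bar>c\<bar>*\<bar>b'\<bar> + \<bar>d\<bar>*\<bar>d'\<bar>)"
    unfolding A B mk_mult nrm1_mk abs_mult[symmetric] by (intro add_mono abs_triangle_ineq)
  also have "\<dots> \<le> nrm1 A * nrm1 B"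
    unfolding A B nrm1_mk by (simp add: algebra_simps)
  finally show ?thesis .
qed

lemma dev_mult: "dev (A ** B) \<le> dev A + dev B + dev A * dev B"
proof -
  have "A ** B - mat 1 = (A - mat 1) + (B - mat 1) + (A - mat 1) ** (B - mat 1)"
    by (simp add: vec_eq_iff forall_2 matrix_matrix_mult_def sum_2 mat_def algebra_simps)
  then show ?thesis
    unfolding dev_eq_nrm1 using nrm1_triangle nrm1_mult by (smt (verit))
qed

text \<open>Although \<open>dev\<close> is not conjugation invariant, a fixed \<open>g\<close>
  distorts it only by a factor. This makes left translations continuous on the quotient and keeps
  the class of Lipschitz functions stable under them.\<close>

lemma dev_conj: assumes "det g = 1" shows "dev (g ** h ** inv2 g) \<le> (nrm1 g)\<^sup>2 * dev h"
proof -
  have "g ** (h - mat 1) ** inv2 g = g ** h ** inv2 g - g ** inv2 g"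
    by (simp add: vec_eq_iff forall_2 matrix_matrix_mult_def sum_2 mat_def algebra_simps)
  then have "g ** h ** inv2 g - mat 1 = g ** (h - mat 1) ** inv2 g"
    using assms by (simp add: inv2_right)
  then have "dev (g ** h ** inv2 g) \<le> (nrm1 g * dev h) * nrm1 (inv2 g)"
    unfolding dev_eq_nrm1
    using order.trans[OF nrm1_mult[of "g ** (h - mat 1)" "inv2 g"] mult_right_mono[OF nrm1_mult nrm1_nonneg]]
    by (simp only:)
  then show ?thesis by (simp add: power2_eq_square mult_ac)
qed

lemma continuous_on_matrix_mult [continuous_intros]:
  fixes f g :: "'a::topological_space \<Rightarrow> real^2^2"
  assumes "continuous_on S f" "continuous_on S g"
  shows "continuous_on S (\<lambda>x. f x ** g x)"
  unfolding matrix_matrix_mult_def by (intro continuous_intros assms)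

lemma continuous_on_dev [continuous_intros]:
  fixes f :: "'a::topological_space \<Rightarrow> real^2^2"
  assumes "continuous_on S f"
  shows "continuous_on S (\<lambda>x. dev (f x))"
  unfolding dev_def by (intro continuous_intros assms)

lemma norm_le_dev: "norm (A - mat 1) \<le> dev A"
proof -
  have "norm (A - mat 1) \<le> (\<Sum>i\<in>UNIV. norm ((A - mat 1) $ i))" unfolding norm_vec_def[of "A - mat 1"] by (rule L2_set_le_sum) simp
  also have "\<dots> \<le> (\<Sum>i\<in>UNIV. \<Sum>j\<in>UNIV. \<bar>(A - mat 1) $ i $ j\<bar>)"
    by (intro sum_mono norm_le_l1_cart)
  also have "\<dots> = dev A" by (simp add: sum_2 dev_def mat_def)
  finally show ?thesis .
qed

abbreviation act :: "real^2^2 \<Rightarrow> (real^2^2) set \<Rightarrow> (real^2^2) set" (infixr "\<star>" 65) where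
  "g \<star> y \<equiv> g <#\<^bsub>SL2R\<^esub> y"

lemma act_mult: "(A ** B) \<star> y = A \<star> (B \<star> y)"
  by (auto simp: l_coset_def matrix_mul_assoc)

lemma act_1 [simp]: "mat 1 \<star> y = y"
  by (auto simp: l_coset_def)

lemma act_inv2 [simp]: "det g = 1 \<Longrightarrow> inv2 g \<star> (g \<star> y) = y" "det g = 1 \<Longrightarrow> g \<star> (inv2 g \<star> y) = y"
  by (simp_all add: inv2_left inv2_right flip: act_mult)

text \<open>Closeness is expressed by the left factor \<open>d ** inv2 g\<close> that carries
  \<open>g\<close> to \<open>d\<close>, because the group acts on cosets from the left. Used both
  for separability of the quotient and for covering it by countably many translates of an open
  set.\<close>

lemma SL2_dense: obtains D :: "(real^2^2) set" where "countable D" "D \<subseteq> {A. det A = 1}"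
  "\<And>g \<delta>. det g = 1 \<Longrightarrow> \<delta> > 0 \<Longrightarrow> \<exists>d\<in>D. dev (d ** inv2 g) < \<delta>"
proof -
  obtain D :: "(real^2^2) set" where D: "countable D" "D \<subseteq> {A. det A = 1}" "{A. det A = 1} \<subseteq> closure D"
    using separable by blast
  show ?thesis
  proof
    fix g :: "real^2^2" and \<delta> :: real assume "det g = 1" "\<delta> > 0"
    then have "g \<in> closure D" using D by auto
    moreover have "open {A. dev (A ** inv2 g) < \<delta>}"
      by (intro open_Collect_less continuous_intros)
    moreover have "g \<in> {A. dev (A ** inv2 g) < \<delta>}"
      using \<open>det g = 1\<close> \<open>\<delta> > 0\<close> by (simp add: inv2_right)
    ultimately show "\<exists>d\<in>D. dev (d ** inv2 g) < \<delta>"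
      using open_Int_closure_eq_empty[of "{A. dev (A ** inv2 g) < \<delta>}" D] by blast
  qed (use D in auto)
qed

section \<open>The homogeneous space\<close>

locale sl2_quotient =
  fixes \<Gamma> :: "(real^2^2) set" and \<mu> :: "(real^2^2) set measure"
  assumes inv_prob: "invariant_prob_measure \<Gamma> \<mu>"
begin

abbreviation X where "X \<equiv> lcosets\<^bsub>SL2R\<^esub> \<Gamma>"

lemma X_iff: "y \<in> X \<longleftrightarrow> (\<exists>g. det g = 1 \<and> y = g \<star> \<Gamma>)"
  by (auto simp: LCOSETS_def)

lemma act_X [simp]: "det g = 1 \<Longrightarrow> y \<in> X \<Longrightarrow> g \<star> y \<in> X"
  unfolding X_iff using act_mult det_mul by (metis mult_1)

lemma transitive: assumes "y \<in> X" "z \<in> X" obtains h where "det h = 1" "z = h \<star> y"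
proof -
  obtain g g' where "det g = 1" "y = g \<star> \<Gamma>" "det g' = 1" "z = g' \<star> \<Gamma>" using assms by (auto simp: X_iff)
  then have "det (g' ** inv2 g) = 1 \<and> z = (g' ** inv2 g) \<star> y" by (simp add: act_mult det_mul)
  then show ?thesis using that by blast
qed

lemma X_nonempty: "\<Gamma> \<in> X" unfolding X_iff by (rule exI[of _ "mat 1"]) simp

text \<open>Right multiplication by \<open>g\<close> is continuous, so the elements
  \<open>h ** g\<close> with \<open>h\<close> near the identity form a neighbourhood basis of
  \<open>g\<close>. The quotient topology is thereby described by the action alone, and this is the
  form in which it is used.\<close>

lemma openin_iff: "openin (coset_topology \<Gamma>) U \<longleftrightarrow>
   U \<subseteq> X \<and> (\<forall>y\<in>U. \<exists>\<delta>>0. \<forall>h. det h = 1 \<longrightarrow> dev h < \<delta> \<longrightarrow> h \<star> y \<in> U)" (is "_ \<longleftrightarrow> ?R")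
proof
  assume "openin (coset_topology \<Gamma>) U"
  then have U: "U \<subseteq> X" "openin (top_of_set {A. det A = 1}) {g. det g = 1 \<and> g \<star> \<Gamma> \<in> U}"
    by (simp_all add: openin_coset_topology)
  then obtain T where T: "open T" "{g. det g = 1 \<and> g \<star> \<Gamma> \<in> U} = {A. det A = 1} \<inter> T"
    by (auto simp: openin_open)
  show ?R
  proof (intro conjI ballI U)
    fix y assume "y \<in> U"
    then obtain g where g: "det g = 1" "y = g \<star> \<Gamma>" using U X_iff by blast
    then have "g \<in> T" using T \<open>y \<in> U\<close> by blast
    have "open ((\<lambda>h. h ** g) -` T)"
      by (intro open_vimage T continuous_intros)
    moreover have "mat 1 \<in> (\<lambda>h. h ** g) -` T" using \<open>g \<in> T\<close> by simp
    ultimately obtain \<delta> where \<delta>: "\<delta> > 0" "ball (mat 1) \<delta> \<subseteq> (\<lambda>h. h ** g) -` T"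
      unfolding open_contains_ball by blast
    show "\<exists>\<delta>>0. \<forall>h. det h = 1 \<longrightarrow> dev h < \<delta> \<longrightarrow> h \<star> y \<in> U"
    proof (intro exI[of _ \<delta>] conjI allI impI \<delta>)
      fix h :: "real^2^2" assume h: "det h = 1" "dev h < \<delta>"
      then have "h \<in> ball (mat 1) \<delta>"
        using norm_le_dev[of h] by (simp add: dist_norm norm_minus_commute)
      then have "h ** g \<in> T" using \<delta> by auto
      then have "h ** g \<in> {g. det g = 1 \<and> g \<star> \<Gamma> \<in> U}" using T h g by (simp add: det_mul)
      then show "h \<star> y \<in> U" using g by (simp add: act_mult)
    qed
  qed
next
  assume R: ?R
  have "\<exists>T. open T \<and> {g. det g = 1 \<and> g \<star> \<Gamma> \<in> U} = {A. det A = 1} \<inter> T"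
  proof -
    have "\<exists>\<delta>. \<forall>y\<in>U. \<delta> y > 0 \<and> (\<forall>h. det h = 1 \<longrightarrow> dev h < \<delta> y \<longrightarrow> h \<star> y \<in> U)"
      using R by metis
    then obtain \<delta> where \<delta>: "\<And>y. y \<in> U \<Longrightarrow> \<delta> y > 0"
       "\<And>y h. y \<in> U \<Longrightarrow> det h = 1 \<Longrightarrow> dev h < \<delta> y \<Longrightarrow> h \<star> y \<in> U" by blast
    define P where "P = {g. det g = 1 \<and> g \<star> \<Gamma> \<in> U}"
    define T where "T = (\<Union>g\<in>P. {A. dev (A ** inv2 g) < \<delta> (g \<star> \<Gamma>)})"
    have "open T" unfolding T_def
      by (intro open_UN ballI open_Collect_less continuous_intros)
    moreover have "P = {A. det A = 1} \<inter> T"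
    proof (intro equalityI subsetI)
      fix g assume "g \<in> P"
      then have "g \<in> {A. dev (A ** inv2 g) < \<delta> (g \<star> \<Gamma>)}" using \<delta>(1) by (auto simp: P_def inv2_right)
      then show "g \<in> {A. det A = 1} \<inter> T" using \<open>g \<in> P\<close> unfolding T_def by (auto simp: P_def)
    next
      fix A assume "A \<in> {A. det A = 1} \<inter> T"
      then obtain g where g: "det A = 1" "g \<in> P" "dev (A ** inv2 g) < \<delta> (g \<star> \<Gamma>)" by (auto simp: T_def)
      then have "(A ** inv2 g) \<star> (g \<star> \<Gamma>) \<in> U"
        using \<delta>(2)[of "g \<star> \<Gamma>" "A ** inv2 g"] by (simp add: P_def det_mul)
      then show "A \<in> P" using g by (simp add: P_def act_mult)
    qed
    ultimately show ?thesis by (auto simp: P_def)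
  qed
  then show "openin (coset_topology \<Gamma>) U"
    using R by (simp add: openin_coset_topology openin_open)
qed

lemma dense_points: obtains Z where "countable Z" "Z \<subseteq> X" "Z \<noteq> {}"
  "\<And>y \<delta>. y \<in> X \<Longrightarrow> \<delta> > 0 \<Longrightarrow> \<exists>z\<in>Z. \<exists>h. det h = 1 \<and> dev h < \<delta> \<and> y = h \<star> z"
proof -
  obtain D :: "(real^2^2) set" where D: "countable D" "D \<subseteq> {A. det A = 1}"
    "\<And>g \<delta>. det g = 1 \<Longrightarrow> \<delta> > 0 \<Longrightarrow> \<exists>d\<in>D. dev (d ** inv2 g) < \<delta>" by (rule SL2_dense) blast
  show ?thesis
  proof (rule that[of "(\<lambda>d. d \<star> \<Gamma>) ` D"])
    show "(\<lambda>d. d \<star> \<Gamma>) ` D \<subseteq> X" using D(2) by (auto intro!: act_X X_nonempty)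
    show "(\<lambda>d. d \<star> \<Gamma>) ` D \<noteq> {}" using D(3)[of "mat 1" 1] by (auto)
    fix y and \<delta> :: real assume "y \<in> X" "\<delta> > 0"
    then obtain g where g: "det g = 1" "y = g \<star> \<Gamma>" by (auto simp: X_iff)
    then obtain d where d: "d \<in> D" "dev (d ** inv2 g) < \<delta>" using D(3) \<open>\<delta> > 0\<close> by blast
    have det: "det d = 1" using d D(2) by auto
    \<comment> \<open>The factor \<open>d ** inv2 g\<close> leads from \<open>y\<close> to the dense
      point; its inverse leads back and has the same \<open>dev\<close>.\<close>
    define h where "h = inv2 (d ** inv2 g)"
    have "det h = 1" "dev h < \<delta>" using det g d by (simp_all add: h_def det_mul)
    moreover have "y = h \<star> (d \<star> \<Gamma>)"
      using det g by (simp add: h_def inv2_mult act_mult)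
    ultimately show "\<exists>z\<in>(\<lambda>d. d \<star> \<Gamma>) ` D. \<exists>h. det h = 1 \<and> dev h < \<delta> \<and> y = h \<star> z"
      using d by blast
  qed (use D in auto)
qed

section \<open>Bounded Lipschitz functions\<close>

text \<open>The Lipschitz condition refers to the left action instead of a metric. The class is
  small enough for explicit error bounds and large enough to contain the bump functions that
  determine weak convergence.\<close>

definition BL :: "((real^2^2) set \<Rightarrow> real) \<Rightarrow> bool" where
  "BL f \<longleftrightarrow> (\<exists>K. \<forall>y\<in>X. \<bar>f y\<bar> \<le> K \<and> (\<forall>h. det h = 1 \<longrightarrow> \<bar>f (h \<star> y) - f y\<bar> \<le> K * dev h))"

text \<open>The normalization \<open>K \<ge> 1\<close> makes the constant positive, so that radii
  can be obtained by dividing by it.\<close>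

lemma BL_E: assumes "BL f" obtains K where "K \<ge> 1" "\<And>y. y \<in> X \<Longrightarrow> \<bar>f y\<bar> \<le> K"
  "\<And>y h. y \<in> X \<Longrightarrow> det h = 1 \<Longrightarrow> \<bar>f (h \<star> y) - f y\<bar> \<le> K * dev h"
proof -
  obtain K where K: "\<forall>y\<in>X. \<bar>f y\<bar> \<le> K \<and> (\<forall>h. det h = 1 \<longrightarrow> \<bar>f (h \<star> y) - f y\<bar> \<le> K * dev h)"
    using assms unfolding BL_def by blast
  show ?thesis
  proof (rule that[of "max 1 K"])
    fix y and h :: "real^2^2" assume "y \<in> X" "det h = 1"
    then have "\<bar>f (h \<star> y) - f y\<bar> \<le> K * dev h" using K by blast
    also have "\<dots> \<le> max 1 K * dev h" by (intro mult_right_mono) auto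
    finally show "\<bar>f (h \<star> y) - f y\<bar> \<le> max 1 K * dev h" .
  qed (use K in force)+
qed

lemma BL_I: assumes "\<And>y. y \<in> X \<Longrightarrow> \<bar>f y\<bar> \<le> M"
  "\<And>y h. y \<in> X \<Longrightarrow> det h = 1 \<Longrightarrow> \<bar>f (h \<star> y) - f y\<bar> \<le> L * dev h"
  shows "BL f"
  unfolding BL_def
proof (intro exI ballI conjI allI impI)
  fix y assume y: "y \<in> X"
  show "\<bar>f y\<bar> \<le> max M L" using assms(1)[OF y] by auto
  fix h :: "real^2^2" assume h: "det h = 1"
  have "L * dev h \<le> max M L * dev h" by (intro mult_right_mono) auto
  then show "\<bar>f (h \<star> y) - f y\<bar> \<le> max M L * dev h" using assms(2)[OF y h] by linarith
qed

lemma BL_const: "BL (\<lambda>y. c)" by (rule BL_I[of _ "\<bar>c\<bar>" 0]) auto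

lemma BL_add: assumes "BL f" "BL g" shows "BL (\<lambda>y. f y + g y)"
proof -
  obtain K where K: "\<And>y. y \<in> X \<Longrightarrow> \<bar>f y\<bar> \<le> K"
    "\<And>y h. y \<in> X \<Longrightarrow> det h = 1 \<Longrightarrow> \<bar>f (h \<star> y) - f y\<bar> \<le> K * dev h" using BL_E[OF assms(1)] by metis
  obtain L where L: "\<And>y. y \<in> X \<Longrightarrow> \<bar>g y\<bar> \<le> L"
    "\<And>y h. y \<in> X \<Longrightarrow> det h = 1 \<Longrightarrow> \<bar>g (h \<star> y) - g y\<bar> \<le> L * dev h" using BL_E[OF assms(2)] by metis
  show ?thesis
  proof (rule BL_I[of _ "K + L" "K + L"])
    fix y assume "y \<in> X"
    then show "\<bar>f y + g y\<bar> \<le> K + L" using K(1)[of y] L(1)[of y] by linarith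
    fix h :: "real^2^2" assume "det h = 1"
    then show "\<bar>f (h \<star> y) + g (h \<star> y) - (f y + g y)\<bar> \<le> (K + L) * dev h"
      using K(2)[of y h] L(2)[of y h] \<open>y \<in> X\<close> unfolding distrib_right by linarith
  qed
qed

lemma BL_cmult: assumes "BL f" shows "BL (\<lambda>y. c * f y)"
proof -
  obtain K where K: "\<And>y. y \<in> X \<Longrightarrow> \<bar>f y\<bar> \<le> K"
    "\<And>y h. y \<in> X \<Longrightarrow> det h = 1 \<Longrightarrow> \<bar>f (h \<star> y) - f y\<bar> \<le> K * dev h" using BL_E[OF assms(1)] by metis
  show ?thesis
    by (rule BL_I[of _ "\<bar>c\<bar> * K" "\<bar>c\<bar> * K"])
      (auto simp: abs_mult mult.assoc simp flip: right_diff_distrib intro!: mult_left_mono K)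
qed

lemma BL_diff: "BL f \<Longrightarrow> BL g \<Longrightarrow> BL (\<lambda>y. f y - g y)"
  using BL_add[of f "\<lambda>y. (-1) * g y"] BL_cmult[of g "-1"] by simp

lemma BL_abs: assumes "BL f" shows "BL (\<lambda>y. \<bar>f y\<bar>)"
proof -
  obtain K where K: "\<And>y. y \<in> X \<Longrightarrow> \<bar>f y\<bar> \<le> K"
    "\<And>y h. y \<in> X \<Longrightarrow> det h = 1 \<Longrightarrow> \<bar>f (h \<star> y) - f y\<bar> \<le> K * dev h" using BL_E[OF assms(1)] by metis
  show ?thesis
    by (rule BL_I[of _ K K]) (auto intro: K order.trans[OF abs_triangle_ineq3])
qed

lemma BL_max: assumes "BL f" "BL g" shows "BL (\<lambda>y. max (f y) (g y))"
proof -
  have "(\<lambda>y. max (f y) (g y)) = (\<lambda>y. (1/2) * (f y + g y + \<bar>f y - g y\<bar>))"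
    by (auto simp: fun_eq_iff max_def)
  then show ?thesis using assms by (simp only:) (intro BL_cmult BL_add BL_diff BL_abs; assumption)
qed

lemma BL_act: assumes "BL f" "det g = 1" shows "BL (\<lambda>y. f (g \<star> y))"
proof -
  obtain K where K0: "K \<ge> 1" and K: "\<And>y. y \<in> X \<Longrightarrow> \<bar>f y\<bar> \<le> K"
    "\<And>y h. y \<in> X \<Longrightarrow> det h = 1 \<Longrightarrow> \<bar>f (h \<star> y) - f y\<bar> \<le> K * dev h" using BL_E[OF assms(1)] by metis
  show ?thesis
  proof (rule BL_I)
    fix y assume y: "y \<in> X"
    then show "\<bar>f (g \<star> y)\<bar> \<le> K" using assms(2) by (intro K) auto
    fix h :: "real^2^2" assume h: "det h = 1"
    have "g \<star> h \<star> y = (g ** h ** inv2 g) \<star> g \<star> y" using assms(2) by (simp add: act_mult)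
    then have "\<bar>f (g \<star> h \<star> y) - f (g \<star> y)\<bar> \<le> K * dev (g ** h ** inv2 g)"
      using K(2)[of "g \<star> y" "g ** h ** inv2 g"] y h assms(2) by (simp add: det_mul)
    also have "\<dots> \<le> K * ((nrm1 g)\<^sup>2 * dev h)"
      using K0 by (intro mult_left_mono dev_conj assms) auto
    finally show "\<bar>f (g \<star> h \<star> y) - f (g \<star> y)\<bar> \<le> (K * (nrm1 g)\<^sup>2) * dev h" by (simp add: mult.assoc)
  qed
qed

section \<open>The invariant measure and open neighbourhoods\<close>

sublocale prob_space \<mu> using inv_prob by (simp add: invariant_prob_measure_def)

lemma sets_mu: "sets \<mu> = sigma_sets X {U. openin (coset_topology \<Gamma>) U}"
  using inv_prob by (simp add: invariant_prob_measure_def sets_borel_of)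

lemma space_mu [simp]: "space \<mu> = X"
  using sets_eq_imp_space_eq[of \<mu> "borel_of (coset_topology \<Gamma>)"] inv_prob by (simp add: invariant_prob_measure_def)

lemma open_sets_mu: "openin (coset_topology \<Gamma>) U \<Longrightarrow> U \<in> sets \<mu>"
  unfolding sets_mu by (rule sigma_sets.Basic) simp

lemma measurable_act [measurable]: assumes "det g = 1" shows "(\<lambda>y. g \<star> y) \<in> measurable \<mu> \<mu>"
proof (rule measurable_sigma_sets[OF sets_mu])
  show "{U. openin (coset_topology \<Gamma>) U} \<subseteq> Pow X" by (auto simp: openin_iff)
  show "(\<lambda>y. g \<star> y) \<in> space \<mu> \<rightarrow> X" using assms by auto
  fix U assume "U \<in> {U. openin (coset_topology \<Gamma>) U}"
  then have U: "U \<subseteq> X" "\<And>y. y \<in> U \<Longrightarrow> \<exists>\<delta>>0. \<forall>h. det h = 1 \<longrightarrow> dev h < \<delta> \<longrightarrow> h \<star> y \<in> U"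
    by (auto simp: openin_iff)
  have "openin (coset_topology \<Gamma>) ((\<lambda>y. g \<star> y) -` U \<inter> X)" unfolding openin_iff
  proof (intro conjI ballI)
    fix y assume y: "y \<in> (\<lambda>y. g \<star> y) -` U \<inter> X"
    then obtain \<delta> where \<delta>: "\<delta> > 0" "\<And>h. det h = 1 \<Longrightarrow> dev h < \<delta> \<Longrightarrow> h \<star> g \<star> y \<in> U" using U by blast
    show "\<exists>\<delta>>0. \<forall>h. det h = 1 \<longrightarrow> dev h < \<delta> \<longrightarrow> h \<star> y \<in> (\<lambda>y. g \<star> y) -` U \<inter> X"
    \<comment> \<open>The radius comes from \<open>dev_conj\<close>; the added one makes the
      denominator visibly positive.\<close>
    proof (intro exI[of _ "\<delta> / ((nrm1 g)\<^sup>2 + 1)"] conjI allI impI)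
      show "0 < \<delta> / ((nrm1 g)\<^sup>2 + 1)" using \<delta> by (intro divide_pos_pos add_nonneg_pos) auto
      fix h :: "real^2^2" assume h: "det h = 1" "dev h < \<delta> / ((nrm1 g)\<^sup>2 + 1)"
      have "dev (g ** h ** inv2 g) \<le> (nrm1 g)\<^sup>2 * dev h" by (rule dev_conj[OF assms])
      also have "\<dots> \<le> ((nrm1 g)\<^sup>2 + 1) * dev h" by (intro mult_right_mono) auto
      also have "\<dots> < \<delta>" using h(2) by (subst (asm) pos_less_divide_eq) (auto intro: add_nonneg_pos simp: mult.commute)
      finally have "(g ** h ** inv2 g) \<star> g \<star> y \<in> U" using h assms by (intro \<delta>(2)) (auto simp: det_mul)
      then show "h \<star> y \<in> (\<lambda>y. g \<star> y) -` U \<inter> X" using assms y h by (simp add: act_mult)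
    qed
  qed auto
  then show "(\<lambda>y. g \<star> y) -` U \<inter> space \<mu> \<in> sets \<mu>" using open_sets_mu by simp
qed

lemma distr_act: "det g = 1 \<Longrightarrow> distr \<mu> \<mu> (\<lambda>y. g \<star> y) = \<mu>"
  using inv_prob by (simp add: invariant_prob_measure_def)

lemma integral_act: assumes "det g = 1" "f \<in> borel_measurable \<mu>"
  shows "(\<integral>y. f (g \<star> y) \<partial>\<mu>) = (\<integral>y. (f y :: real) \<partial>\<mu>)"
  using integral_distr[OF measurable_act[OF assms(1)], of f] assms by (simp add: distr_act)

lemma emeasure_act: assumes "det g = 1" "A \<in> sets \<mu>"
  shows "emeasure \<mu> {y\<in>X. g \<star> y \<in> A} = emeasure \<mu> A"
proof -
  have "emeasure \<mu> A = emeasure (distr \<mu> \<mu> (\<lambda>y. g \<star> y)) A" using assms by (simp add: distr_act)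
  also have "\<dots> = emeasure \<mu> {y\<in>X. g \<star> y \<in> A}"
    by (subst emeasure_distr[OF measurable_act[OF assms(1)] assms(2)]) (auto intro!: arg_cong[where f="emeasure \<mu>"])
  finally show ?thesis by simp
qed

lemma AE_act: assumes "det g = 1" "AE y in \<mu>. P y" shows "AE y in \<mu>. P (g \<star> y)"
  by (rule AE_distrD[OF measurable_act[OF assms(1)]]) (unfold distr_act[OF assms(1)], rule assms(2))

lemma BL_open: assumes "BL f" shows "openin (coset_topology \<Gamma>) {y\<in>X. a < f y}"
  unfolding openin_iff
proof (intro conjI ballI)
  obtain K where K0: "K \<ge> 1" and K:
    "\<And>y h. y \<in> X \<Longrightarrow> det h = 1 \<Longrightarrow> \<bar>f (h \<star> y) - f y\<bar> \<le> K * dev h" using BL_E[OF assms(1)] by metis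
  fix y assume "y \<in> {y\<in>X. a < f y}"
  then have y: "y \<in> X" "a < f y" by auto
  show "\<exists>\<delta>>0. \<forall>h. det h = 1 \<longrightarrow> dev h < \<delta> \<longrightarrow> h \<star> y \<in> {y\<in>X. a < f y}"
  proof (intro exI[of _ "(f y - a) / K"] conjI allI impI)
    show "0 < (f y - a) / K" using y K0 by auto
    fix h :: "real^2^2" assume h: "det h = 1" "dev h < (f y - a) / K"
    then have "K * dev h < f y - a" using K0 by (subst (asm) pos_less_divide_eq) (auto simp: mult.commute)
    then have "a < f (h \<star> y)" using K[OF y(1) h(1)] by linarith
    then show "h \<star> y \<in> {y\<in>X. a < f y}" using y h by simp
  qed
qed auto

lemma BL_measurable: "BL f \<Longrightarrow> f \<in> borel_measurable \<mu>"
  unfolding borel_measurable_iff_greater using open_sets_mu[OF BL_open] by simp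

lemma BL_integrable: assumes "BL f" shows "integrable \<mu> f"
proof -
  obtain K where K: "\<And>y. y \<in> X \<Longrightarrow> \<bar>f y\<bar> \<le> K" using BL_E[OF assms(1)] by metis
  show ?thesis by (rule integrable_const_bound[of _ K]) (auto intro!: AE_I2 K BL_measurable assms)
qed

text \<open>The radius is measured in the group and hence has the same meaning at every point, which
  is what estimates uniform over the space require.\<close>

definition nbh :: "real \<Rightarrow> (real^2^2) set \<Rightarrow> (real^2^2) set set" where
  "nbh \<delta> x = {h \<star> x | h. det h = 1 \<and> dev h < \<delta>}"

lemma nbh_open: assumes "x \<in> X" shows "openin (coset_topology \<Gamma>) (nbh \<delta> x)"
  unfolding openin_iff
proof (intro conjI ballI)
  show "nbh \<delta> x \<subseteq> X" using assms by (auto simp: nbh_def)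
  fix y assume "y \<in> nbh \<delta> x"
  then obtain h where h: "det h = 1" "dev h < \<delta>" "y = h \<star> x" by (auto simp: nbh_def)
  show "\<exists>\<delta>'>0. \<forall>k. det k = 1 \<longrightarrow> dev k < \<delta>' \<longrightarrow> k \<star> y \<in> nbh \<delta> x"
  \<comment> \<open>Chosen so that the bound \<open>dev k * (1 + dev h) + dev h\<close> from
    \<open>dev_mult\<close> stays below \<open>\<delta>\<close>.\<close>
  proof (intro exI[of _ "(\<delta> - dev h) / (1 + dev h)"] conjI allI impI)
    show "0 < (\<delta> - dev h) / (1 + dev h)" using h by (intro divide_pos_pos add_pos_nonneg) auto
    fix k :: "real^2^2" assume k: "det k = 1" "dev k < (\<delta> - dev h) / (1 + dev h)"
    have "dev (k ** h) \<le> dev k * (1 + dev h) + dev h" using dev_mult[of k h] by (simp add: algebra_simps)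
    also have "\<dots> < \<delta>" using k(2) by (subst (asm) pos_less_divide_eq) (auto intro: add_pos_nonneg)
    finally show "k \<star> y \<in> nbh \<delta> x" unfolding nbh_def using h k
      by (intro CollectI exI[of _ "k ** h"]) (auto simp: act_mult det_mul)
  qed
qed

text \<open>If y = g x, then an element close to the inverse of g carries y into the neighbourhood.
  So countably many translates of it cover the space, and by invariance they all have the same
  measure, which cannot be zero.\<close>

lemma nbh_pos: assumes "x \<in> X" "\<delta> > 0" shows "measure \<mu> (nbh \<delta> x) > 0"
proof (rule ccontr)
  assume "\<not> ?thesis"
  then have 0: "emeasure \<mu> (nbh \<delta> x) = 0"
    using measure_nonneg[of \<mu> "nbh \<delta> x"] by (simp add: emeasure_eq_measure)
  have O: "nbh \<delta> x \<in> sets \<mu>" using open_sets_mu nbh_open assms by blast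
  obtain D :: "(real^2^2) set" where D: "countable D" "D \<subseteq> {A. det A = 1}"
    "\<And>g \<delta>. det g = 1 \<Longrightarrow> \<delta> > 0 \<Longrightarrow> \<exists>d\<in>D. dev (d ** inv2 g) < \<delta>" by (rule SL2_dense) blast
  have "{y\<in>X. d \<star> y \<in> nbh \<delta> x} \<in> null_sets \<mu>" if "d \<in> D" for d
  proof -
    have d: "det d = 1" using D that by auto
    have "{y\<in>X. d \<star> y \<in> nbh \<delta> x} \<in> sets \<mu>"
      using measurable_sets[OF measurable_act[OF d] O] by (simp add: vimage_def Int_def conj_commute)
    then show ?thesis using emeasure_act[OF d O] 0 by (simp add: null_sets_def)
  qed
  then have N: "(\<Union>d\<in>D. {y\<in>X. d \<star> y \<in> nbh \<delta> x}) \<in> null_sets \<mu>"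
    using D(1) by (intro null_sets_UN') auto
  have "X \<subseteq> (\<Union>d\<in>D. {y\<in>X. d \<star> y \<in> nbh \<delta> x})"
  proof
    fix y assume y: "y \<in> X"
    then obtain g where g: "det g = 1" "y = g \<star> x" using transitive assms by metis
    then obtain d where d: "d \<in> D" "dev (d ** g) < \<delta>" using D(3)[of "inv2 g" \<delta>] assms by auto
    have "d \<star> y = (d ** g) \<star> x" "det (d ** g) = 1" using g d D by (auto simp: act_mult det_mul)
    then have "d \<star> y \<in> nbh \<delta> x" unfolding nbh_def using d by blast
    then show "y \<in> (\<Union>d\<in>D. {y\<in>X. d \<star> y \<in> nbh \<delta> x})" using d y by blast
  qed
  then have "emeasure \<mu> X \<le> emeasure \<mu> (\<Union>d\<in>D. {y\<in>X. d \<star> y \<in> nbh \<delta> x})"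
    using N by (intro emeasure_mono) auto
  also have "\<dots> = 0" using N by auto
  finally show False using emeasure_space_1 by simp
qed

lemma sets_mu_borel: "sets \<mu> = sets (borel_of (coset_topology \<Gamma>))"
  using inv_prob by (simp add: invariant_prob_measure_def)

end

section \<open>Ergodicity of the horocycle flow\<close>

text \<open>Plays the role of the Borel-Cantelli lemma: integrals that are summable in
  \<open>k\<close> force the functions to tend to zero almost everywhere.\<close>

lemma L1_summable_AE:
  fixes f :: "nat \<Rightarrow> 'a \<Rightarrow> real"
  assumes "\<And>k. integrable M (f k)" "\<And>k x. f k x \<ge> 0" "summable (\<lambda>k. \<integral>x. f k x \<partial>M)"
  shows "AE x in M. summable (\<lambda>k. f k x)"
proof -
  have [measurable]: "f k \<in> borel_measurable M" for k using assms(1) by blast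
  have "(\<integral>\<^sup>+x. (\<Sum>k. ennreal (f k x)) \<partial>M) = (\<Sum>k. \<integral>\<^sup>+x. ennreal (f k x) \<partial>M)"
    by (intro nn_integral_suminf) measurable
  also have "\<dots> = (\<Sum>k. ennreal (\<integral>x. f k x \<partial>M))"
    using assms by (simp add: nn_integral_eq_integral)
  also have "\<dots> \<noteq> \<infinity>"
    using assms by (subst suminf_ennreal2) (auto intro!: integral_nonneg)
  finally have "AE x in M. (\<Sum>k. ennreal (f k x)) \<noteq> \<infinity>"
    by (intro nn_integral_PInf_AE) measurable
  then show ?thesis
    by eventually_elim (use assms(2) in \<open>auto intro!: summable_suminf_not_top\<close>)
qed

text \<open>Normalizing the determinant lets Lebesgue measure on all matrices stand in for Haar measure.\<close>

definition nz :: "real^2^2 \<Rightarrow> real^2^2" where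
  "nz A = (if det A > 0 then (1 / sqrt (det A)) *\<^sub>R A else mat 1)"

lemma nz_mk: "a*d - b*c > 0 \<Longrightarrow> nz (mk a b c d) =
   mk (a / sqrt (a*d - b*c)) (b / sqrt (a*d - b*c)) (c / sqrt (a*d - b*c)) (d / sqrt (a*d - b*c))"
  by (simp add: nz_def vec_eq_iff forall_2)

lemma det_nz [simp]: "det (nz A) = 1"
proof (cases A rule: mk_cases)
  fix a b c d assume A: "A = mk a b c d"
  show ?thesis
  proof (cases "a*d - b*c > 0")
    case True
    then show ?thesis by (simp add: A nz_mk flip: diff_divide_distrib)
  next
    case False
    then show ?thesis by (simp add: A nz_def)
  qed
qed

lemma nz_id: "det A = 1 \<Longrightarrow> nz A = A" by (simp add: nz_def)

lemma nz_mult: "det A > 0 \<Longrightarrow> det B = 1 \<Longrightarrow> nz (A ** B) = nz A ** B"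
  by (simp add: nz_def det_mul scalar_matrix_assoc)

section \<open>Joint measurability and averages of translates\<close>

context sl2_quotient begin

text \<open>Measurability of each single translation does not give joint measurability in the group
  element and the point. Rounding the entries down to multiples of 1 / (n + 1) leaves only countably
  many matrices, each acting measurably; continuity of \<open>nz\<close> on positive determinants
  and the Lipschitz bound allow n to tend to infinity.\<close>

lemma BL_nz_measurable:
  assumes p: "BL p" and [measurable]: "a \<in> borel_measurable N" "b \<in> borel_measurable N"
    "c \<in> borel_measurable N" "d \<in> borel_measurable N" "q \<in> measurable N \<mu>"
  shows "(\<lambda>x. p (nz (mk (a x) (b x) (c x) (d x)) \<star> q x)) \<in> borel_measurable N"
proof -
  have [measurable]: "p \<in> borel_measurable \<mu>" by (rule BL_measurable[OF p])
  have qX: "q x \<in> X" if "x \<in> space N" for x using measurable_space[OF assms(6) that] by simp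
  define R :: "nat \<Rightarrow> real \<Rightarrow> real" where "R n v = real_of_int \<lfloor>real (Suc n) * v\<rfloor> / real (Suc n)" for n v
  have R: "(\<lambda>n. R n v) \<longlonglongrightarrow> v" for v
  proof (rule real_tendsto_sandwich)
    show "\<forall>\<^sub>F n in sequentially. v - inverse (real (Suc n)) \<le> R n v"
    proof (intro always_eventually allI)
      fix n
      have "real (Suc n) * v - 1 \<le> real_of_int \<lfloor>real (Suc n) * v\<rfloor>" by linarith
      then have "(real (Suc n) * v - 1) / real (Suc n) \<le> R n v" unfolding R_def by (rule divide_right_mono) simp
      then show "v - inverse (real (Suc n)) \<le> R n v" by (simp add: diff_divide_distrib inverse_eq_divide)
    qed
    show "\<forall>\<^sub>F n in sequentially. R n v \<le> v"
      unfolding R_def by (intro always_eventually allI) (simp add: field_simps)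
    show "(\<lambda>n. v - inverse (real (Suc n))) \<longlonglongrightarrow> v"
      using tendsto_diff[OF tendsto_const LIMSEQ_inverse_real_of_nat] by simp
  qed simp
  define T where "T x = p (nz (mk (a x) (b x) (c x) (d x)) \<star> q x)" for x
  define G where "G n x = p (nz (mk (R n (a x)) (R n (b x)) (R n (c x)) (R n (d x))) \<star> q x)" for n x
  have base: "(\<lambda>x. p (nz M \<star> q x)) \<in> borel_measurable N" for M
    by (rule measurable_compose[OF measurable_compose[OF assms(6) measurable_act[OF det_nz]] BL_measurable[OF p]])
  have fl: "(\<lambda>x. \<lfloor>real (Suc n) * v x\<rfloor>) \<in> measurable N (count_space UNIV)"
    if [measurable]: "v \<in> borel_measurable N" for v n by measurable
  have G[measurable]: "G n \<in> borel_measurable N" for n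
    unfolding G_def R_def
    by (rule measurable_compose_countable[OF _ fl[OF assms(2)]],
        rule measurable_compose_countable[OF _ fl[OF assms(3)]],
        rule measurable_compose_countable[OF _ fl[OF assms(4)]],
        rule measurable_compose_countable[OF _ fl[OF assms(5)]], rule base)
  define H where "H n x = (if a x * d x - b x * c x > 0 then G n x else p (q x))" for n x
  have "(\<lambda>n. H n x) \<longlonglongrightarrow> T x" if x: "x \<in> space N" for x
  proof (cases "a x * d x - b x * c x > 0")
    case True
    let ?a = "\<lambda>n. R n (a x)" and ?b = "\<lambda>n. R n (b x)" and ?c = "\<lambda>n. R n (c x)" and ?d = "\<lambda>n. R n (d x)"
    let ?A = "nz (mk (a x) (b x) (c x) (d x))" and ?B = "\<lambda>n. nz (mk (?a n) (?b n) (?c n) (?d n))"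
    let ?D = "\<lambda>n. ?a n * ?d n - ?b n * ?c n"
    have D: "?D \<longlonglongrightarrow> a x * d x - b x * c x" by (intro tendsto_intros R)
    then have ev: "\<forall>\<^sub>F n in sequentially. ?D n > 0" using True by (rule order_tendstoD)
    have "(\<lambda>n. dev (mk (?a n / sqrt (?D n)) (?b n / sqrt (?D n)) (?c n / sqrt (?D n)) (?d n / sqrt (?D n)) ** inv2 ?A)) \<longlonglongrightarrow>
        dev (mk (a x / sqrt (a x * d x - b x * c x)) (b x / sqrt (a x * d x - b x * c x)) (c x / sqrt (a x * d x - b x * c x)) (d x / sqrt (a x * d x - b x * c x)) ** inv2 ?A)"
      unfolding nz_mk[OF True] inv2_mk mk_mult dev_mk
      by (intro tendsto_intros R D) (use True in auto)
    also have "mk (a x / sqrt (a x * d x - b x * c x)) (b x / sqrt (a x * d x - b x * c x)) (c x / sqrt (a x * d x - b x * c x)) (d x / sqrt (a x * d x - b x * c x)) = ?A"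
      by (rule nz_mk[OF True, symmetric])
    also have "dev (?A ** inv2 ?A) = 0" by (simp add: inv2_right)
    finally have lim: "(\<lambda>n. dev (?B n ** inv2 ?A)) \<longlonglongrightarrow> 0"
      by (rule Lim_transform_eventually) (use ev in eventually_elim, simp add: nz_mk)
    obtain K where K: "\<And>y h. y \<in> X \<Longrightarrow> det h = 1 \<Longrightarrow> \<bar>p (h \<star> y) - p y\<bar> \<le> K * dev h"
      using BL_E[OF p] by metis
    have "norm (G n x - T x) \<le> K * dev (?B n ** inv2 ?A)" for n
      using K[of "?A \<star> q x" "?B n ** inv2 ?A"] qX[OF x] by (simp add: G_def T_def act_mult det_mul)
    then have "(\<lambda>n. G n x - T x) \<longlonglongrightarrow> 0"
      by (rule Lim_null_comparison[OF always_eventually[OF allI]]) (use tendsto_mult_right_zero[OF lim] in simp)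
    then show ?thesis using True by (simp add: H_def LIM_zero_cancel)
  next
    case False
    then show ?thesis by (simp add: H_def T_def nz_def)
  qed
  then have "T \<in> borel_measurable N"
    by (rule borel_measurable_LIMSEQ_real) (simp_all add: H_def)
  then show ?thesis by (simp add: T_def[abs_def])
qed

text \<open>These are the dyadic convex combinations of the translates of \<open>f\<close> by
  shears. Midpoints are all that the parallelogram law asks for, and the induction rule reduces a
  statement about averages to one shear and one midpoint.\<close>

inductive_set uhull :: "((real^2^2) set \<Rightarrow> real) \<Rightarrow> ((real^2^2) set \<Rightarrow> real) set" for f where
  base: "f \<in> uhull f"
| shift: "g \<in> uhull f \<Longrightarrow> (\<lambda>y. g (shear s \<star> y)) \<in> uhull f"
| mid: "g \<in> uhull f \<Longrightarrow> g' \<in> uhull f \<Longrightarrow> (\<lambda>y. (g y + g' y) / 2) \<in> uhull f"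

lemma BL_uhull: assumes "BL f" "g \<in> uhull f" shows "BL g"
  using assms(2)
proof induction
  case (mid g g')
  then show ?case using BL_cmult[OF BL_add, of g g' "1/2"] by simp
qed (auto intro: assms BL_act)

lemma uhull_bound: assumes "\<And>y. y \<in> X \<Longrightarrow> \<bar>f y\<bar> \<le> K" "g \<in> uhull f" "y \<in> X" shows "\<bar>g y\<bar> \<le> K"
  using assms(2,3)
proof (induction arbitrary: y)
  case (mid g g')
  have "\<bar>g y\<bar> \<le> K" "\<bar>g' y\<bar> \<le> K" using mid by auto
  then show ?case by (auto simp: abs_le_iff)
qed (auto intro: assms(1))

lemma uhull_integral: assumes "BL f" "g \<in> uhull f" shows "(\<integral>y. g y \<partial>\<mu>) = (\<integral>y. f y \<partial>\<mu>)"
  using assms(2)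
proof induction
  case (shift g s)
  then show ?case using integral_act[OF det_shear BL_measurable[OF BL_uhull[OF assms(1)]]] by simp
next
  case (mid g g')
  then show ?case using BL_integrable[OF BL_uhull[OF assms(1)]] by simp
qed simp

lemma BL_sq_integrable: assumes "BL f" shows "integrable \<mu> (\<lambda>y. (f y)\<^sup>2)"
proof -
  obtain K where K: "\<And>y. y \<in> X \<Longrightarrow> \<bar>f y\<bar> \<le> K" using BL_E[OF assms(1)] by metis
  have [measurable]: "f \<in> borel_measurable \<mu>" by (rule BL_measurable[OF assms])
  have "(f y)\<^sup>2 \<le> K\<^sup>2" if "y \<in> X" for y using power_mono[OF K[OF that], of 2] by simp
  then show ?thesis by (intro integrable_const_bound[of _ "K\<^sup>2"] AE_I2) auto
qed

text \<open>By the parallelogram law, as the hull is closed under midpoints.\<close>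

lemma uhull_near_minimal:
  assumes f: "BL f" and min: "\<And>g. g \<in> uhull f \<Longrightarrow> d \<le> (\<integral>y. (g y)\<^sup>2 \<partial>\<mu>)"
    and g: "g \<in> uhull f" "(\<integral>y. (g y)\<^sup>2 \<partial>\<mu>) \<le> d + \<eta>\<^sup>2"
    and g': "g' \<in> uhull f" "(\<integral>y. (g' y)\<^sup>2 \<partial>\<mu>) \<le> d + \<eta>\<^sup>2" and \<eta>: "\<eta> > 0"
  shows "(\<integral>y. \<bar>g y - g' y\<bar> \<partial>\<mu>) \<le> 3 * \<eta>"
proof -
  note BL_g = BL_uhull[OF f g(1)] BL_uhull[OF f g'(1)]
  note I = BL_sq_integrable[OF BL_g(1)] BL_sq_integrable[OF BL_g(2)]
  have BL_m: "BL (\<lambda>y. (g y + g' y) / 2)" using BL_uhull[OF f uhull.mid[OF g(1) g'(1)]] .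
  have BL_d: "BL (\<lambda>y. g y - g' y)" using BL_g by (rule BL_diff)
  have "(\<integral>y. (g y - g' y)\<^sup>2 \<partial>\<mu>) = (\<integral>y. 2 * (g y)\<^sup>2 + 2 * (g' y)\<^sup>2 - 4 * ((g y + g' y) / 2)\<^sup>2 \<partial>\<mu>)"
    by (intro arg_cong[where f="integral\<^sup>L \<mu>"]) (auto simp: fun_eq_iff power2_eq_square field_simps)
  also have "\<dots> = 2 * (\<integral>y. (g y)\<^sup>2 \<partial>\<mu>) + 2 * (\<integral>y. (g' y)\<^sup>2 \<partial>\<mu>) - 4 * (\<integral>y. ((g y + g' y) / 2)\<^sup>2 \<partial>\<mu>)"
    using I BL_sq_integrable[OF BL_m] by simp
  also have "\<dots> \<le> 4 * \<eta>\<^sup>2" using g g' min[OF uhull.mid[OF g(1) g'(1)]] by simp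
  finally have sq: "(\<integral>y. (g y - g' y)\<^sup>2 \<partial>\<mu>) \<le> 4 * \<eta>\<^sup>2" .
  \<comment> \<open>The inequality
    \<open>2 * \<bar>v\<bar> * \<eta> \<le> v\<^sup>2 + \<eta>\<^sup>2\<close> takes the place of
    the Cauchy-Schwarz inequality.\<close>
  have "(\<integral>y. \<bar>g y - g' y\<bar> \<partial>\<mu>) \<le> (\<integral>y. ((g y - g' y)\<^sup>2 / \<eta> + \<eta>) / 2 \<partial>\<mu>)"
  proof (rule integral_mono)
    show "integrable \<mu> (\<lambda>y. \<bar>g y - g' y\<bar>)" by (intro BL_integrable BL_abs BL_d)
    show "integrable \<mu> (\<lambda>y. ((g y - g' y)\<^sup>2 / \<eta> + \<eta>) / 2)" using BL_sq_integrable[OF BL_d] by simp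
    fix y
    have "0 \<le> (\<bar>g y - g' y\<bar> - \<eta>)\<^sup>2" by simp
    then have "2 * \<bar>g y - g' y\<bar> * \<eta> \<le> (g y - g' y)\<^sup>2 + \<eta>\<^sup>2" by (simp add: power2_diff)
    then show "\<bar>g y - g' y\<bar> \<le> ((g y - g' y)\<^sup>2 / \<eta> + \<eta>) / 2"
      using \<eta> by (simp add: field_simps power2_eq_square)
  qed
  also have "\<dots> = ((\<integral>y. (g y - g' y)\<^sup>2 \<partial>\<mu>) / \<eta> + \<eta>) / 2"
    using BL_sq_integrable[OF BL_d] prob_space by simp
  also have "\<dots> \<le> (4 * \<eta>\<^sup>2 / \<eta> + \<eta>) / 2" using \<eta> sq by (simp add: divide_right_mono)
  also have "\<dots> \<le> 3 * \<eta>" using \<eta> by (simp add: power2_eq_square)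
  finally show ?thesis .
qed

text \<open>The limit is taken pointwise, which keeps its composition with the action jointly measurable.\<close>

lemma uhull_cauchy_limit:
  assumes f: "BL f"
  obtains p K \<phi> where "\<And>k. p k \<in> uhull f" "\<And>y. y \<in> X \<Longrightarrow> \<bar>\<phi> y\<bar> \<le> K"
    "\<And>(N :: 'b measure) a b c d q. a \<in> borel_measurable N \<Longrightarrow> b \<in> borel_measurable N \<Longrightarrow>
       c \<in> borel_measurable N \<Longrightarrow> d \<in> borel_measurable N \<Longrightarrow> q \<in> measurable N \<mu> \<Longrightarrow>
       (\<lambda>x. \<phi> (nz (mk (a x) (b x) (c x) (d x)) \<star> q x)) \<in> borel_measurable N"
    "\<phi> \<in> borel_measurable \<mu>"
    "(\<lambda>k. \<integral>y. \<bar>p k y - \<phi> y\<bar> \<partial>\<mu>) \<longlonglongrightarrow> 0"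
    "\<And>r. AE y in \<mu>. \<phi> (shear r \<star> y) = \<phi> y"
proof -
  obtain K where K0: "K \<ge> 1" and K: "\<And>y. y \<in> X \<Longrightarrow> \<bar>f y\<bar> \<le> K" using BL_E[OF f] by metis
  define d where "d = Inf ((\<lambda>g. \<integral>y. (g y)\<^sup>2 \<partial>\<mu>) ` uhull f)"
  have bdd: "bdd_below ((\<lambda>g. \<integral>y. (g y)\<^sup>2 \<partial>\<mu>) ` uhull f)" by (rule bdd_belowI[of _ 0]) auto
  have min: "d \<le> (\<integral>y. (g y)\<^sup>2 \<partial>\<mu>)" if "g \<in> uhull f" for g
    unfolding d_def using that bdd by (intro cInf_lower) auto
  have ne: "(\<lambda>g. \<integral>y. (g y)\<^sup>2 \<partial>\<mu>) ` uhull f \<noteq> {}" using uhull.base by blast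
  \<comment> \<open>Geometric decay makes the L^1 norms of the increments of \<open>p\<close>
    summable, so that \<open>p\<close> itself converges almost everywhere and no subsequence has to
    be extracted.\<close>
  define \<eta> :: "nat \<Rightarrow> real" where "\<eta> k = (1/2) ^ k" for k
  have \<eta>: "\<eta> k > 0" "\<eta> (Suc k) \<le> \<eta> k" for k by (simp_all add: \<eta>_def)
  have "\<exists>g\<in>uhull f. (\<integral>y. (g y)\<^sup>2 \<partial>\<mu>) \<le> d + (\<eta> k)\<^sup>2" for k
  proof -
    have "d < d + (\<eta> k)\<^sup>2" using \<eta>(1)[of k] by simp
    then have "\<exists>v\<in>(\<lambda>g. \<integral>y. (g y)\<^sup>2 \<partial>\<mu>) ` uhull f. v < d + (\<eta> k)\<^sup>2"
      using cInf_lessD[OF ne] d_def by blast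
    then show ?thesis using less_imp_le by blast
  qed
  then obtain p where p: "\<And>k. p k \<in> uhull f" "\<And>k. (\<integral>y. (p k y)\<^sup>2 \<partial>\<mu>) \<le> d + (\<eta> k)\<^sup>2" by metis
  have BL_p: "BL (p k)" for k using BL_uhull[OF f p(1)] .
  have [measurable]: "p k \<in> borel_measurable \<mu>" for k by (rule BL_measurable[OF BL_p])
  have pK: "\<bar>p k y\<bar> \<le> K" if "y \<in> X" for k y by (rule uhull_bound[OF K p(1) that])
  have close: "(\<integral>y. \<bar>p (Suc k) y - p k y\<bar> \<partial>\<mu>) \<le> 3 * \<eta> k" for k
  proof (rule uhull_near_minimal[OF f min p(1) _ p(1) p(2) \<eta>(1)])
    have "(\<eta> (Suc k))\<^sup>2 \<le> (\<eta> k)\<^sup>2" using \<eta> less_imp_le by (intro power_mono) auto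
    then show "(\<integral>y. (p (Suc k) y)\<^sup>2 \<partial>\<mu>) \<le> d + (\<eta> k)\<^sup>2" using p(2)[of "Suc k"] by linarith
  qed
  have "AE y in \<mu>. summable (\<lambda>k. \<bar>p (Suc k) y - p k y\<bar>)"
  proof (rule L1_summable_AE)
    show "integrable \<mu> (\<lambda>y. \<bar>p (Suc k) y - p k y\<bar>)" for k by (intro BL_integrable BL_abs BL_diff BL_p)
    show "summable (\<lambda>k. \<integral>y. \<bar>p (Suc k) y - p k y\<bar> \<partial>\<mu>)"
    proof (rule summable_comparison_test')
      show "summable (\<lambda>k. 3 * \<eta> k)" unfolding \<eta>_def by (intro summable_mult summable_geometric) simp
      show "norm (\<integral>y. \<bar>p (Suc k) y - p k y\<bar> \<partial>\<mu>) \<le> 3 * \<eta> k" for k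
        using close[of k] by (simp add: integral_nonneg)
    qed
  qed simp
  then have conv: "AE y in \<mu>. convergent (\<lambda>k. p k y)"
  proof eventually_elim
    case (elim y)
    then have "summable (\<lambda>k. p (Suc k) y - p k y)" by (rule summable_rabs_cancel)
    then have "convergent (\<lambda>n. (\<Sum>k<n. p (Suc k) y - p k y) + p 0 y)"
      by (intro convergent_add convergent_const) (simp add: summable_iff_convergent)
    then show ?case unfolding sum_lessThan_telescope[of "\<lambda>k. p k y"] by simp
  qed
  \<comment> \<open>\<open>lim\<close> has an unspecified value where the sequence diverges.
    Truncation at \<open>K\<close> keeps the bound valid at every point and changes nothing where
    the limit exists.\<close>
  define \<phi> where "\<phi> y = max (- K) (min K (lim (\<lambda>k. p k y)))" for y
  have lim: "AE y in \<mu>. (\<lambda>k. p k y) \<longlonglongrightarrow> \<phi> y"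
    using conv AE_space
  proof eventually_elim
    case (elim y)
    then have "(\<lambda>k. p k y) \<longlonglongrightarrow> lim (\<lambda>k. p k y)" by (simp add: convergent_LIMSEQ_iff)
    then have "(\<lambda>k. max (- K) (min K (p k y))) \<longlonglongrightarrow> \<phi> y" unfolding \<phi>_def by (intro tendsto_intros)
    moreover have "max (- K) (min K (p k y)) = p k y" for k using pK[of y k] elim(2) by simp
    ultimately show ?case by simp
  qed
  have \<phi>K: "\<bar>\<phi> y\<bar> \<le> K" for y unfolding \<phi>_def using K0 by auto
  have \<phi>M[measurable]: "\<phi> \<in> borel_measurable \<mu>" unfolding \<phi>_def by measurable
  have lim1: "(\<lambda>k. \<integral>y. \<bar>p k y - \<phi> y\<bar> \<partial>\<mu>) \<longlonglongrightarrow> 0"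
  proof -
    have "(\<lambda>k. \<integral>y. \<bar>p k y - \<phi> y\<bar> \<partial>\<mu>) \<longlonglongrightarrow> (\<integral>y. 0 \<partial>\<mu>)"
    proof (rule integral_dominated_convergence[where w="\<lambda>_. 2 * K"])
      show "AE y in \<mu>. (\<lambda>k. \<bar>p k y - \<phi> y\<bar>) \<longlonglongrightarrow> 0"
        using lim by eventually_elim (auto intro: tendsto_rabs_zero simp: LIM_zero_iff)
      show "AE y in \<mu>. norm \<bar>p k y - \<phi> y\<bar> \<le> 2 * K" for k
      proof (rule AE_I2)
        fix y assume "y \<in> space \<mu>"
        then show "norm \<bar>p k y - \<phi> y\<bar> \<le> 2 * K" using pK[of y k] \<phi>K[of y] by auto
      qed
    qed auto
    then show ?thesis by simp
  qed
  have int\<phi>: "integrable \<mu> \<phi>" by (rule integrable_const_bound[of _ K]) (use \<phi>K in auto)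
  have inv: "AE y in \<mu>. \<phi> (shear r \<star> y) = \<phi> y" for r
  proof -
    note [measurable] = measurable_act[OF det_shear, of r]
    have [measurable]: "(\<lambda>y. \<phi> (shear r \<star> y)) \<in> borel_measurable \<mu>" by measurable
    have ir: "integrable \<mu> (\<lambda>y. \<phi> (shear r \<star> y))"
      by (rule integrable_const_bound[of _ K]) (use \<phi>K in auto)
    let ?e = "\<lambda>k. \<integral>y. \<bar>p k y - \<phi> y\<bar> \<partial>\<mu>"
    have "(\<integral>y. \<bar>\<phi> (shear r \<star> y) - \<phi> y\<bar> \<partial>\<mu>) \<le> ?e k + 3 * \<eta> k + ?e k" for k
    proof -
      have BLr: "BL (\<lambda>y. p k (shear r \<star> y))" by (rule BL_act[OF BL_p det_shear])
      have i1: "integrable \<mu> (\<lambda>y. \<bar>p k (shear r \<star> y) - \<phi> (shear r \<star> y)\<bar>)"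
        using BL_integrable[OF BLr] ir by auto
      have i2: "integrable \<mu> (\<lambda>y. \<bar>p k (shear r \<star> y) - p k y\<bar>)"
        using BL_integrable[OF BLr] BL_integrable[OF BL_p] by auto
      have i3: "integrable \<mu> (\<lambda>y. \<bar>p k y - \<phi> y\<bar>)"
        using BL_integrable[OF BL_p] int\<phi> by auto
      have "(\<integral>y. \<bar>\<phi> (shear r \<star> y) - \<phi> y\<bar> \<partial>\<mu>) \<le>
        (\<integral>y. \<bar>p k (shear r \<star> y) - \<phi> (shear r \<star> y)\<bar> + \<bar>p k (shear r \<star> y) - p k y\<bar> + \<bar>p k y - \<phi> y\<bar> \<partial>\<mu>)"
        using i1 i2 i3 ir int\<phi> by (intro integral_mono) auto
      also have "\<dots> = (\<integral>y. \<bar>p k (shear r \<star> y) - \<phi> (shear r \<star> y)\<bar> \<partial>\<mu>) + (\<integral>y. \<bar>p k (shear r \<star> y) - p k y\<bar> \<partial>\<mu>) + ?e k"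
        using i1 i2 i3 by simp
      also have "(\<integral>y. \<bar>p k (shear r \<star> y) - \<phi> (shear r \<star> y)\<bar> \<partial>\<mu>) = ?e k"
        by (rule integral_act[OF det_shear, of "\<lambda>y. \<bar>p k y - \<phi> y\<bar>"]) measurable
      \<comment> \<open>Here minimality produces invariance: the translate of \<open>p k\<close>
        belongs to the hull and has the same L^2 norm, so it is another near minimizer and must be
        close to \<open>p k\<close>.\<close>
      also have "(\<integral>y. \<bar>p k (shear r \<star> y) - p k y\<bar> \<partial>\<mu>) \<le> 3 * \<eta> k"
      proof (rule uhull_near_minimal[OF f min uhull.shift[OF p(1)] _ p(1) p(2) \<eta>(1)])
        have "(\<integral>y. (p k (shear r \<star> y))\<^sup>2 \<partial>\<mu>) = (\<integral>y. (p k y)\<^sup>2 \<partial>\<mu>)"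
          by (rule integral_act[OF det_shear, of "\<lambda>y. (p k y)\<^sup>2"]) measurable
        then show "(\<integral>y. (p k (shear r \<star> y))\<^sup>2 \<partial>\<mu>) \<le> d + (\<eta> k)\<^sup>2" using p(2) by simp
      qed
      finally show ?thesis by simp
    qed
    moreover have "(\<lambda>k. ?e k + 3 * \<eta> k + ?e k) \<longlonglongrightarrow> 0 + 3 * 0 + 0"
      unfolding \<eta>_def by (intro tendsto_intros lim1 LIMSEQ_power_zero) simp
    ultimately have "(\<integral>y. \<bar>\<phi> (shear r \<star> y) - \<phi> y\<bar> \<partial>\<mu>) \<le> 0"
      by (intro LIMSEQ_le_const[of "\<lambda>k. ?e k + 3 * \<eta> k + ?e k"]) auto
    then have "(\<integral>y. \<bar>\<phi> (shear r \<star> y) - \<phi> y\<bar> \<partial>\<mu>) = 0" by (intro antisym) auto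
    then show ?thesis using ir int\<phi> by (subst (asm) integral_nonneg_eq_0_iff_AE) auto
  qed
  show ?thesis
  proof (rule that[OF p(1) _ _ \<phi>M lim1 inv])
    show "\<bar>\<phi> y\<bar> \<le> K" for y by (rule \<phi>K)
    fix N :: "'b measure" and a b c d :: "'b \<Rightarrow> real" and q
    assume [measurable]: "a \<in> borel_measurable N" "b \<in> borel_measurable N"
       "c \<in> borel_measurable N" "d \<in> borel_measurable N" "q \<in> measurable N \<mu>"
    have [measurable]: "(\<lambda>x. p k (nz (mk (a x) (b x) (c x) (d x)) \<star> q x)) \<in> borel_measurable N" for k
      by (rule BL_nz_measurable[OF BL_p]) measurable
    show "(\<lambda>x. \<phi> (nz (mk (a x) (b x) (c x) (d x)) \<star> q x)) \<in> borel_measurable N"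
      unfolding \<phi>_def by measurable
  qed
qed

end

section \<open>From shear invariance to constancy\<close>

lemma AE_lborel_mult_right:
  fixes h :: "real^2^2" and P :: "real^2^2 \<Rightarrow> bool"
  assumes "AE A in lborel. P A" "det h = 1"
  shows "AE A in lborel. P (A ** h)"
proof -
  obtain N where N: "{A. \<not> P A} \<subseteq> N" "N \<in> null_sets lborel"
    using assms(1) by (auto simp: eventually_ae_filter)
  then have "negligible N" by (simp add: negligible_iff_null_sets null_sets_completionI)
  have lin: "linear (\<lambda>A :: real^2^2. A ** inv2 h)"
    by (rule linearI) (simp_all add: vec_eq_iff forall_2 matrix_matrix_mult_def sum_2 algebra_simps)
  have diff: "(\<lambda>A :: real^2^2. A ** inv2 h) differentiable_on N"
    by (rule linear_imp_differentiable_on[OF lin])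
  have "negligible ((\<lambda>A. A ** inv2 h) ` N)"
    using \<open>negligible N\<close> diff by (intro negligible_differentiable_image_negligible) auto
  moreover have "{A. \<not> P (A ** h)} \<subseteq> (\<lambda>A. A ** inv2 h) ` N"
  proof
    fix A assume "A \<in> {A. \<not> P (A ** h)}"
    then have "A ** h \<in> N" using N by auto
    moreover have "A = (A ** h) ** inv2 h" using assms(2) by (simp add: inv2_right flip: matrix_mul_assoc)
    ultimately show "A \<in> (\<lambda>A. A ** inv2 h) ` N" by blast
  qed
  ultimately have "AE A in lebesgue. P (A ** h)"
    using \<open>negligible ((\<lambda>A. A ** inv2 h) ` N)\<close>
    by (intro AE_I'[of "(\<lambda>A. A ** inv2 h) ` N"]) (auto simp: negligible_iff_null_sets)
  then show ?thesis by (simp add: AE_completion_iff)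
qed

context sl2_quotient begin

text \<open>Fubini turns almost everywhere invariance under each group element into invariance of one
  point under almost every group element.\<close>

lemma AE_invariant_imp_const:
  fixes \<phi> :: "(real^2^2) set \<Rightarrow> real"
  assumes joint: "\<And>N :: ((real^2^2) \<times> (real^2^2) set) measure. \<And>a b c d q. a \<in> borel_measurable N \<Longrightarrow> b \<in> borel_measurable N \<Longrightarrow>
       c \<in> borel_measurable N \<Longrightarrow> d \<in> borel_measurable N \<Longrightarrow> q \<in> measurable N \<mu> \<Longrightarrow>
       (\<lambda>x. \<phi> (nz (mk (a x) (b x) (c x) (d x)) \<star> q x)) \<in> borel_measurable N"
    and [measurable]: "\<phi> \<in> borel_measurable \<mu>"
    and inv: "\<And>g. det g = 1 \<Longrightarrow> AE y in \<mu>. \<phi> (g \<star> y) = \<phi> y"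
  obtains \<kappa> where "AE y in \<mu>. \<phi> y = \<kappa>"
proof -
  interpret P: pair_sigma_finite "lborel :: (real^2^2) measure" \<mu> ..
  have [measurable]: "(\<lambda>x. \<phi> (nz (fst x) \<star> snd x)) \<in> borel_measurable ((lborel :: (real^2^2) measure) \<Otimes>\<^sub>M \<mu>)"
  proof -
    have [measurable]: "(\<lambda>A :: real^2^2. A $ i $ j) \<in> borel_measurable lborel" for i j
      by (simp add: borel_measurable_continuous_onI continuous_intros)
    show ?thesis
      using joint[of "\<lambda>x. fst x $ 1 $ 1" "lborel \<Otimes>\<^sub>M \<mu>" "\<lambda>x. fst x $ 1 $ 2" "\<lambda>x. fst x $ 2 $ 1" "\<lambda>x. fst x $ 2 $ 2" snd]
      by (simp add: mk_eta)
  qed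
  have [measurable]: "Measurable.pred (lborel :: (real^2^2) measure) (\<lambda>A. 0 < det A)"
    unfolding det_2 by (intro borel_measurable_pred_less) (auto intro!: borel_measurable_continuous_onI continuous_intros)
  have "AE A in (lborel :: (real^2^2) measure). AE y in \<mu>. \<phi> (nz A \<star> y) = \<phi> y"
    by (intro AE_I2 inv) simp
  then have "AE y in \<mu>. AE A in lborel. \<phi> (nz A \<star> y) = \<phi> y"
    by (subst (asm) P.AE_commute) measurable
  then have "\<exists>y0\<in>X. AE A in lborel. \<phi> (nz A \<star> y0) = \<phi> y0"
  proof (rule contrapos_pp)
    assume none: "\<not> (\<exists>y0\<in>X. AE A in lborel. \<phi> (nz A \<star> y0) = \<phi> y0)"
    show "\<not> (AE y in \<mu>. AE A in lborel. \<phi> (nz A \<star> y) = \<phi> y)"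
    proof
      assume "AE y in \<mu>. AE A in lborel. \<phi> (nz A \<star> y) = \<phi> y"
      with AE_space have "AE y in \<mu>. False" by eventually_elim (use none in auto)
      then show False by simp
    qed
  qed
  then obtain y0 where y0: "y0 \<in> X" "AE A in lborel. \<phi> (nz A \<star> y0) = \<phi> y0" by blast
  define \<kappa> where "\<kappa> = \<phi> y0"
  \<comment> \<open>By transitivity y = h y0, and for positive determinant \<open>nz A\<close> acts
    on y as \<open>nz (A ** h)\<close> acts on y0. The exceptional matrices remain a null set under
    right multiplication by \<open>h\<close>.\<close>
  have "AE A in lborel. 0 < det A \<longrightarrow> \<phi> (nz A \<star> y) = \<kappa>" if y: "y \<in> X" for y
  proof -
    obtain h where h: "det h = 1" "y = h \<star> y0" by (rule transitive[OF y0(1) y])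
    have "AE A in lborel. \<phi> (nz (A ** h) \<star> y0) = \<kappa>"
      using AE_lborel_mult_right[OF y0(2) h(1)] by (simp add: \<kappa>_def)
    then show ?thesis by eventually_elim (use h in \<open>auto simp: nz_mult act_mult\<close>)
  qed
  then have "AE y in \<mu>. AE A in lborel. 0 < det A \<longrightarrow> \<phi> (nz A \<star> y) = \<kappa>" by (rule AE_I2) simp
  then have AE2: "AE A in lborel. AE y in \<mu>. 0 < det A \<longrightarrow> \<phi> (nz A \<star> y) = \<kappa>"
    by (subst P.AE_commute) measurable
  \<comment> \<open>The matrices of positive determinant form a nonempty open set, hence not a null
    set, so one of them is not exceptional. Its action preserves \<open>\<mu>\<close> and can be
    undone afterwards.\<close>
  have "\<exists>A. 0 < det A \<and> (AE y in \<mu>. \<phi> (nz A \<star> y) = \<kappa>)"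
  proof (rule ccontr)
    assume "\<not> ?thesis"
    then have "AE A in lborel. \<not> (0 < det (A :: real^2^2))" using AE2 by (auto elim!: eventually_mono)
    then obtain N where N: "{A :: real^2^2. 0 < det A} \<subseteq> N" "N \<in> null_sets lborel"
      by (auto simp: eventually_ae_filter)
    then have "negligible {A :: real^2^2. 0 < det A}"
      by (meson negligible_iff_null_sets negligible_subset null_sets_completionI)
    moreover have "open {A :: real^2^2. 0 < det A}"
      unfolding det_2 by (intro open_Collect_less continuous_intros)
    moreover have "mat 1 \<in> {A :: real^2^2. 0 < det A}" by simp
    ultimately show False using open_not_negligible by blast
  qed
  then obtain A where "AE y in \<mu>. \<phi> (nz A \<star> y) = \<kappa>" by blast
  then have "AE y in \<mu>. \<phi> (nz A \<star> (inv2 (nz A) \<star> y)) = \<kappa>"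
    by (rule AE_act[rotated]) simp
  then show ?thesis using that by simp
qed

text \<open>The Mautner phenomenon: matrices close to the identity generate diagonal matrices
  modulo the unipotent subgroup.\<close>

lemma shear_invariant_imp_invariant:
  assumes [measurable]: "\<phi> \<in> borel_measurable \<mu>" and K: "\<And>y. y \<in> X \<Longrightarrow> \<bar>\<phi> y\<bar> \<le> K"
    and p: "\<And>k. BL (p k)" and lim: "(\<lambda>k. \<integral>y. \<bar>p k y - \<phi> y\<bar> \<partial>\<mu>) \<longlonglongrightarrow> 0"
    and inv: "\<And>r. AE y in \<mu>. \<phi> (shear r \<star> y) = \<phi> y" and g: "det g = 1"
  shows "AE y in \<mu>. \<phi> (g \<star> y) = \<phi> y"
proof -
  \<comment> \<open>The L^1 displacement of \<open>\<phi>\<close>. Invariance of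
    \<open>\<mu>\<close> makes it subadditive on products. Shears contribute nothing, so an element
    vanishes under \<open>\<Delta>\<close> once it is a product of shears and of factors that can be
    made arbitrarily small.\<close>
  define \<Delta> where "\<Delta> g = (\<integral>y. \<bar>\<phi> (g \<star> y) - \<phi> y\<bar> \<partial>\<mu>)" for g
  have M[measurable]: "(\<lambda>y. \<phi> (g \<star> y)) \<in> borel_measurable \<mu>" if "det g = 1" for g
    using measurable_compose[OF measurable_act[OF that] assms(1)] .
  have I: "integrable \<mu> (\<lambda>y. \<phi> (g \<star> y))" if "det g = 1" for g
    by (rule integrable_const_bound[of _ K]) (use K that M in auto)
  have I0: "integrable \<mu> \<phi>" using I[of "mat 1"] by simp
  have nonneg: "\<Delta> g \<ge> 0" for g unfolding \<Delta>_def by simp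
  have tri: "\<Delta> (g ** h) \<le> \<Delta> g + \<Delta> h" if gh: "det g = 1" "det h = 1" for g h
  proof -
    have Igh: "integrable \<mu> (\<lambda>y. \<phi> (g \<star> h \<star> y))"
      using I[of "g ** h"] gh by (simp add: act_mult det_mul)
    have "\<Delta> (g ** h) \<le> (\<integral>y. \<bar>\<phi> (g \<star> h \<star> y) - \<phi> (h \<star> y)\<bar> + \<bar>\<phi> (h \<star> y) - \<phi> y\<bar> \<partial>\<mu>)"
      unfolding \<Delta>_def act_mult by (intro integral_mono) (use Igh I I0 gh in auto)
    also have "\<dots> = (\<integral>y. \<bar>\<phi> (g \<star> h \<star> y) - \<phi> (h \<star> y)\<bar> \<partial>\<mu>) + \<Delta> h"
      unfolding \<Delta>_def by (intro Bochner_Integration.integral_add) (use Igh I I0 gh in auto)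
    also have "(\<integral>y. \<bar>\<phi> (g \<star> h \<star> y) - \<phi> (h \<star> y)\<bar> \<partial>\<mu>) = \<Delta> g"
      unfolding \<Delta>_def by (rule integral_act[OF gh(2), of "\<lambda>y. \<bar>\<phi> (g \<star> y) - \<phi> y\<bar>"]) (use M[OF gh(1)] in measurable)
    finally show ?thesis .
  qed
  have u0: "\<Delta> (shear r) = 0" for r
    unfolding \<Delta>_def using I0 I[OF det_shear, of r] inv[of r]
    by (subst integral_nonneg_eq_0_iff_AE) auto
  \<comment> \<open>\<open>\<phi>\<close> is merely measurable; continuity of its displacement at
    the identity is inherited from a Lipschitz \<open>p k\<close>, and translating the approximation
    error costs nothing by invariance.\<close>
  have cont: "\<exists>\<delta>>0. \<forall>g. det g = 1 \<longrightarrow> dev g < \<delta> \<longrightarrow> \<Delta> g < \<epsilon>" if "\<epsilon> > 0" for \<epsilon>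
  proof -
    have "\<forall>\<^sub>F k in sequentially. (\<integral>y. \<bar>p k y - \<phi> y\<bar> \<partial>\<mu>) < \<epsilon> / 3"
      using lim \<open>\<epsilon> > 0\<close> by (intro order_tendstoD) auto
    then obtain k where k: "(\<integral>y. \<bar>p k y - \<phi> y\<bar> \<partial>\<mu>) < \<epsilon> / 3" by (auto simp: eventually_sequentially)
    obtain L where L: "L \<ge> 1" "\<And>y h. y \<in> X \<Longrightarrow> det h = 1 \<Longrightarrow> \<bar>p k (h \<star> y) - p k y\<bar> \<le> L * dev h"
      using BL_E[OF p[of k]] by metis
    have [measurable]: "p k \<in> borel_measurable \<mu>" by (rule BL_measurable[OF p])
    show ?thesis
    proof (intro exI[of _ "\<epsilon> / 3 / L"] conjI allI impI)
      show "0 < \<epsilon> / 3 / L" using \<open>\<epsilon> > 0\<close> L by simp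
      fix g :: "real^2^2" assume g: "det g = 1" and "dev g < \<epsilon> / 3 / L"
      then have dg: "L * dev g < \<epsilon> / 3" using L(1) by (simp add: field_simps)
      have Ip: "integrable \<mu> (p k)" "integrable \<mu> (\<lambda>y. p k (g \<star> y))"
        by (intro BL_integrable p BL_act g)+
      have "\<Delta> g \<le> (\<integral>y. \<bar>p k (g \<star> y) - \<phi> (g \<star> y)\<bar> + L * dev g + \<bar>p k y - \<phi> y\<bar> \<partial>\<mu>)"
        unfolding \<Delta>_def
      proof (rule integral_mono)
        fix y assume "y \<in> space \<mu>"
        then show "\<bar>\<phi> (g \<star> y) - \<phi> y\<bar> \<le> \<bar>p k (g \<star> y) - \<phi> (g \<star> y)\<bar> + L * dev g + \<bar>p k y - \<phi> y\<bar>"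
          using L(2)[of y g] g by auto
      qed (use Ip I[OF g] I0 in auto)
      also have "\<dots> = (\<integral>y. \<bar>p k (g \<star> y) - \<phi> (g \<star> y)\<bar> \<partial>\<mu>) + L * dev g + (\<integral>y. \<bar>p k y - \<phi> y\<bar> \<partial>\<mu>)"
        using Ip I[OF g] I0 prob_space by simp
      also have "(\<integral>y. \<bar>p k (g \<star> y) - \<phi> (g \<star> y)\<bar> \<partial>\<mu>) = (\<integral>y. \<bar>p k y - \<phi> y\<bar> \<partial>\<mu>)"
        by (rule integral_act[OF g, of "\<lambda>y. \<bar>p k y - \<phi> y\<bar>"]) measurable
      finally show "\<Delta> g < \<epsilon>" using k dg by linarith
    qed
  qed
  define v where "v s = mk 1 0 s 1" for s
  have det_v[simp]: "det (v s) = 1" for s by (simp add: v_def)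
  have vcont: "\<exists>\<delta>>0. \<forall>s. \<bar>s\<bar> < \<delta> \<longrightarrow> \<Delta> (v s) < \<epsilon>" if \<epsilon>: "\<epsilon> > 0" for \<epsilon>
  proof -
    obtain \<delta> where \<delta>: "\<delta> > 0" "\<And>g. det g = 1 \<Longrightarrow> dev g < \<delta> \<Longrightarrow> \<Delta> g < \<epsilon>" using cont[OF \<epsilon>] by blast
    have "dev (v s) = \<bar>s\<bar>" for s by (simp add: v_def)
    then show ?thesis using \<delta> det_v by metis
  qed
  have dg0: "\<Delta> (dg a) = 0" if a: "a \<noteq> 0" for a
  proof (rule ccontr)
    assume "\<Delta> (dg a) \<noteq> 0"
    then have pos: "\<Delta> (dg a) / 2 > 0" using nonneg[of "dg a"] by simp
    obtain \<delta> where \<delta>: "\<delta> > 0" "\<And>s. \<bar>s\<bar> < \<delta> \<Longrightarrow> \<Delta> (v s) < \<Delta> (dg a) / 2" using vcont[OF pos] by blast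
    \<comment> \<open>For every nonzero \<open>c\<close>, with q = (1 - a) / c, the product of
      \<open>v (- c / a)\<close>, \<open>shear (- q)\<close>, \<open>v c\<close> and
      \<open>shear (q / a)\<close> is \<open>dg a\<close>. The freedom in \<open>c\<close> is used
      to make both lower triangular factors cost less than half of \<open>\<Delta> (dg a)\<close>, a
      contradiction.\<close>
    define c where "c = min 1 \<bar>a\<bar> * \<delta> / 2"
    have c: "c \<noteq> 0" "\<bar>c\<bar> < \<delta>" "\<bar>- c / a\<bar> < \<delta>"
      using a \<delta>(1) unfolding c_def by (auto simp: abs_mult min_def field_simps)
    define q where "q = (1 - a) / c"
    have "dg a = v (- c / a) ** shear (- q) ** v c ** shear (q / a)"
      using a c(1) by (simp add: v_def dg_def shear_mk q_def field_simps)
    then have "\<Delta> (dg a) \<le> \<Delta> (v (- c / a)) + \<Delta> (shear (- q)) + \<Delta> (v c) + \<Delta> (shear (q / a))"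
      using tri[of "v (- c / a) ** shear (- q) ** v c" "shear (q / a)"]
        tri[of "v (- c / a) ** shear (- q)" "v c"] tri[of "v (- c / a)" "shear (- q)"]
      by (simp add: det_mul)
    then show False using u0 \<delta>(2)[OF c(2)] \<delta>(2)[OF c(3)] by simp
  qed
  have v0: "\<Delta> (v s) = 0" for s
  proof (rule ccontr)
    assume "\<Delta> (v s) \<noteq> 0"
    then have pos: "\<Delta> (v s) > 0" using nonneg[of "v s"] by simp
    obtain \<delta> where \<delta>: "\<delta> > 0" "\<And>r. \<bar>r\<bar> < \<delta> \<Longrightarrow> \<Delta> (v r) < \<Delta> (v s)" using vcont[OF pos] by blast
    \<comment> \<open>Conjugation by \<open>dg a\<close> shrinks the parameter of \<open>v\<close>
      by \<open>a\<^sup>2\<close> and is free because \<open>\<Delta>\<close> vanishes on diagonal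
      matrices; \<open>a\<close> is large enough to bring \<open>s / a\<^sup>2\<close> below
      \<open>\<delta>\<close>.\<close>
    define a where "a = 1 + \<bar>s\<bar> / \<delta>"
    have a: "a \<ge> 1" "\<bar>s\<bar> < a * \<delta>" using \<delta>(1) unfolding a_def by (auto simp: field_simps)
    have "a * \<delta> \<le> a\<^sup>2 * \<delta>" using a(1) \<delta>(1) by (simp add: power2_eq_square)
    then have small: "\<bar>s / a\<^sup>2\<bar> < \<delta>" using a by (simp add: field_simps)
    have "v s = dg (1 / a) ** v (s / a\<^sup>2) ** dg a"
      using a(1) by (simp add: v_def dg_def power2_eq_square)
    then have "\<Delta> (v s) \<le> \<Delta> (dg (1 / a)) + \<Delta> (v (s / a\<^sup>2)) + \<Delta> (dg a)"
      using tri[of "dg (1 / a) ** v (s / a\<^sup>2)" "dg a"] tri[of "dg (1 / a)" "v (s / a\<^sup>2)"] a(1)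
      by (simp add: det_mul)
    then show False using \<delta>(2)[OF small] dg0[of a] dg0[of "1 / a"] a(1) by simp
  qed
  have big: "\<Delta> (mk a b c d) = 0" if "a \<noteq> 0" "a * d - b * c = 1" for a b c d
  proof -
    have "mk a b c d = v (c / a) ** dg a ** shear (b / a)"
      using that by (simp add: v_def dg_def shear_mk field_simps)
    then have "\<Delta> (mk a b c d) \<le> \<Delta> (v (c / a)) + \<Delta> (dg a) + \<Delta> (shear (b / a))"
      using tri[of "v (c / a) ** dg a" "shear (b / a)"] tri[of "v (c / a)" "dg a"] that(1)
      by (simp add: det_mul)
    then show ?thesis using v0 dg0[OF that(1)] u0 nonneg[of "mk a b c d"] by simp
  qed
  have "\<Delta> g = 0"
  proof (cases g rule: mk_cases)
    fix a b c d assume g': "g = mk a b c d"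
    show ?thesis
    proof (cases "a = 0")
      case True
      then have bc: "- b * c = 1" using g g' by simp
      \<comment> \<open>A shear moves the nonzero entry \<open>c\<close> into the upper left corner,
        after which the triangular factorization of \<open>big\<close> applies.\<close>
      have "g = shear (-1) ** mk (a + c) (b + d) c d" by (simp add: g' shear_mk)
      moreover have "\<Delta> (mk (a + c) (b + d) c d) = 0"
        by (rule big) (use bc True in \<open>auto simp: algebra_simps\<close>)
      ultimately have "\<Delta> g \<le> 0"
        using tri[of "shear (-1)" "mk (a + c) (b + d) c d"] u0[of "-1"] bc True by (simp add: algebra_simps)
      then show ?thesis using nonneg[of g] by simp
    next
      case False
      then show ?thesis using big g g' by simp
    qed
  qed
  then show ?thesis
    unfolding \<Delta>_def using I[OF g] I0 by (subst (asm) integral_nonneg_eq_0_iff_AE) auto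
qed

text \<open>The almost everywhere constant limit is identified through integrals: every function of
  the hull has the same integral as \<open>f\<close>, so the constant can only be the mean.\<close>

lemma ex_uhull_close:
  assumes f: "BL f" and \<epsilon>: "\<epsilon> > 0"
  shows "\<exists>g\<in>uhull f. (\<integral>y. \<bar>g y - (\<integral>y. f y \<partial>\<mu>)\<bar> \<partial>\<mu>) < \<epsilon>"
proof -
  obtain p K \<phi> where p: "\<And>k. p k \<in> uhull f" and K: "\<And>y. y \<in> X \<Longrightarrow> \<bar>\<phi> y\<bar> \<le> K"
    and joint: "\<And>(N :: ((real^2^2) \<times> (real^2^2) set) measure) a b c d q. a \<in> borel_measurable N \<Longrightarrow> b \<in> borel_measurable N \<Longrightarrow>
       c \<in> borel_measurable N \<Longrightarrow> d \<in> borel_measurable N \<Longrightarrow> q \<in> measurable N \<mu> \<Longrightarrow>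
       (\<lambda>x. \<phi> (nz (mk (a x) (b x) (c x) (d x)) \<star> q x)) \<in> borel_measurable N"
    and M: "\<phi> \<in> borel_measurable \<mu>"
    and lim: "(\<lambda>k. \<integral>y. \<bar>p k y - \<phi> y\<bar> \<partial>\<mu>) \<longlonglongrightarrow> 0"
    and inv: "\<And>r. AE y in \<mu>. \<phi> (shear r \<star> y) = \<phi> y"
    by (rule uhull_cauchy_limit[OF f]) blast
  have BL_p: "BL (p k)" for k using BL_uhull[OF f p] .
  have "AE y in \<mu>. \<phi> (g \<star> y) = \<phi> y" if "det g = 1" for g
    by (rule shear_invariant_imp_invariant[OF M K BL_p lim inv that])
  then obtain \<kappa> where \<kappa>: "AE y in \<mu>. \<phi> y = \<kappa>"
    using AE_invariant_imp_const[OF joint M] by blast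
  have "(\<integral>y. \<bar>p k y - \<phi> y\<bar> \<partial>\<mu>) = (\<integral>y. \<bar>p k y - \<kappa>\<bar> \<partial>\<mu>)" for k
    using \<kappa> M BL_measurable[OF BL_p] by (intro integral_cong_AE) auto
  then have lim\<kappa>: "(\<lambda>k. \<integral>y. \<bar>p k y - \<kappa>\<bar> \<partial>\<mu>) \<longlonglongrightarrow> 0" using lim by simp
  have "\<bar>(\<integral>y. f y \<partial>\<mu>) - \<kappa>\<bar> \<le> (\<integral>y. \<bar>p k y - \<kappa>\<bar> \<partial>\<mu>)" for k
  proof -
    have "(\<integral>y. f y \<partial>\<mu>) - \<kappa> = (\<integral>y. p k y - \<kappa> \<partial>\<mu>)"
      using uhull_integral[OF f p[of k]] BL_integrable[OF BL_p[of k]] prob_space by simp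
    then show ?thesis by (simp add: integral_abs_bound)
  qed
  then have "\<bar>(\<integral>y. f y \<partial>\<mu>) - \<kappa>\<bar> \<le> 0"
    by (intro LIMSEQ_le_const[OF lim\<kappa>]) auto
  then have eq: "(\<integral>y. f y \<partial>\<mu>) = \<kappa>" by simp
  have "\<forall>\<^sub>F k in sequentially. (\<integral>y. \<bar>p k y - \<kappa>\<bar> \<partial>\<mu>) < \<epsilon>"
    using lim\<kappa> \<epsilon> by (rule order_tendstoD)
  then obtain k where "(\<integral>y. \<bar>p k y - \<kappa>\<bar> \<partial>\<mu>) < \<epsilon>" by (auto simp: eventually_sequentially)
  then show ?thesis unfolding eq using p by blast
qed

end

section \<open>Expanding horocycles\<close>

lemma integral_lipschitz_endpoint:
  fixes G :: "real \<Rightarrow> real"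
  assumes G: "continuous_on UNIV G" "\<And>s. \<bar>G s\<bar> \<le> M" and uv: "L \<le> u" "L \<le> v"
  shows "\<bar>integral {L..u} G - integral {L..v} G\<bar> \<le> M * \<bar>u - v\<bar>"
proof -
  have I: "G integrable_on {p..q}" for p q
    by (rule integrable_continuous_real) (rule continuous_on_subset[OF G(1)], simp)
  have *: "\<bar>integral {L..u} G - integral {L..v} G\<bar> \<le> M * \<bar>u - v\<bar>" if "L \<le> v" "v \<le> u" for u v
  proof -
    have "integral {L..v} G + integral {v..u} G = integral {L..u} G"
      using that I by (intro Henstock_Kurzweil_Integration.integral_combine) auto
    moreover have "norm (integral {v..u} G) \<le> M * (u - v)"
      using that G by (intro integral_bound continuous_on_subset[OF G(1)]) auto
    ultimately show ?thesis using that by simp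
  qed
  show ?thesis
  proof (cases "v \<le> u")
    case True then show ?thesis using *[of v u] uv by simp
  next
    case False
    then show ?thesis using *[of u v] uv by (simp add: abs_minus_commute)
  qed
qed

lemma integral_endpoints:
  fixes G :: "real \<Rightarrow> real"
  assumes G: "continuous_on UNIV G" "\<And>s. \<bar>G s\<bar> \<le> M" and "a \<le> b" "c \<le> d"
  shows "\<bar>integral {c..d} G - integral {a..b} G\<bar> \<le> M * (\<bar>c - a\<bar> + \<bar>d - b\<bar>)"
proof -
  have I: "G integrable_on {p..q}" for p q
    by (rule integrable_continuous_real) (rule continuous_on_subset[OF G(1)], simp)
  define L where "L = min a c"
  have "integral {L..c} G + integral {c..d} G = integral {L..d} G"
    "integral {L..a} G + integral {a..b} G = integral {L..b} G"
    using assms(3,4) I unfolding L_def by (auto intro!: Henstock_Kurzweil_Integration.integral_combine)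
  moreover have "\<bar>integral {L..d} G - integral {L..b} G\<bar> \<le> M * \<bar>d - b\<bar>"
    "\<bar>integral {L..c} G - integral {L..a} G\<bar> \<le> M * \<bar>c - a\<bar>"
    using assms(3,4) unfolding L_def by (auto intro!: integral_lipschitz_endpoint[OF G])
  ultimately show ?thesis by (simp add: distrib_left abs_le_iff)
qed

lemma integral_shift_bound:
  fixes G :: "real \<Rightarrow> real"
  assumes G: "continuous_on UNIV G" "\<And>s. \<bar>G s\<bar> \<le> M" and "a \<le> b"
  shows "\<bar>integral {a..b} (\<lambda>s. G (s + \<eta>)) - integral {a..b} G\<bar> \<le> 2 * M * \<bar>\<eta>\<bar>"
proof -
  have "integral {a..b} (\<lambda>s. G (s + \<eta>)) = integral {a + \<eta>..b + \<eta>} G"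
    using integral_shift[of a \<eta> b G] continuous_on_subset[OF G(1)] by (simp add: o_def)
  then show ?thesis using integral_endpoints[OF G, of a b "a + \<eta>" "b + \<eta>"] assms(3) by (simp add: algebra_simps)
qed

lemma integral_abs_diff_le:
  fixes G H :: "real \<Rightarrow> real"
  assumes "continuous_on {a..b} G" "continuous_on {a..b} H" "a \<le> b"
    "\<And>s. s \<in> {a..b} \<Longrightarrow> \<bar>G s - H s\<bar> \<le> C"
  shows "\<bar>integral {a..b} G - integral {a..b} H\<bar> \<le> C * (b - a)"
proof -
  have "integral {a..b} G - integral {a..b} H = integral {a..b} (\<lambda>s. G s - H s)"
    using assms by (intro integral_diff[symmetric] integrable_continuous_real)
  moreover have "norm (integral {a..b} (\<lambda>s. G s - H s)) \<le> C * (b - a)"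
    using assms by (intro integral_bound continuous_intros) auto
  ultimately show ?thesis by simp
qed

context sl2_quotient begin

lemma BL_continuous_on:
  assumes f: "BL f" and \<gamma>: "continuous_on S \<gamma>" "\<And>s. s \<in> S \<Longrightarrow> det (\<gamma> s) = 1" and x: "x \<in> X"
  shows "continuous_on S (\<lambda>s. f (\<gamma> s \<star> x))"
  unfolding continuous_on_def
proof
  fix s assume s: "s \<in> S"
  obtain K where K: "\<And>y h. y \<in> X \<Longrightarrow> det h = 1 \<Longrightarrow> \<bar>f (h \<star> y) - f y\<bar> \<le> K * dev h"
    using BL_E[OF f] by metis
  have "continuous_on S (\<lambda>s'. dev (\<gamma> s' ** inv2 (\<gamma> s)))" by (intro continuous_intros \<gamma>)
  then have "((\<lambda>s'. dev (\<gamma> s' ** inv2 (\<gamma> s))) \<longlongrightarrow> dev (\<gamma> s ** inv2 (\<gamma> s))) (at s within S)"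
    using s by (simp add: continuous_on_def)
  then have lim: "((\<lambda>s'. K * dev (\<gamma> s' ** inv2 (\<gamma> s))) \<longlongrightarrow> 0) (at s within S)"
    using \<gamma>(2)[OF s] by (intro tendsto_mult_right_zero) (simp add: inv2_right)
  have "\<forall>\<^sub>F s' in at s within S. norm (f (\<gamma> s' \<star> x) - f (\<gamma> s \<star> x)) \<le> K * dev (\<gamma> s' ** inv2 (\<gamma> s))"
    unfolding eventually_at_filter
  proof (intro always_eventually allI impI)
    fix s' assume "s' \<in> S"
    then show "norm (f (\<gamma> s' \<star> x) - f (\<gamma> s \<star> x)) \<le> K * dev (\<gamma> s' ** inv2 (\<gamma> s))"
      using K[of "\<gamma> s \<star> x" "\<gamma> s' ** inv2 (\<gamma> s)"] \<gamma>(2) s x by (simp add: act_mult det_mul)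
  qed
  then have "((\<lambda>s'. f (\<gamma> s' \<star> x) - f (\<gamma> s \<star> x)) \<longlongrightarrow> 0) (at s within S)"
    using lim by (rule Lim_null_comparison)
  then show "((\<lambda>s'. f (\<gamma> s' \<star> x)) \<longlongrightarrow> f (\<gamma> s \<star> x)) (at s within S)" by (rule LIM_zero_cancel)
qed

lemma continuous_on_mk [continuous_intros]:
  fixes a b c d :: "'a::topological_space \<Rightarrow> real"
  assumes "continuous_on S a" "continuous_on S b" "continuous_on S c" "continuous_on S d"
  shows "continuous_on S (\<lambda>x. mk (a x) (b x) (c x) (d x))"
proof -
  have "(\<lambda>x. mk (a x) (b x) (c x) (d x)) = (\<lambda>x. \<chi> i j. if i = 1 then (if j = 1 then a x else b x) else (if j = 1 then c x else d x))"
    by (auto simp: fun_eq_iff vec_eq_iff forall_2)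
  moreover have "continuous_on S (\<lambda>x. (\<chi> i j. if i = 1 then (if j = 1 then a x else b x) else (if j = 1 then c x else d x)) :: real^2^2)"
  proof (intro continuous_on_vec_lambda)
    fix i j :: 2
    show "continuous_on S (\<lambda>x. if i = 1 then (if j = 1 then a x else b x) else (if j = 1 then c x else d x))"
      by (cases "i = 1"; cases "j = 1"; simp add: assms)
  qed
  ultimately show ?thesis by (simp only:)
qed

lemma horo_continuous:
  assumes "BL f" "x \<in> X" "r \<noteq> 0"
  shows "continuous_on S (\<lambda>s. f (dg r \<star> shear s \<star> x))"
proof -
  have "continuous_on S (\<lambda>s. f ((dg r ** shear s) \<star> x))"
    by (rule BL_continuous_on[OF assms(1) _ _ assms(2)])
      (use assms(3) in \<open>auto simp: dg_def shear_mk intro!: continuous_intros\<close>)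
  then show ?thesis by (simp add: act_mult)
qed

text \<open>Since dg r ** shear s = shear (r^2 s) ** dg r, this runs along a horocycle of length r^2
  b through dg r x. It is not divided by \<open>b\<close>, so the expected limit is \<open>b\<close>
  times the mean.\<close>

definition horo_avg :: "real \<Rightarrow> real \<Rightarrow> ((real^2^2) set \<Rightarrow> real) \<Rightarrow> (real^2^2) set \<Rightarrow> real" where
  "horo_avg r b f x = integral {0..b} (\<lambda>s. f (dg r \<star> shear s \<star> x))"

text \<open>If \<open>h\<close> is close to \<open>1\<close>, then \<open>shear s ** h = Q s ** shear (\<sigma> s)\<close> with a lower triangular
  \<open>Q s\<close> close to \<open>1\<close>, which stays close to \<open>1\<close> under conjugation by \<open>dg r\<close>, and \<open>\<sigma>\<close> is a
  reparametrization close to the identity. Hence the estimate is uniform in \<open>r\<close>.\<close>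

lemma horo_equicont:
  assumes f: "BL f" and b: "b > 0"
  obtains C where "C > 0" "\<And>h x r. det h = 1 \<Longrightarrow> dev h * (1 + b) \<le> 1/2 \<Longrightarrow> x \<in> X \<Longrightarrow> r \<ge> 1 \<Longrightarrow>
     \<bar>horo_avg r b f (h \<star> x) - horo_avg r b f x\<bar> \<le> C * dev h"
proof -
  obtain K where K1: "K \<ge> 1" and KB: "\<And>y. y \<in> X \<Longrightarrow> \<bar>f y\<bar> \<le> K" and
    K: "\<And>y h. y \<in> X \<Longrightarrow> det h = 1 \<Longrightarrow> \<bar>f (h \<star> y) - f y\<bar> \<le> K * dev h"
    using BL_E[OF f] by metis
  \<comment> \<open>The factor 18 (1 + b)^2 absorbs three errors: dropping the triangular factor,
    inserting the Jacobian of the reparametrization, and moving the end points of the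
    interval.\<close>
  define C where "C = K * (18 * (1 + b)\<^sup>2)"
  have main: "\<bar>horo_avg r b f (h \<star> x) - horo_avg r b f x\<bar> \<le> C * dev h"
    if h: "det h = 1" "dev h * (1 + b) \<le> 1/2" and x: "x \<in> X" and r: "r \<ge> 1" for h x r
  proof (cases h rule: mk_cases)
    fix p q u v assume h': "h = mk p q u v"
    define \<delta> where "\<delta> = dev h"
    have \<delta>: "0 \<le> \<delta>" "\<delta> * (1 + b) \<le> 1/2" "\<bar>p - 1\<bar> \<le> \<delta>" "\<bar>q\<bar> \<le> \<delta>" "\<bar>u\<bar> \<le> \<delta>" "\<bar>v - 1\<bar> \<le> \<delta>"
      using h(2) by (auto simp: \<delta>_def h')
    have det: "p * v - q * u = 1" using h(1) h' by simp
    define e where "e = \<delta> * (1 + b)"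
    have e: "0 \<le> e" "e \<le> 1/2" using \<delta> b by (auto simp: e_def)
    define \<kappa> where "\<kappa> s = p + s * u" for s
    have \<kappa>e: "\<bar>\<kappa> s - 1\<bar> \<le> e" if "s \<in> {0..b}" for s
    proof -
      have "\<bar>s * u\<bar> \<le> b * \<delta>" unfolding abs_mult using that \<delta> by (intro mult_mono) auto
      then show ?thesis using \<delta>(3) by (simp add: \<kappa>_def e_def algebra_simps)
    qed
    have \<kappa>2: "\<kappa> s \<ge> 1/2" if "s \<in> {0..b}" for s using \<kappa>e[OF that] e by linarith
    define \<sigma> where "\<sigma> s = (q + s * v) / \<kappa> s" for s
    define F where "F s = f (dg r \<star> shear s \<star> x)" for s
    have Fc: "continuous_on S F" for S unfolding F_def using r by (intro horo_continuous f x) auto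
    have FK: "\<bar>F s\<bar> \<le> K" for s unfolding F_def using r x by (intro KB act_X) auto
    have \<sigma>c: "continuous_on {0..b} \<sigma>"
      unfolding \<sigma>_def \<kappa>_def by (intro continuous_intros) (use \<kappa>2 in \<open>force simp: \<kappa>_def\<close>)
    have F\<sigma>: "continuous_on {0..b} (\<lambda>s. F (\<sigma> s))"
      by (rule continuous_on_compose2[OF Fc[of UNIV] \<sigma>c]) simp
    have inv\<kappa>: "\<bar>1 / \<kappa> s - 1\<bar> \<le> 2 * e" if "s \<in> {0..b}" for s
    proof -
      have "\<bar>1 / \<kappa> s - 1\<bar> = \<bar>\<kappa> s - 1\<bar> / \<kappa> s" using \<kappa>2[OF that] by (simp add: field_simps abs_if)
      also have "\<dots> \<le> e / (1/2)" using \<kappa>2[OF that] \<kappa>e[OF that] by (intro frac_le) auto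
      finally show ?thesis by simp
    qed
    have 1: "\<bar>integral {0..b} (\<lambda>s. f (dg r \<star> shear s \<star> h \<star> x)) - integral {0..b} (\<lambda>s. F (\<sigma> s))\<bar> \<le> (K * (3 * e + \<delta>)) * (b - 0)"
    proof (rule integral_abs_diff_le[OF _ F\<sigma>])
      show "continuous_on {0..b} (\<lambda>s. f (dg r \<star> shear s \<star> h \<star> x))"
        using r x h by (intro horo_continuous f act_X) auto
      fix s assume s: "s \<in> {0..b}"
      have k0: "\<kappa> s \<noteq> 0" using \<kappa>2[OF s] by auto
      define Q where "Q = mk (\<kappa> s) 0 (u / r\<^sup>2) (1 / \<kappa> s)"
      have detQ: "det Q = 1" using k0 by (simp add: Q_def)
      have "dg r ** shear s ** h = Q ** dg r ** shear (\<sigma> s)"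
      proof -
        have e2: "q + s * v = \<kappa> s * \<sigma> s" using k0 by (simp add: \<sigma>_def)
        have e4: "v = u * \<sigma> s + 1 / \<kappa> s"
          using k0 det by (simp add: \<sigma>_def field_simps) (simp add: \<kappa>_def algebra_simps)
        have "dg r ** shear s ** h = mk (r * \<kappa> s) (r * (q + s * v)) (u / r) (v / r)"
          by (simp add: h' dg_def shear_mk \<kappa>_def algebra_simps)
        also have "\<dots> = Q ** dg r ** shear (\<sigma> s)"
          unfolding e2 using r by (subst e4) (simp add: Q_def dg_def shear_mk power2_eq_square add_divide_distrib)
        finally show ?thesis .
      qed
      then have eq: "dg r \<star> shear s \<star> h \<star> x = Q \<star> dg r \<star> shear (\<sigma> s) \<star> x"
        by (metis act_mult)
      have "\<bar>f (dg r \<star> shear s \<star> h \<star> x) - F (\<sigma> s)\<bar> \<le> K * dev Q"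
        unfolding eq F_def using r x by (intro K detQ act_X) auto
      also have "dev Q \<le> 3 * e + \<delta>"
      proof -
        have "\<bar>u / r\<^sup>2\<bar> \<le> \<delta> / 1"
          unfolding abs_divide using \<delta> r by (intro frac_le) auto
        then show ?thesis using \<kappa>e[OF s] inv\<kappa>[OF s] by (simp add: Q_def)
      qed
      finally show "\<bar>f (dg r \<star> shear s \<star> h \<star> x) - F (\<sigma> s)\<bar> \<le> K * (3 * e + \<delta>)"
        using K1 by (simp add: mult_left_mono)
    qed (use b in simp)
    have ink: "\<bar>(1 / \<kappa> s)\<^sup>2 - 1\<bar> \<le> 10 * e" if "s \<in> {0..b}" for s
    proof -
      have "(1 / \<kappa> s)\<^sup>2 - 1 = (1 / \<kappa> s - 1) * (1 / \<kappa> s + 1)" by (simp add: power2_eq_square algebra_simps)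
      moreover have "\<bar>1 / \<kappa> s + 1\<bar> \<le> 3"
        using \<kappa>2[OF that] by (auto simp: abs_le_iff field_simps)
      ultimately have "\<bar>(1 / \<kappa> s)\<^sup>2 - 1\<bar> \<le> 2 * e * 3"
        unfolding abs_mult using inv\<kappa>[OF that] e by (simp only: abs_mult) (intro mult_mono, auto)
      then show ?thesis using e by linarith
    qed
    \<comment> \<open>The weight is the derivative of \<open>\<sigma>\<close>: since
      \<open>h\<close> has determinant one, the numerator in the quotient rule is one. Inserting it
      turns the integral into one over the interval from \<open>\<sigma> 0\<close> to
      \<open>\<sigma> b\<close>.\<close>
    have cont2: "continuous_on {0..b} (\<lambda>s. (1 / \<kappa> s)\<^sup>2 *\<^sub>R F (\<sigma> s))"
      unfolding \<kappa>_def by (intro continuous_intros F\<sigma>) (use \<kappa>2 in \<open>force simp: \<kappa>_def\<close>)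
    have 2: "\<bar>integral {0..b} (\<lambda>s. (1 / \<kappa> s)\<^sup>2 *\<^sub>R F (\<sigma> s)) - integral {0..b} (\<lambda>s. F (\<sigma> s))\<bar> \<le> (10 * e * K) * (b - 0)"
    proof (rule integral_abs_diff_le[OF cont2 F\<sigma>])
      fix s assume s: "s \<in> {0..b}"
      have "\<bar>(1 / \<kappa> s)\<^sup>2 *\<^sub>R F (\<sigma> s) - F (\<sigma> s)\<bar> = \<bar>(1 / \<kappa> s)\<^sup>2 - 1\<bar> * \<bar>F (\<sigma> s)\<bar>"
        by (simp add: algebra_simps flip: abs_mult)
      also have "\<dots> \<le> 10 * e * K" using ink[OF s] FK e by (intro mult_mono) auto
      finally show "\<bar>(1 / \<kappa> s)\<^sup>2 *\<^sub>R F (\<sigma> s) - F (\<sigma> s)\<bar> \<le> 10 * e * K" .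
    qed (use b in simp)
    have \<sigma>0: "\<bar>\<sigma> 0\<bar> \<le> 2 * \<delta>"
    proof -
      have "\<bar>\<sigma> 0\<bar> = \<bar>q\<bar> / \<kappa> 0" using \<kappa>2[of 0] b by (simp add: \<sigma>_def)
      also have "\<dots> \<le> \<delta> / (1/2)" using \<kappa>2[of 0] b \<delta> by (intro frac_le) auto
      finally show ?thesis by simp
    qed
    have \<sigma>b: "\<bar>\<sigma> b - b\<bar> \<le> 2 * ((1 + b)\<^sup>2 * \<delta>)"
    proof -
      have kb: "\<kappa> b \<ge> 1/2" using \<kappa>2[of b] b by simp
      have "\<sigma> b - b = (q + b * (v - 1) - b * (p - 1) - b\<^sup>2 * u) / \<kappa> b"
        using kb by (simp add: \<sigma>_def field_simps) (simp add: \<kappa>_def algebra_simps power2_eq_square)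
      then have "\<bar>\<sigma> b - b\<bar> = \<bar>q + b * (v - 1) - b * (p - 1) - b\<^sup>2 * u\<bar> / \<kappa> b" using kb by simp
      also have "\<dots> \<le> ((1 + b)\<^sup>2 * \<delta>) / (1/2)"
      proof (rule frac_le)
        have "\<bar>b * (v - 1)\<bar> \<le> b * \<delta>" "\<bar>b * (p - 1)\<bar> \<le> b * \<delta>" "\<bar>b\<^sup>2 * u\<bar> \<le> b\<^sup>2 * \<delta>"
          unfolding abs_mult using \<delta> b by (auto intro!: mult_mono)
        then have "\<bar>q + b * (v - 1) - b * (p - 1) - b\<^sup>2 * u\<bar> \<le> \<delta> + b * \<delta> + b * \<delta> + b\<^sup>2 * \<delta>" using \<delta>(4) by linarith
        also have "\<dots> = (1 + b)\<^sup>2 * \<delta>" by (simp add: power2_eq_square algebra_simps)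
        finally show "\<bar>q + b * (v - 1) - b * (p - 1) - b\<^sup>2 * u\<bar> \<le> (1 + b)\<^sup>2 * \<delta>" .
      qed (use kb \<delta> in auto)
      finally show ?thesis by simp
    qed
    have der: "(\<sigma> has_field_derivative (1 / \<kappa> s)\<^sup>2) (at s within S)" if "s \<in> {0..b}" for s S
    proof -
      have k0: "p + s * u \<noteq> 0" using \<kappa>2[OF that] by (auto simp: \<kappa>_def)
      have "((\<lambda>s. (q + s * v) / (p + s * u)) has_field_derivative
          (v * (p + s * u) - (q + s * v) * u) / ((p + s * u) * (p + s * u))) (at s within S)"
        using k0 by (auto intro!: derivative_eq_intros)
      moreover have "v * (p + s * u) - (q + s * v) * u = 1" using det by (simp add: algebra_simps)
      ultimately show ?thesis unfolding \<sigma>_def \<kappa>_def by (simp add: power2_eq_square)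
    qed
    have mono: "\<sigma> 0 \<le> \<sigma> s" "\<sigma> s \<le> \<sigma> b" if s: "s \<in> {0..b}" for s
    proof -
      have "\<sigma> s' \<le> \<sigma> s''" if "0 \<le> s'" "s' \<le> s''" "s'' \<le> b" for s' s''
      proof (rule DERIV_nonneg_imp_nondecreasing[OF that(2)])
        fix s assume "s' \<le> s" "s \<le> s''"
        then show "\<exists>y. (\<sigma> has_real_derivative y) (at s) \<and> 0 \<le> y"
          using der[of s UNIV] that by (intro exI[of _ "(1 / \<kappa> s)\<^sup>2"]) auto
      qed
      then show "\<sigma> 0 \<le> \<sigma> s" "\<sigma> s \<le> \<sigma> b" using s by auto
    qed
    have "((\<lambda>s. (1 / \<kappa> s)\<^sup>2 *\<^sub>R F (\<sigma> s)) has_integral (integral {\<sigma> 0..\<sigma> b} F)) {0..b}"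
      by (rule has_integral_substitution[of 0 b \<sigma> "\<sigma> 0" "\<sigma> b"]) (use b mono der Fc in auto)
    then have sub: "integral {0..b} (\<lambda>s. (1 / \<kappa> s)\<^sup>2 *\<^sub>R F (\<sigma> s)) = integral {\<sigma> 0..\<sigma> b} F"
      by (rule integral_unique)
    have 3: "\<bar>integral {\<sigma> 0..\<sigma> b} F - integral {0..b} F\<bar> \<le> K * (\<bar>\<sigma> 0 - 0\<bar> + \<bar>\<sigma> b - b\<bar>)"
      by (rule integral_endpoints[OF Fc FK]) (use b mono[of b] in auto)
    have "\<bar>horo_avg r b f (h \<star> x) - horo_avg r b f x\<bar> \<le>
        (K * (3 * e + \<delta>)) * b + (10 * e * K) * b + K * (2 * \<delta> + 2 * ((1 + b)\<^sup>2 * \<delta>))"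
    proof -
      have "K * (\<bar>\<sigma> 0 - 0\<bar> + \<bar>\<sigma> b - b\<bar>) \<le> K * (2 * \<delta> + 2 * ((1 + b)\<^sup>2 * \<delta>))"
        using \<sigma>0 \<sigma>b K1 by (intro mult_left_mono) auto
      moreover have "horo_avg r b f x = integral {0..b} F" by (simp add: horo_avg_def F_def[abs_def])
      moreover have "horo_avg r b f (h \<star> x) = integral {0..b} (\<lambda>s. f (dg r \<star> shear s \<star> h \<star> x))"
        by (simp add: horo_avg_def)
      ultimately show ?thesis using 1 2[unfolded sub] 3 unfolding diff_zero by linarith
    qed
    also have "\<dots> = K * \<delta> * (13 * ((1 + b) * b) + b + 2 + 2 * (1 + b)\<^sup>2)"
      by (simp add: e_def algebra_simps)
    also have "\<dots> \<le> K * \<delta> * (18 * (1 + b)\<^sup>2)"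
      using K1 \<delta> b by (intro mult_left_mono) (auto simp: power2_eq_square algebra_simps)
    finally show ?thesis by (simp add: C_def \<delta>_def mult_ac)
  qed
  have "C > 0" unfolding C_def using K1 b by (intro mult_pos_pos zero_less_power) auto
  with main show ?thesis using that by blast
qed

text \<open>A shear applied after \<open>dg r\<close> is a shear by s / r^2 before it, so the two
  averages differ only by end pieces of that length. The constant depends on \<open>g\<close> but
  not on the base point, as the estimate will be used at a point about which nothing but its
  neighbourhood is known.\<close>

lemma horo_avg_uhull:
  assumes f: "BL f" and g: "g \<in> uhull f" and b: "b > 0"
  shows "\<exists>C>0. \<forall>r\<ge>1. \<forall>x\<in>X. \<bar>horo_avg r b f x - horo_avg r b g x\<bar> \<le> C / r\<^sup>2"
  using g
proof induction
  case base
  show ?case by (rule exI[of _ 1]) simp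
next
  case (shift g s)
  then obtain C where C: "C > 0" "\<And>r x. r \<ge> 1 \<Longrightarrow> x \<in> X \<Longrightarrow> \<bar>horo_avg r b f x - horo_avg r b g x\<bar> \<le> C / r\<^sup>2" by blast
  have BLg: "BL g" by (rule BL_uhull[OF f shift(1)])
  obtain K where K1: "K \<ge> 1" and K: "\<And>y. y \<in> X \<Longrightarrow> \<bar>g y\<bar> \<le> K" using BL_E[OF BLg] by metis
  show ?case
  proof (intro exI[of _ "C + 2 * K * \<bar>s\<bar>"] conjI allI ballI impI)
    show "C + 2 * K * \<bar>s\<bar> > 0" using C K1 by (intro add_pos_nonneg) auto
    fix r x assume r: "(1::real) \<le> r" and x: "x \<in> X"
    define G where "G t = g (dg r \<star> shear t \<star> x)" for t
    have "shear s ** dg r = dg r ** shear (s / r\<^sup>2)" using r by (simp add: dg_def shear_mk power2_eq_square)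
    then have sh: "shear s \<star> dg r \<star> shear t \<star> x = dg r \<star> shear (t + s / r\<^sup>2) \<star> x" for t
    proof -
      have "shear s \<star> dg r \<star> shear t \<star> x = (shear s ** dg r) \<star> shear t \<star> x" by (rule act_mult[symmetric])
      also have "\<dots> = dg r \<star> (shear (s / r\<^sup>2) ** shear t) \<star> x"
        unfolding \<open>shear s ** dg r = dg r ** shear (s / r\<^sup>2)\<close> act_mult by (rule refl)
      finally show ?thesis by (simp add: add.commute flip: shear_add)
    qed
    have "\<bar>integral {0..b} (\<lambda>t. G (t + s / r\<^sup>2)) - integral {0..b} G\<bar> \<le> 2 * K * \<bar>s / r\<^sup>2\<bar>"
    proof (rule integral_shift_bound)
      show "continuous_on UNIV G" unfolding G_def using r by (intro horo_continuous BLg x) auto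
      show "\<bar>G t\<bar> \<le> K" for t unfolding G_def using r x by (intro K act_X) auto
    qed (use b in simp)
    then have "\<bar>horo_avg r b (\<lambda>y. g (shear s \<star> y)) x - horo_avg r b g x\<bar> \<le> 2 * K * \<bar>s\<bar> / r\<^sup>2"
      unfolding horo_avg_def sh G_def by (simp add: abs_divide)
    then show "\<bar>horo_avg r b f x - horo_avg r b (\<lambda>y. g (shear s \<star> y)) x\<bar> \<le> (C + 2 * K * \<bar>s\<bar>) / r\<^sup>2"
      using C(2)[OF r x] unfolding add_divide_distrib by linarith
  qed
next
  case (mid g g')
  then obtain C C' where C: "C > 0" "\<And>r x. r \<ge> 1 \<Longrightarrow> x \<in> X \<Longrightarrow> \<bar>horo_avg r b f x - horo_avg r b g x\<bar> \<le> C / r\<^sup>2"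
    and C': "C' > 0" "\<And>r x. r \<ge> 1 \<Longrightarrow> x \<in> X \<Longrightarrow> \<bar>horo_avg r b f x - horo_avg r b g' x\<bar> \<le> C' / r\<^sup>2" by blast
  show ?case
  proof (intro exI[of _ "C + C'"] conjI allI ballI impI)
    show "C + C' > 0" using C C' by simp
    fix r x assume r: "(1::real) \<le> r" and x: "x \<in> X"
    have "(\<lambda>t. g (dg r \<star> shear t \<star> x)) integrable_on {0..b}" "(\<lambda>t. g' (dg r \<star> shear t \<star> x)) integrable_on {0..b}"
      using r by (auto intro!: integrable_continuous_real horo_continuous BL_uhull[OF f mid(1)] BL_uhull[OF f mid(2)] x)
    then have "horo_avg r b (\<lambda>y. (g y + g' y) / 2) x = (horo_avg r b g x + horo_avg r b g' x) / 2"
      unfolding horo_avg_def by (simp add: integral_add)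
    then have "\<bar>horo_avg r b f x - horo_avg r b (\<lambda>y. (g y + g' y) / 2) x\<bar>
        \<le> \<bar>horo_avg r b f x - horo_avg r b g x\<bar> + \<bar>horo_avg r b f x - horo_avg r b g' x\<bar>"
      by (simp add: abs_if field_simps)
    also have "\<dots> \<le> C / r\<^sup>2 + C' / r\<^sup>2" by (intro add_mono C C' r x)
    finally show "\<bar>horo_avg r b f x - horo_avg r b (\<lambda>y. (g y + g' y) / 2) x\<bar> \<le> (C + C') / r\<^sup>2"
      by (simp add: add_divide_distrib)
  qed
qed

text \<open>Fubini together with the fact that for each fixed \<open>s\<close> the map of the space
  given by \<open>dg r ** shear s\<close> preserves \<open>\<mu>\<close>. The nonnegative integral
  allows comparison with the measure of a neighbourhood without integrability conditions.\<close>

lemma horo_L1: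
  assumes g: "BL g" and b: "b > 0" and r: "r > 0"
  shows "(\<lambda>x. ennreal (horo_avg r b (\<lambda>y. \<bar>g y - c\<bar>) x)) \<in> borel_measurable \<mu>"
    and "(\<integral>\<^sup>+x. ennreal (horo_avg r b (\<lambda>y. \<bar>g y - c\<bar>) x) \<partial>\<mu>) = ennreal (b * (\<integral>y. \<bar>g y - c\<bar> \<partial>\<mu>))"
proof -
  define k where "k = (\<lambda>y. \<bar>g y - c\<bar>)"
  have k: "BL k" unfolding k_def by (intro BL_abs BL_diff BL_const g)
  interpret P: pair_sigma_finite "lborel :: real measure" \<mu> ..
  have "(\<lambda>z. k (nz (mk r (r * fst z) 0 (1 / r)) \<star> snd z)) \<in> borel_measurable (lborel \<Otimes>\<^sub>M \<mu>)"
    by (rule BL_nz_measurable[OF k]) measurable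
  moreover have "nz (mk r (r * s) 0 (1 / r)) = dg r ** shear s" for s
    using r by (simp add: nz_id) (simp add: dg_def shear_mk)
  ultimately have [measurable]: "(\<lambda>z. k (dg r \<star> shear (fst z) \<star> snd z)) \<in> borel_measurable (lborel \<Otimes>\<^sub>M \<mu>)"
    by (simp add: act_mult)
  define F where "F = (\<lambda>z. ennreal (k (dg r \<star> shear (fst z) \<star> snd z)) * indicator {0..b} (fst z))"
  have [measurable]: "F \<in> borel_measurable (lborel \<Otimes>\<^sub>M \<mu>)" unfolding F_def by measurable
  have eq: "ennreal (horo_avg r b k x) = (\<integral>\<^sup>+s. F (s, x) \<partial>lborel)" if x: "x \<in> X" for x
  proof -
    have c: "continuous_on {0..b} (\<lambda>s. k (dg r \<star> shear s \<star> x))"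
      using r by (intro horo_continuous k x) auto
    have "((\<lambda>s. k (dg r \<star> shear s \<star> x)) has_integral horo_avg r b k x) {0..b}"
      unfolding horo_avg_def by (intro integrable_integral integrable_continuous_real c)
    then have "(\<integral>\<^sup>+s. ennreal (k (dg r \<star> shear s \<star> x)) * indicator {0..b} s \<partial>lborel) = ennreal (horo_avg r b k x)"
      by (intro nn_integral_has_integral_lebesgue') (auto simp: k_def)
    then show ?thesis by (simp add: F_def)
  qed
  show "(\<lambda>x. ennreal (horo_avg r b (\<lambda>y. \<bar>g y - c\<bar>) x)) \<in> borel_measurable \<mu>"
  proof (subst measurable_cong)
    show "ennreal (horo_avg r b (\<lambda>y. \<bar>g y - c\<bar>) x) = (\<integral>\<^sup>+s. F (s, x) \<partial>lborel)" if "x \<in> space \<mu>" for x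
      using eq[of x] that by (simp add: k_def)
  qed measurable
  have "(\<integral>\<^sup>+x. ennreal (horo_avg r b k x) \<partial>\<mu>) = (\<integral>\<^sup>+x. \<integral>\<^sup>+s. F (s, x) \<partial>lborel \<partial>\<mu>)"
    by (intro nn_integral_cong) (simp add: eq)
  also have "\<dots> = (\<integral>\<^sup>+s. \<integral>\<^sup>+x. F (s, x) \<partial>\<mu> \<partial>lborel)"
    by (rule P.Fubini') simp
  also have "\<dots> = (\<integral>\<^sup>+s. ennreal (\<integral>y. k y \<partial>\<mu>) * indicator {0..b} s \<partial>lborel)"
  proof (intro nn_integral_cong)
    fix s :: real
    have BLs: "BL (\<lambda>y. k ((dg r ** shear s) \<star> y))" using r by (intro BL_act[OF k]) (simp add: det_mul)
    have "(\<integral>\<^sup>+x. ennreal (k ((dg r ** shear s) \<star> x)) \<partial>\<mu>) = ennreal (\<integral>x. k ((dg r ** shear s) \<star> x) \<partial>\<mu>)"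
      by (intro nn_integral_eq_integral BL_integrable[OF BLs]) (simp add: k_def)
    also have "(\<integral>x. k ((dg r ** shear s) \<star> x) \<partial>\<mu>) = (\<integral>y. k y \<partial>\<mu>)"
      using r by (intro integral_act BL_measurable k) (simp add: det_mul)
    finally have "(\<integral>\<^sup>+x. ennreal (k (dg r \<star> shear s \<star> x)) \<partial>\<mu>) = ennreal (\<integral>y. k y \<partial>\<mu>)" by (simp add: act_mult)
    then show "(\<integral>\<^sup>+x. F (s, x) \<partial>\<mu>) = ennreal (\<integral>y. k y \<partial>\<mu>) * indicator {0..b} s"
      by (auto simp: F_def split: split_indicator)
  qed
  also have "\<dots> = ennreal (\<integral>y. k y \<partial>\<mu>) * ennreal b"
    using b by (subst nn_integral_cmult_indicator) auto
  also have "\<dots> = ennreal (b * (\<integral>y. k y \<partial>\<mu>))"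
    using b by (subst ennreal_mult''[symmetric]) (auto simp: mult.commute)
  finally show "(\<integral>\<^sup>+x. ennreal (horo_avg r b (\<lambda>y. \<bar>g y - c\<bar>) x) \<partial>\<mu>) = ennreal (b * (\<integral>y. \<bar>g y - c\<bar> \<partial>\<mu>))"
    by (simp add: k_def)
qed

text \<open>A function with small integral over a set of positive measure is small at some point of
  it; equicontinuity spreads the estimate from there to the whole neighbourhood.
  \<open>\<delta>\<close> comes from equicontinuity and does not depend on the point; only
  \<open>R\<close> does, through the measure of \<open>nbh \<delta> x\<close>.\<close>

lemma horo_near:
  assumes f: "BL f" and b: "b > 0" and \<epsilon>: "\<epsilon> > 0"
  obtains \<delta> where "\<delta> > 0" "\<And>x. x \<in> X \<Longrightarrow>
    \<exists>R\<ge>1. \<forall>r\<ge>R. \<forall>y\<in>nbh \<delta> x. \<bar>horo_avg r b f y - b * (\<integral>y. f y \<partial>\<mu>)\<bar> \<le> \<epsilon>"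
proof -
  define c where "c = (\<integral>y. f y \<partial>\<mu>)"
  obtain C where C: "C > 0" "\<And>h x r. det h = 1 \<Longrightarrow> dev h * (1 + b) \<le> 1/2 \<Longrightarrow> x \<in> X \<Longrightarrow> r \<ge> 1 \<Longrightarrow>
     \<bar>horo_avg r b f (h \<star> x) - horo_avg r b f x\<bar> \<le> C * dev h" using horo_equicont[OF f b] by blast
  define \<delta> where "\<delta> = min (1 / (2 * (1 + b))) (\<epsilon> / (4 * C))"
  have \<delta>: "\<delta> > 0" "\<delta> \<le> 1 / (2 * (1 + b))" "\<delta> \<le> \<epsilon> / (4 * C)" using b C \<epsilon> by (auto simp: \<delta>_def)
  have eqc: "\<bar>horo_avg r b f y - horo_avg r b f x\<bar> \<le> \<epsilon> / 4" if y: "y \<in> nbh \<delta> x" and that': "x \<in> X" "r \<ge> 1" for x y r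
  proof -
    obtain h where h: "det h = 1" "dev h < \<delta>" "y = h \<star> x" using y by (auto simp: nbh_def)
    have "dev h * (1 + b) \<le> 1 / (2 * (1 + b)) * (1 + b)" using h \<delta> b by (intro mult_right_mono) auto
    moreover have "1 / (2 * (1 + b)) * (1 + b) = 1/2" using b by (simp add: field_simps)
    ultimately have "dev h * (1 + b) \<le> 1/2" by linarith
    then have "\<bar>horo_avg r b f y - horo_avg r b f x\<bar> \<le> C * dev h" using C(2) h that' by blast
    also have "\<dots> \<le> C * (\<epsilon> / (4 * C))" using h \<delta> C by (intro mult_left_mono) auto
    finally show ?thesis using C by simp
  qed
  show ?thesis
  proof (rule that[OF \<delta>(1)])
    fix x assume x: "x \<in> X"
    define m where "m = measure \<mu> (nbh \<delta> x)"
    have m: "m > 0" unfolding m_def by (rule nbh_pos[OF x \<delta>(1)])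
    \<comment> \<open>\<open>g\<close> is chosen after the measure \<open>m\<close> is known: if its
      average deviation exceeded \<epsilon>/4 on all of the neighbourhood, the integral over the
      space would be too large.\<close>
    have "\<epsilon> / 4 * m / b > 0" using m \<epsilon> b by simp
    then obtain g where g: "g \<in> uhull f" "(\<integral>y. \<bar>g y - c\<bar> \<partial>\<mu>) < \<epsilon> / 4 * m / b"
      using ex_uhull_close[OF f] c_def by blast
    have BLg: "BL g" using BL_uhull[OF f g(1)] .
    obtain D where D: "D > 0" "\<And>r x. r \<ge> 1 \<Longrightarrow> x \<in> X \<Longrightarrow> \<bar>horo_avg r b f x - horo_avg r b g x\<bar> \<le> D / r\<^sup>2"
      using horo_avg_uhull[OF f g(1) b] by blast
    define R where "R = max 1 (4 * D / \<epsilon>)"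
    have "\<bar>horo_avg r b f y - b * c\<bar> \<le> \<epsilon>" if r: "r \<ge> R" and y: "y \<in> nbh \<delta> x" for r y
    proof -
      have r1: "r \<ge> 1" "4 * D / \<epsilon> \<le> r" using r by (auto simp: R_def)
      have D4: "D / r\<^sup>2 \<le> \<epsilon> / 4"
      proof -
        have "4 * D \<le> \<epsilon> * r" using r1 \<epsilon> by (simp add: field_simps)
        also have "\<dots> \<le> \<epsilon> * r\<^sup>2" using r1 \<epsilon> by (intro mult_left_mono) (auto simp: power2_eq_square)
        finally show ?thesis using r1 by (simp add: field_simps)
      qed
      let ?J = "\<lambda>z. horo_avg r b (\<lambda>y. \<bar>g y - c\<bar>) z"
      have "\<exists>z\<in>nbh \<delta> x. ?J z \<le> \<epsilon> / 4"
      proof (rule ccontr)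
        assume "\<not> ?thesis"
        then have *: "\<And>z. z \<in> nbh \<delta> x \<Longrightarrow> ?J z > \<epsilon> / 4" by force
        have "ennreal (\<epsilon> / 4 * m) = ennreal (\<epsilon> / 4) * emeasure \<mu> (nbh \<delta> x)"
          unfolding m_def emeasure_eq_measure using \<epsilon> by (intro ennreal_mult) auto
        also have "\<dots> = (\<integral>\<^sup>+z. ennreal (\<epsilon> / 4) * indicator (nbh \<delta> x) z \<partial>\<mu>)"
          by (rule nn_integral_cmult_indicator[symmetric]) (rule open_sets_mu[OF nbh_open[OF x]])
        also have "\<dots> \<le> (\<integral>\<^sup>+z. ennreal (?J z) \<partial>\<mu>)"
        proof (rule nn_integral_mono)
          fix z
          show "ennreal (\<epsilon> / 4) * indicator (nbh \<delta> x) z \<le> ennreal (?J z)"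
            using *[of z] by (cases "z \<in> nbh \<delta> x") (auto intro!: ennreal_leI)
        qed
        also have "\<dots> = ennreal (b * (\<integral>y. \<bar>g y - c\<bar> \<partial>\<mu>))" by (rule horo_L1(2)[OF BLg b]) (use r1 in simp)
        finally have "\<epsilon> / 4 * m \<le> b * (\<integral>y. \<bar>g y - c\<bar> \<partial>\<mu>)"
          using b by (subst (asm) ennreal_le_iff) auto
        moreover have "b * (\<integral>y. \<bar>g y - c\<bar> \<partial>\<mu>) < b * (\<epsilon> / 4 * m / b)" using g(2) b by (intro mult_strict_left_mono)
        ultimately show False using b by simp
      qed
      then obtain z where z: "z \<in> nbh \<delta> x" "?J z \<le> \<epsilon> / 4" by blast
      have zX: "z \<in> X" using z(1) x by (auto simp: nbh_def)
      have cg: "continuous_on {0..b} (\<lambda>s. g (dg r \<star> shear s \<star> z))"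
        using r1 by (intro horo_continuous BLg zX) auto
      have "horo_avg r b g z - b * c = integral {0..b} (\<lambda>s. g (dg r \<star> shear s \<star> z) - c)"
        unfolding horo_avg_def using b by (subst integral_diff) (auto intro!: integrable_continuous_real cg)
      also have "\<bar>\<dots>\<bar> \<le> ?J z"
        unfolding horo_avg_def using integral_norm_bound_integral[of "\<lambda>s. g (dg r \<star> shear s \<star> z) - c" "{0..b}" "\<lambda>s. \<bar>g (dg r \<star> shear s \<star> z) - c\<bar>"]
        by (simp add: integrable_continuous_real continuous_intros cg)
      finally have "\<bar>horo_avg r b g z - b * c\<bar> \<le> \<epsilon> / 4" using z(2) by linarith
      \<comment> \<open>Four errors of \<epsilon>/4: from \<open>y\<close> to \<open>x\<close>, from
        \<open>x\<close> to \<open>z\<close>, from \<open>f\<close> to \<open>g\<close> at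
        \<open>z\<close>, and from the average of \<open>g\<close> at \<open>z\<close> to the
        mean.\<close>
      then show ?thesis
        using eqc[OF y x r1(1)] eqc[OF z(1) x r1(1)] D(2)[OF r1(1) zX] D4 by linarith
    qed
    then show "\<exists>R\<ge>1. \<forall>r\<ge>R. \<forall>y\<in>nbh \<delta> x. \<bar>horo_avg r b f y - b * (\<integral>y. f y \<partial>\<mu>)\<bar> \<le> \<epsilon>"
      by (intro exI[of _ R]) (auto simp: R_def c_def)
  qed
qed

lemma horo_pointwise:
  assumes f: "BL f" and b: "b > 0" and x: "x \<in> X"
  shows "((\<lambda>r. horo_avg r b f x) \<longlongrightarrow> b * (\<integral>y. f y \<partial>\<mu>)) at_top"
proof (rule tendstoI)
  fix \<epsilon> :: real assume "\<epsilon> > 0"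
  then have e2: "\<epsilon> / 2 > 0" by simp
  obtain \<delta> where \<delta>: "\<delta> > 0" "\<And>x. x \<in> X \<Longrightarrow>
    \<exists>R\<ge>1. \<forall>r\<ge>R. \<forall>y\<in>nbh \<delta> x. \<bar>horo_avg r b f y - b * (\<integral>y. f y \<partial>\<mu>)\<bar> \<le> \<epsilon> / 2"
    using horo_near[OF f b e2] by metis
  have "x \<in> nbh \<delta> x" unfolding nbh_def using \<delta>(1) by (auto intro!: exI[of _ "mat 1"])
  then obtain R where R: "\<And>r. r \<ge> R \<Longrightarrow> \<bar>horo_avg r b f x - b * (\<integral>y. f y \<partial>\<mu>)\<bar> \<le> \<epsilon> / 2" using \<delta>(2)[OF x] by blast
  show "\<forall>\<^sub>F r in at_top. dist (horo_avg r b f x) (b * (\<integral>y. f y \<partial>\<mu>)) < \<epsilon>"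
    using eventually_ge_at_top[of R]
  proof eventually_elim
    case (elim r)
    then show ?case using R[OF elim] \<open>\<epsilon> > 0\<close> by (simp add: dist_real_def)
  qed
qed

text \<open>Each threshold from \<open>horo_near\<close> is already valid on a whole neighbourhood,
  so the maximum over a finite subcover works everywhere.\<close>

lemma horo_uniform:
  assumes f: "BL f" and b: "b > 0" and cpt: "compact_space (coset_topology \<Gamma>)" and \<epsilon>: "\<epsilon> > 0"
  shows "\<exists>R\<ge>1. \<forall>r\<ge>R. \<forall>y\<in>X. \<bar>horo_avg r b f y - b * (\<integral>y. f y \<partial>\<mu>)\<bar> \<le> \<epsilon>"
proof -
  obtain \<delta> where \<delta>: "\<delta> > 0" "\<And>x. x \<in> X \<Longrightarrow>
    \<exists>R\<ge>1. \<forall>r\<ge>R. \<forall>y\<in>nbh \<delta> x. \<bar>horo_avg r b f y - b * (\<integral>y. f y \<partial>\<mu>)\<bar> \<le> \<epsilon>"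
    using horo_near[OF f b \<epsilon>] by metis
  then obtain R where R: "\<And>x r y. x \<in> X \<Longrightarrow> r \<ge> R x \<Longrightarrow> y \<in> nbh \<delta> x \<Longrightarrow> \<bar>horo_avg r b f y - b * (\<integral>y. f y \<partial>\<mu>)\<bar> \<le> \<epsilon>"
    by metis
  have self: "x \<in> nbh \<delta> x" for x unfolding nbh_def using \<delta>(1) by (auto intro!: exI[of _ "mat 1"])
  have "\<exists>F. finite F \<and> F \<subseteq> nbh \<delta> ` X \<and> X \<subseteq> \<Union>F"
    using cpt unfolding compact_space_alt topspace_coset_topology
    by (rule allE[of _ "nbh \<delta> ` X"]) (use self nbh_open in blast)
  then obtain F where F: "finite F" "F \<subseteq> nbh \<delta> ` X" "X \<subseteq> \<Union>F" by blast
  then obtain Z where Z: "Z \<subseteq> X" "finite Z" "F = nbh \<delta> ` Z" by (auto dest: finite_subset_image)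
  show ?thesis
  proof (intro exI[of _ "Max (insert 1 (R ` Z))"] conjI allI ballI impI)
    show "1 \<le> Max (insert 1 (R ` Z))" using Z by simp
    fix r y assume r: "Max (insert 1 (R ` Z)) \<le> r" and "y \<in> X"
    then obtain z where z: "z \<in> Z" "y \<in> nbh \<delta> z" using F Z by blast
    have "R z \<le> r" using r Z z by simp
    then show "\<bar>horo_avg r b f y - b * (\<integral>y. f y \<partial>\<mu>)\<bar> \<le> \<epsilon>" using R[of z r y] z Z by blast
  qed
qed

end

section \<open>Expanding circles\<close>

lemma one_minus_cos_le: "\<bar>cos \<omega> - 1\<bar> \<le> \<bar>\<omega>\<bar>" for \<omega> :: real
proof -
  have "cos \<omega> = 1 - 2 * (sin (\<omega> / 2))\<^sup>2" using cos_double_sin[of "\<omega> / 2"] by simp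
  moreover have "(sin (\<omega> / 2))\<^sup>2 \<le> \<bar>sin (\<omega> / 2)\<bar>"
    using abs_sin_le_one[of "\<omega> / 2"] mult_left_mono[of "\<bar>sin (\<omega> / 2)\<bar>" 1 "\<bar>sin (\<omega> / 2)\<bar>"]
    by (simp add: power2_eq_square flip: abs_mult)
  moreover have "\<bar>sin (\<omega> / 2)\<bar> \<le> \<bar>\<omega> / 2\<bar>" by (rule abs_sin_x_le_abs_x)
  ultimately show ?thesis by simp
qed

lemma abs_sin_minus_le: "\<bar>sin \<eta> - \<eta>\<bar> \<le> \<eta>\<^sup>2" for \<eta> :: real
proof -
  have "\<bar>sin \<eta> - (\<Sum>m<2. sin_coeff m * \<eta> ^ m)\<bar> \<le> inverse (fact 2) * \<bar>\<eta>\<bar> ^ 2" by (rule Maclaurin_sin_bound)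
  then have "2 * \<bar>sin \<eta> - \<eta>\<bar> \<le> \<eta>\<^sup>2" by (simp add: sin_coeff_def eval_nat_numeral)
  moreover have "\<bar>sin \<eta> - \<eta>\<bar> \<le> 2 * \<bar>sin \<eta> - \<eta>\<bar>" by simp
  ultimately show ?thesis by (rule order.trans[rotated])
qed

lemma integral_pieces:
  fixes G :: "real \<Rightarrow> real"
  assumes G: "continuous_on UNIV G" and \<delta>: "\<delta> \<ge> 0"
  shows "integral {0..real J * \<delta>} G = (\<Sum>j<J. integral {0..\<delta>} (\<lambda>\<omega>. G (\<omega> + real j * \<delta>)))"
proof (induction J)
  case (Suc J)
  have I: "G integrable_on {p..q}" for p q
    by (rule integrable_continuous_real) (rule continuous_on_subset[OF G(1)], simp)
  have "integral {0..real J * \<delta>} G + integral {real J * \<delta>..real (Suc J) * \<delta>} G = integral {0..real (Suc J) * \<delta>} G"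
    using \<delta> by (intro Henstock_Kurzweil_Integration.integral_combine I) (auto simp: algebra_simps)
  moreover have "integral {0..\<delta>} (\<lambda>\<omega>. G (\<omega> + real J * \<delta>)) = integral {real J * \<delta>..real (Suc J) * \<delta>} G"
    using integral_shift[of 0 "real J * \<delta>" \<delta> G] continuous_on_subset[OF G(1)] by (simp add: o_def algebra_simps)
  ultimately show ?case using Suc by simp
qed simp

text \<open>This conjugate carries the point at angle \<theta> to the one at angle \<theta> +
  \<eta>. Its upper right entry, about t^2 \<eta>, is the dominant one, so functions along the
  circle oscillate on the scale t^(-2).\<close>

lemma dev_arc:
  assumes t: "t \<ge> 1"
  shows "dev (shear t ** rot \<eta> ** shear (- t)) \<le> 7 * t\<^sup>2 * \<bar>\<eta>\<bar>"
proof -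
  have s: "\<bar>sin \<eta>\<bar> \<le> \<bar>\<eta>\<bar>" and c: "\<bar>cos \<eta> - 1\<bar> \<le> \<bar>\<eta>\<bar>" by (rule abs_sin_x_le_abs_x one_minus_cos_le)+
  have t2: "t \<le> t\<^sup>2" "1 \<le> t\<^sup>2" using t by (auto simp: power2_eq_square intro: order.trans[OF t] mult_mono[of 1 t 1 t, simplified])
  have ts: "\<bar>t * sin \<eta>\<bar> \<le> t * \<bar>\<eta>\<bar>" using s t by (simp add: abs_mult)
  have ts2: "\<bar>t\<^sup>2 * sin \<eta>\<bar> \<le> t\<^sup>2 * \<bar>\<eta>\<bar>" using s by (simp add: abs_mult mult_left_mono)
  have "shear t ** rot \<eta> ** shear (- t) = mk (cos \<eta> - t * sin \<eta>) (sin \<eta> + t\<^sup>2 * sin \<eta>) (- sin \<eta>) (cos \<eta> + t * sin \<eta>)"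
    by (simp add: shear_mk rot_mk algebra_simps power2_eq_square)
  then have "dev (shear t ** rot \<eta> ** shear (- t)) \<le> 4 * \<bar>\<eta>\<bar> + 2 * (t * \<bar>\<eta>\<bar>) + t\<^sup>2 * \<bar>\<eta>\<bar>"
    using s c ts ts2 abs_triangle_ineq4[of "cos \<eta> - 1" "t * sin \<eta>"] abs_triangle_ineq[of "sin \<eta>" "t\<^sup>2 * sin \<eta>"]
      abs_triangle_ineq[of "cos \<eta> - 1" "t * sin \<eta>"] by (simp add: algebra_simps)
  also have "\<dots> \<le> 4 * (t\<^sup>2 * \<bar>\<eta>\<bar>) + 2 * (t\<^sup>2 * \<bar>\<eta>\<bar>) + t\<^sup>2 * \<bar>\<eta>\<bar>"
    using t2 mult_right_mono[of 1 "t\<^sup>2" "\<bar>\<eta>\<bar>"] mult_right_mono[of t "t\<^sup>2" "\<bar>\<eta>\<bar>"]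
    by (intro add_mono mult_left_mono order_refl) auto
  finally show ?thesis by (simp add: algebra_simps)
qed

text \<open>At the critical scale \<eta> = s / t^2 the dominant entry becomes \<open>s\<close> up to
  order 1 / t, and so do all other entries agree with those of \<open>shear s\<close>. Rotating by s
  / t^2 thus amounts to acting by \<open>shear s\<close>.\<close>

lemma dev_arc_shear:
  assumes t: "t \<ge> 1"
  shows "dev (shear t ** rot (s / t\<^sup>2) ** shear (- t) ** shear (- s)) \<le> (6 * \<bar>s\<bar> + 4 * s\<^sup>2) / t"
proof -
  define \<eta> where "\<eta> = s / t\<^sup>2"
  have t2: "t \<le> t\<^sup>2" using t by (simp add: power2_eq_square)
  have \<eta>: "\<bar>\<eta>\<bar> \<le> \<bar>s\<bar> / t" "t * \<bar>\<eta>\<bar> = \<bar>s\<bar> / t" "t\<^sup>2 * \<eta> = s"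
    using t t2 unfolding \<eta>_def by (auto simp: abs_divide power2_eq_square intro!: divide_left_mono)
  have sn: "\<bar>sin \<eta>\<bar> \<le> \<bar>\<eta>\<bar>" and c: "\<bar>cos \<eta> - 1\<bar> \<le> \<bar>\<eta>\<bar>" by (rule abs_sin_x_le_abs_x one_minus_cos_le)+
  have ts: "\<bar>t * sin \<eta>\<bar> \<le> \<bar>s\<bar> / t" using sn t \<eta>(2) by (simp add: abs_mult) (metis mult_left_mono order_trans zero_le_one)
  define A where "A = cos \<eta> - t * sin \<eta>"
  have A: "\<bar>A - 1\<bar> \<le> 2 * (\<bar>s\<bar> / t)" using c \<eta>(1) ts unfolding A_def by linarith
  have sA: "\<bar>s * (A - 1)\<bar> \<le> 2 * (s\<^sup>2 / t)"
  proof -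
    have "\<bar>s * (A - 1)\<bar> \<le> \<bar>s\<bar> * (2 * (\<bar>s\<bar> / t))" unfolding abs_mult by (intro mult_left_mono A) auto
    also have "\<dots> = 2 * ((\<bar>s\<bar> * \<bar>s\<bar>) / t)" by simp
    finally show ?thesis by (simp add: power2_eq_square)
  qed
  have ssin: "\<bar>s * sin \<eta>\<bar> \<le> s\<^sup>2 / t"
  proof -
    have "\<bar>s * sin \<eta>\<bar> \<le> \<bar>s\<bar> * (\<bar>s\<bar> / t)" unfolding abs_mult using sn \<eta>(1) by (intro mult_left_mono) auto
    then show ?thesis by (simp add: power2_eq_square)
  qed
  have q: "\<bar>t\<^sup>2 * (sin \<eta> - \<eta>)\<bar> \<le> s\<^sup>2 / t"
  proof -
    have "\<bar>t\<^sup>2 * (sin \<eta> - \<eta>)\<bar> \<le> t\<^sup>2 * \<eta>\<^sup>2" unfolding abs_mult using abs_sin_minus_le[of \<eta>] by (intro mult_mono) auto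
    also have "t\<^sup>2 * \<eta>\<^sup>2 = s\<^sup>2 / t\<^sup>2" using t by (simp add: \<eta>_def power2_eq_square)
    also have "\<dots> \<le> s\<^sup>2 / t" using t t2 by (intro divide_left_mono) auto
    finally show ?thesis .
  qed
  have "sin \<eta> + t\<^sup>2 * sin \<eta> - s * A = sin \<eta> + t\<^sup>2 * (sin \<eta> - \<eta>) - s * (A - 1)" using \<eta>(3) by (simp add: algebra_simps)
  then have B: "\<bar>sin \<eta> + t\<^sup>2 * sin \<eta> - s * A\<bar> \<le> \<bar>s\<bar> / t + 3 * (s\<^sup>2 / t)" using sn \<eta>(1) q sA by linarith
  have D: "\<bar>cos \<eta> + t * sin \<eta> + s * sin \<eta> - 1\<bar> \<le> 2 * (\<bar>s\<bar> / t) + s\<^sup>2 / t" using c \<eta>(1) ts ssin by linarith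
  have "shear t ** rot \<eta> ** shear (- t) ** shear (- s) =
      mk A (sin \<eta> + t\<^sup>2 * sin \<eta> - s * A) (- sin \<eta>) (cos \<eta> + t * sin \<eta> + s * sin \<eta>)"
    by (simp add: shear_mk rot_mk algebra_simps power2_eq_square A_def)
  then have "dev (shear t ** rot \<eta> ** shear (- t) ** shear (- s)) \<le> 6 * (\<bar>s\<bar> / t) + 4 * (s\<^sup>2 / t)"
    using A B D sn \<eta>(1) by simp
  then show ?thesis by (simp add: \<eta>_def add_divide_distrib)
qed

text \<open>Think of H and H' as living at times \<open>a\<close> and \<open>b\<close>, with H'
  close to a difference F(\<theta>) - F(\<theta> + s / b^2). Shifting the variable moves the
  difference onto \<open>H\<close>, whose Lipschitz constant is only of order a^2; what remains are
  end pieces of the interval.\<close>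

lemma correlation_bound:
  fixes H H' F :: "real \<Rightarrow> real"
  assumes c: "continuous_on UNIV H" "continuous_on UNIV H'" "continuous_on UNIV F"
    and M: "\<And>\<theta>. \<bar>H \<theta>\<bar> \<le> M" "\<And>\<theta>. \<bar>F \<theta>\<bar> \<le> M"
    and L: "\<And>\<theta> \<eta>. \<bar>H (\<theta> + \<eta>) - H \<theta>\<bar> \<le> L * a\<^sup>2 * \<bar>\<eta>\<bar>"
    and E: "\<And>\<theta>. \<bar>H' \<theta> - (F \<theta> - F (\<theta> + s / b\<^sup>2))\<bar> \<le> E / b"
    and ab: "1 \<le> a" "a \<le> b" and p: "p \<ge> 0" and pos: "L \<ge> 0" "E \<ge> 0"
  shows "\<bar>integral {0..p} (\<lambda>\<theta>. H \<theta> * H' \<theta>)\<bar> \<le> (M * E * p + 2 * M\<^sup>2 * \<bar>s\<bar> + L * M * \<bar>s\<bar> * p) * (a / b)"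
proof -
  define \<eta> where "\<eta> = s / b\<^sup>2"
  have M0: "M \<ge> 0" using M(1)[of 0] by linarith
  have cs: "continuous_on UNIV (\<lambda>\<theta>. f (\<theta> + \<eta>))" if "continuous_on UNIV f" for f :: "real \<Rightarrow> real"
    by (rule continuous_on_compose2[OF that]) (auto intro!: continuous_intros)
  note cc = c cs[OF c(1)] cs[OF c(2)] cs[OF c(3)]
  note sub = continuous_on_subset[OF _ subset_UNIV]
  have b: "b \<ge> 1" using ab by simp
  \<comment> \<open>The three errors have the rates 1 / b, 1 / b^2 and a^2 / b^2; a / b dominates
    all of them and is geometric along an exponential sequence.\<close>
  have bb: "1 / b \<le> a / b" "1 / b\<^sup>2 \<le> a / b" "a\<^sup>2 / b\<^sup>2 \<le> a / b"
  proof -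
    show "1 / b \<le> a / b" using ab b by (intro divide_right_mono) auto
    have "1 / b\<^sup>2 = 1 / b * (1 / b)" by (simp add: power2_eq_square)
    also have "\<dots> \<le> a / b * 1" using ab b by (intro mult_mono) (auto intro: divide_right_mono)
    finally show "1 / b\<^sup>2 \<le> a / b" by simp
    have "a\<^sup>2 / b\<^sup>2 = a / b * (a / b)" by (simp add: power2_eq_square)
    also have "\<dots> \<le> a / b * 1" using ab b by (intro mult_mono) auto
    finally show "a\<^sup>2 / b\<^sup>2 \<le> a / b" by simp
  qed
  have 1: "\<bar>integral {0..p} (\<lambda>\<theta>. H \<theta> * H' \<theta>) - integral {0..p} (\<lambda>\<theta>. H \<theta> * (F \<theta> - F (\<theta> + \<eta>)))\<bar> \<le> (M * (E / b)) * (p - 0)"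
  proof (rule integral_abs_diff_le)
    fix \<theta>
    have "\<bar>H \<theta> * H' \<theta> - H \<theta> * (F \<theta> - F (\<theta> + \<eta>))\<bar> = \<bar>H \<theta>\<bar> * \<bar>H' \<theta> - (F \<theta> - F (\<theta> + \<eta>))\<bar>"
      by (simp add: algebra_simps flip: abs_mult)
    also have "\<dots> \<le> M * (E / b)" using M(1) E M0 unfolding \<eta>_def by (intro mult_mono) auto
    finally show "\<bar>H \<theta> * H' \<theta> - H \<theta> * (F \<theta> - F (\<theta> + \<eta>))\<bar> \<le> M * (E / b)" .
  qed (auto intro!: continuous_intros sub[OF cc(1)] sub[OF cc(2)] sub[OF cc(3)] sub[OF cc(6)] p)
  have "\<bar>integral {0..p} (\<lambda>\<theta>. H (\<theta> + \<eta>) * F (\<theta> + \<eta>)) - integral {0..p} (\<lambda>\<theta>. H \<theta> * F \<theta>)\<bar> \<le> 2 * (M * M) * \<bar>\<eta>\<bar>"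
  proof (rule integral_shift_bound[of "\<lambda>\<theta>. H \<theta> * F \<theta>"])
    show "continuous_on UNIV (\<lambda>\<theta>. H \<theta> * F \<theta>)" by (intro continuous_intros c)
    show "\<bar>H \<theta> * F \<theta>\<bar> \<le> M * M" for \<theta> unfolding abs_mult using M M0 by (intro mult_mono) auto
  qed (rule p)
  moreover have "\<bar>integral {0..p} (\<lambda>\<theta>. H (\<theta> + \<eta>) * F (\<theta> + \<eta>)) - integral {0..p} (\<lambda>\<theta>. H \<theta> * F (\<theta> + \<eta>))\<bar> \<le> (L * a\<^sup>2 * \<bar>\<eta>\<bar> * M) * (p - 0)"
  proof (rule integral_abs_diff_le)
    fix \<theta>
    have "\<bar>H (\<theta> + \<eta>) * F (\<theta> + \<eta>) - H \<theta> * F (\<theta> + \<eta>)\<bar> = \<bar>H (\<theta> + \<eta>) - H \<theta>\<bar> * \<bar>F (\<theta> + \<eta>)\<bar>"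
      by (simp add: algebra_simps flip: abs_mult)
    also have "\<dots> \<le> (L * a\<^sup>2 * \<bar>\<eta>\<bar>) * M" using M(2) L pos by (intro mult_mono) auto
    finally show "\<bar>H (\<theta> + \<eta>) * F (\<theta> + \<eta>) - H \<theta> * F (\<theta> + \<eta>)\<bar> \<le> L * a\<^sup>2 * \<bar>\<eta>\<bar> * M" .
  qed (auto intro!: continuous_intros sub[OF cc(1)] sub[OF cc(4)] sub[OF cc(6)] p)
  moreover have "integral {0..p} (\<lambda>\<theta>. H \<theta> * (F \<theta> - F (\<theta> + \<eta>))) =
      integral {0..p} (\<lambda>\<theta>. H \<theta> * F \<theta>) - integral {0..p} (\<lambda>\<theta>. H \<theta> * F (\<theta> + \<eta>))"
    unfolding right_diff_distrib
    by (intro integral_diff integrable_continuous_real continuous_intros sub[OF cc(1)] sub[OF cc(3)] sub[OF cc(6)])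
  ultimately have 2: "\<bar>integral {0..p} (\<lambda>\<theta>. H \<theta> * (F \<theta> - F (\<theta> + \<eta>)))\<bar> \<le> 2 * (M * M) * \<bar>\<eta>\<bar> + L * a\<^sup>2 * \<bar>\<eta>\<bar> * M * p"
    unfolding diff_zero by linarith
  have "\<bar>integral {0..p} (\<lambda>\<theta>. H \<theta> * H' \<theta>)\<bar> \<le> M * (E / b) * p + (2 * (M * M) * \<bar>\<eta>\<bar> + L * a\<^sup>2 * \<bar>\<eta>\<bar> * M * p)"
    using 1 2 unfolding diff_zero by linarith
  also have "\<dots> = (M * E * p) * (1 / b) + (2 * M\<^sup>2 * \<bar>s\<bar>) * (1 / b\<^sup>2) + (L * M * \<bar>s\<bar> * p) * (a\<^sup>2 / b\<^sup>2)"
    by (simp add: \<eta>_def abs_divide power2_eq_square)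
  also have "\<dots> \<le> (M * E * p) * (a / b) + (2 * M\<^sup>2 * \<bar>s\<bar>) * (a / b) + (L * M * \<bar>s\<bar> * p) * (a / b)"
    using M0 pos p by (intro add_mono mult_left_mono bb) auto
  finally show ?thesis by (simp only: distrib_right)
qed

text \<open>Adding one more term costs its square and its correlations with all earlier ones, whose
  sum is bounded by a geometric series. The second moment therefore grows at most linearly.\<close>

lemma geometric_correlation_sum:
  fixes H :: "nat \<Rightarrow> real \<Rightarrow> real"
  assumes c: "\<And>n. continuous_on UNIV (H n)" and M: "\<And>n \<theta>. \<bar>H n \<theta>\<bar> \<le> M"
    and q: "0 < q" "q < 1" and C: "C \<ge> 0" and p: "p \<ge> 0"
    and corr: "\<And>n m. n < m \<Longrightarrow> \<bar>integral {0..p} (\<lambda>\<theta>. H n \<theta> * H m \<theta>)\<bar> \<le> C * q ^ (m - n)"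
  shows "integral {0..p} (\<lambda>\<theta>. (\<Sum>n=1..N. H n \<theta>)\<^sup>2) \<le> (2 * C / (1 - q) + M\<^sup>2 * p) * real N"
proof (induction N)
  case (Suc N)
  note sub = continuous_on_subset[OF _ subset_UNIV]
  let ?S = "\<lambda>\<theta>. \<Sum>n=1..N. H n \<theta>"
  have I: "f integrable_on {0..p}" if "continuous_on UNIV f" for f :: "real \<Rightarrow> real"
    by (rule integrable_continuous_real) (rule sub[OF that])
  have cS: "continuous_on UNIV ?S" by (intro continuous_intros c)
  have "integral {0..p} (\<lambda>\<theta>. (\<Sum>n=1..Suc N. H n \<theta>)\<^sup>2) =
     integral {0..p} (\<lambda>\<theta>. (?S \<theta>)\<^sup>2 + (2 * (\<Sum>n=1..N. H n \<theta> * H (Suc N) \<theta>) + (H (Suc N) \<theta>)\<^sup>2))"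
    by (intro integral_cong) (simp add: power2_eq_square algebra_simps sum_distrib_left sum_distrib_right)
  also have "\<dots> = integral {0..p} (\<lambda>\<theta>. (?S \<theta>)\<^sup>2) + (2 * integral {0..p} (\<lambda>\<theta>. \<Sum>n=1..N. H n \<theta> * H (Suc N) \<theta>)
     + integral {0..p} (\<lambda>\<theta>. (H (Suc N) \<theta>)\<^sup>2))"
    by (subst integral_add, (intro I continuous_intros c)+, subst integral_add, (intro I continuous_intros c)+, simp)
  also have "integral {0..p} (\<lambda>\<theta>. \<Sum>n=1..N. H n \<theta> * H (Suc N) \<theta>) = (\<Sum>n=1..N. integral {0..p} (\<lambda>\<theta>. H n \<theta> * H (Suc N) \<theta>))"
    by (intro integral_sum I continuous_intros c) simp
  also have "\<dots> \<le> (\<Sum>n=1..N. C * q ^ (Suc N - n))"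
    using corr[of _ "Suc N"] by (intro sum_mono) (meson abs_le_D1 atLeastAtMost_iff le_imp_less_Suc)
  also have "\<dots> = C * (\<Sum>n=1..N. q ^ (Suc N - n))" by (simp add: sum_distrib_left)
  also have "(\<Sum>n=1..N. q ^ (Suc N - n)) = (\<Sum>k=1..N. q ^ k)"
    by (rule sum.reindex_bij_witness[of _ "\<lambda>k. Suc N - k" "\<lambda>k. Suc N - k"]) auto
  also have "\<dots> \<le> (\<Sum>k. q ^ k)"
    using q by (intro sum_le_suminf summable_geometric) auto
  also have "\<dots> = 1 / (1 - q)" using q by (intro suminf_geometric) auto
  also have "integral {0..p} (\<lambda>\<theta>. (H (Suc N) \<theta>)\<^sup>2) \<le> M\<^sup>2 * (p - 0)"
  proof -
    have "norm (integral {0..p} (\<lambda>\<theta>. (H (Suc N) \<theta>)\<^sup>2)) \<le> M\<^sup>2 * (p - 0)"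
    proof (rule integral_bound)
      show "continuous_on {0..p} (\<lambda>\<theta>. (H (Suc N) \<theta>)\<^sup>2)" by (intro continuous_intros sub[OF c])
      show "norm ((H (Suc N) \<theta>)\<^sup>2) \<le> M\<^sup>2" for \<theta> using power_mono[OF M[of "Suc N" \<theta>], of 2] by simp
    qed (rule p)
    then show ?thesis by simp
  qed
  finally have "integral {0..p} (\<lambda>\<theta>. (\<Sum>n=1..Suc N. H n \<theta>)\<^sup>2) \<le>
     integral {0..p} (\<lambda>\<theta>. (?S \<theta>)\<^sup>2) + (2 * (C * (1 / (1 - q))) + M\<^sup>2 * (p - 0))"
    using C by (simp add: mult_left_mono)
  moreover have "2 * (C * (1 / (1 - q))) + M\<^sup>2 * (p - 0) = 2 * C / (1 - q) + M\<^sup>2 * p" by simp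
  ultimately show ?case using Suc unfolding of_nat_Suc distrib_left mult_1_right by linarith
qed simp

text \<open>With k the integer part of the root of N, at most 3 k indices lie beyond k^2, and a
  bounded sequence contributes at most 3 M / k there.\<close>

lemma cesaro_squares:
  fixes a :: "nat \<Rightarrow> real"
  assumes M: "\<And>n. \<bar>a n\<bar> \<le> M" and sq: "(\<lambda>k. (\<Sum>n=1..k\<^sup>2. a n) / real (k\<^sup>2)) \<longlonglongrightarrow> 0"
  shows "(\<lambda>N. (\<Sum>n=1..N. a n) / real N) \<longlonglongrightarrow> 0"
proof -
  define k where "k N = nat \<lfloor>sqrt (real N)\<rfloor>" for N
  have k1: "real (k N) \<le> sqrt (real N)" for N unfolding k_def by simp
  have k2: "sqrt (real N) \<le> real (k N) + 1" for N unfolding k_def by linarith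
  have lim: "filterlim k at_top sequentially"
    unfolding k_def by (intro filterlim_compose[OF filterlim_nat_sequentially] filterlim_compose[OF filterlim_floor_sequentially]
      filterlim_compose[OF sqrt_at_top] filterlim_real_sequentially)
  have M0: "M \<ge> 0" using M[of 0] by linarith
  have "\<forall>\<^sub>F N in sequentially. norm ((\<Sum>n=1..N. a n) / real N) \<le> \<bar>(\<Sum>n=1..(k N)\<^sup>2. a n) / real ((k N)\<^sup>2)\<bar> + 3 * M * (1 / real (k N))"
    using eventually_compose_filterlim[OF eventually_gt_at_top[of 0] lim]
  proof eventually_elim
    case (elim N)
    have kN: "(k N)\<^sup>2 \<le> N"
    proof -
      have "(real (k N))\<^sup>2 \<le> (sqrt (real N))\<^sup>2" using k1 by (intro power_mono) auto
      then have "real ((k N)\<^sup>2) \<le> real N" by simp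
      then show ?thesis by (simp only: of_nat_le_iff)
    qed
    have N2: "real N \<le> real ((k N)\<^sup>2) + 3 * real (k N)"
    proof -
      have "(sqrt (real N))\<^sup>2 \<le> (real (k N) + 1)\<^sup>2" using k2 by (intro power_mono) auto
      then show ?thesis using elim by (simp add: power2_eq_square algebra_simps)
    qed
    have kpos: "real ((k N)\<^sup>2) > 0" using elim by simp
    have "(\<Sum>n=1..N. a n) = (\<Sum>n=1..(k N)\<^sup>2. a n) + (\<Sum>n=Suc ((k N)\<^sup>2)..N. a n)"
      using kN sum.ub_add_nat[of 1 "(k N)\<^sup>2" a "N - (k N)\<^sup>2"] by simp
    moreover have "\<bar>\<Sum>n=Suc ((k N)\<^sup>2)..N. a n\<bar> \<le> 3 * M * real (k N)"
    proof -
      have "\<bar>\<Sum>n=Suc ((k N)\<^sup>2)..N. a n\<bar> \<le> (\<Sum>n=Suc ((k N)\<^sup>2)..N. M)" using M by (intro order.trans[OF sum_abs] sum_mono)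
      also have "\<dots> = real (N - (k N)\<^sup>2) * M" using kN by simp
      also have "\<dots> \<le> (3 * real (k N)) * M" using N2 kN M0 by (intro mult_right_mono) (auto simp: of_nat_diff)
      finally show ?thesis by (simp add: mult_ac)
    qed
    ultimately have "\<bar>\<Sum>n=1..N. a n\<bar> \<le> \<bar>\<Sum>n=1..(k N)\<^sup>2. a n\<bar> + 3 * M * real (k N)" by linarith
    then have "\<bar>\<Sum>n=1..N. a n\<bar> / real N \<le> (\<bar>\<Sum>n=1..(k N)\<^sup>2. a n\<bar> + 3 * M * real (k N)) / real ((k N)\<^sup>2)"
      using kN kpos M0 by (intro frac_le) auto
    also have "\<dots> = \<bar>\<Sum>n=1..(k N)\<^sup>2. a n\<bar> / real ((k N)\<^sup>2) + 3 * M * (1 / real (k N))"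
      using elim by (simp add: add_divide_distrib power2_eq_square)
    finally show ?case by simp
  qed
  moreover have lim0: "(\<lambda>N. \<bar>(\<Sum>n=1..(k N)\<^sup>2. a n) / real ((k N)\<^sup>2)\<bar> + 3 * M * (1 / real (k N))) \<longlonglongrightarrow> 0 + 3 * M * 0"
    by (intro tendsto_add tendsto_mult tendsto_const tendsto_rabs_zero filterlim_compose[OF sq lim]
      filterlim_compose[OF lim_1_over_n lim])
  ultimately show ?thesis by (intro Lim_null_comparison[OF _ lim0[unfolded mult_zero_right add_0_right]])
qed

section \<open>Arcs of the expanding circle\<close>

context sl2_quotient begin

lemma arc_continuous:
  assumes "BL f" "x \<in> X"
  shows "continuous_on S (\<lambda>\<theta>. f (shear t \<star> rot \<theta> \<star> x))"
proof -
  have "continuous_on S (\<lambda>\<theta>. f ((shear t ** rot \<theta>) \<star> x))"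
    by (rule BL_continuous_on[OF assms(1) _ _ assms(2)])
      (auto simp: rot_mk shear_mk det_mul algebra_simps simp flip: power2_eq_square intro!: continuous_intros)
  then show ?thesis by (simp add: act_mult)
qed

lemma act_shear_cancel [simp]: "shear (- t) \<star> shear t \<star> y = y"
  unfolding act_mult[symmetric] shear_add[symmetric] by (simp add: shear_0)

lemma arc_lipschitz:
  assumes K: "\<And>y h. y \<in> X \<Longrightarrow> det h = 1 \<Longrightarrow> \<bar>f (h \<star> y) - f y\<bar> \<le> K * dev h" "K \<ge> 0"
    and x: "x \<in> X" and t: "t \<ge> 1"
  shows "\<bar>f (shear t \<star> rot (\<theta> + \<eta>) \<star> x) - f (shear t \<star> rot \<theta> \<star> x)\<bar> \<le> 7 * K * t\<^sup>2 * \<bar>\<eta>\<bar>"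
proof -
  let ?h = "shear t ** rot \<eta> ** shear (- t)"
  have "?h \<star> shear t \<star> rot \<theta> \<star> x = shear t \<star> (rot \<eta> ** rot \<theta>) \<star> x"
    by (simp add: act_mult)
  then have "\<bar>f (shear t \<star> rot (\<theta> + \<eta>) \<star> x) - f (shear t \<star> rot \<theta> \<star> x)\<bar> \<le> K * dev ?h"
    using K(1)[of "shear t \<star> rot \<theta> \<star> x" ?h] x by (simp add: det_mul add.commute[of \<theta>] rot_add)
  also have "\<dots> \<le> K * (7 * t\<^sup>2 * \<bar>\<eta>\<bar>)" by (intro mult_left_mono dev_arc t K)
  finally show ?thesis by (simp add: mult_ac)
qed

lemma arc_shear:
  assumes K: "\<And>y h. y \<in> X \<Longrightarrow> det h = 1 \<Longrightarrow> \<bar>f (h \<star> y) - f y\<bar> \<le> K * dev h" "K \<ge> 0"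
    and x: "x \<in> X" and t: "t \<ge> 1"
  shows "\<bar>f (shear t \<star> rot (\<theta> + s / t\<^sup>2) \<star> x) - f (shear s \<star> shear t \<star> rot \<theta> \<star> x)\<bar> \<le> K * (6 * \<bar>s\<bar> + 4 * s\<^sup>2) / t"
proof -
  let ?h = "shear t ** rot (s / t\<^sup>2) ** shear (- t) ** shear (- s)"
  have "?h \<star> shear s \<star> shear t \<star> rot \<theta> \<star> x = shear t \<star> (rot (s / t\<^sup>2) ** rot \<theta>) \<star> x"
    by (simp add: act_mult)
  then have "\<bar>f (shear t \<star> rot (\<theta> + s / t\<^sup>2) \<star> x) - f (shear s \<star> shear t \<star> rot \<theta> \<star> x)\<bar> \<le> K * dev ?h"
    using K(1)[of "shear s \<star> shear t \<star> rot \<theta> \<star> x" ?h] x by (simp add: det_mul add.commute[of \<theta>] rot_add)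
  also have "\<dots> \<le> K * ((6 * \<bar>s\<bar> + 4 * s\<^sup>2) / t)" by (intro mult_left_mono dev_arc_shear t K)
  finally show ?thesis by simp
qed

text \<open>With \<open>t = tan \<beta>\<close> and \<open>R = sqrt (1 + t\<^sup>2)\<close>, the first row of \<open>shear t ** rot (\<omega> - \<beta>)\<close> is
  \<open>R * (cos \<omega>, sin \<omega>)\<close>, so this matrix equals \<open>dg R ** shear (tan \<omega>)\<close> up to a lower triangular
  factor close to \<open>1\<close>: a short arc of the large circle is a long horocycle.\<close>

lemma arc_le_horo:
  assumes g: "BL g" "\<And>y. y \<in> X \<Longrightarrow> 0 \<le> g y"
    and K: "\<And>y h. y \<in> X \<Longrightarrow> det h = 1 \<Longrightarrow> \<bar>g (h \<star> y) - g y\<bar> \<le> K * dev h" "K \<ge> 0"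
    and z: "z \<in> X" and t: "t > 0" and \<delta>: "0 < \<delta>" "\<delta> \<le> 1/2"
  shows "integral {0..\<delta>} (\<lambda>\<omega>. g (shear t \<star> rot (\<omega> - arctan t) \<star> z)) \<le>
    horo_avg (sqrt (1 + t\<^sup>2)) (tan \<delta>) g z + K * (3 * \<delta> + 1 / sqrt (1 + t\<^sup>2)) * \<delta>"
proof -
  define R where "R = sqrt (1 + t\<^sup>2)"
  define \<beta> where "\<beta> = arctan t"
  have R: "R > 0" unfolding R_def by (intro real_sqrt_gt_zero add_pos_nonneg) auto
  have R\<beta>: "R * cos \<beta> = 1" "R * sin \<beta> = t" using R unfolding R_def \<beta>_def by (simp_all add: cos_arctan sin_arctan)
  define G where "G s = g (dg R \<star> shear s \<star> z)" for s
  have Gc: "continuous_on S G" for S unfolding G_def using R by (intro horo_continuous g z) auto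
  have G0: "G s \<ge> 0" for s unfolding G_def using R z by (intro g act_X) auto
  have cos: "cos \<omega> \<ge> 1/2" if "\<omega> \<in> {0..\<delta>}" for \<omega>
    using one_minus_cos_le[of \<omega>] that \<delta> by auto
  have "\<delta> < pi / 2" using \<delta> pi_gt3 by linarith
  have tanc: "continuous_on {0..\<delta>} tan"
    using cos by (intro continuous_on_tan continuous_on_id) force
  have Gtc: "continuous_on {0..\<delta>} (\<lambda>\<omega>. G (tan \<omega>))"
    by (rule continuous_on_compose2[OF Gc[of UNIV] tanc]) simp
  have cont: "continuous_on {0..\<delta>} (\<lambda>\<omega>. g (shear t \<star> rot (\<omega> - \<beta>) \<star> z))"
    by (rule continuous_on_compose2[OF arc_continuous[OF g(1) z, of UNIV]]) (auto intro!: continuous_intros)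
  have close: "g (shear t \<star> rot (\<omega> - \<beta>) \<star> z) \<le> G (tan \<omega>) + K * (3 * \<delta> + 1 / R)" if \<omega>: "\<omega> \<in> {0..\<delta>}" for \<omega>
  proof -
    define \<theta> where "\<theta> = \<omega> - \<beta>"
    have c0: "cos \<omega> \<ge> 1/2" by (rule cos[OF \<omega>])
    define Q where "Q = mk (cos \<omega>) 0 (- (sin \<theta> / R)) (1 / cos \<omega>)"
    have dQ: "det Q = 1" using c0 by (auto simp: Q_def)
    have e1: "cos \<theta> - t * sin \<theta> = R * cos \<omega>"
    proof -
      have "cos \<theta> - t * sin \<theta> = (R * cos \<beta>) * cos \<theta> - (R * sin \<beta>) * sin \<theta>" by (simp add: R\<beta>)
      also have "\<dots> = R * (cos \<beta> * cos \<theta> - sin \<beta> * sin \<theta>)" by (simp add: right_diff_distrib)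
      also have "\<dots> = R * cos (\<beta> + \<theta>)" by (simp add: cos_add)
      finally show ?thesis by (simp add: \<theta>_def)
    qed
    have e2: "sin \<theta> + t * cos \<theta> = R * sin \<omega>"
    proof -
      have "sin \<theta> + t * cos \<theta> = (R * sin \<beta>) * cos \<theta> + (R * cos \<beta>) * sin \<theta>" by (simp add: R\<beta>)
      also have "\<dots> = R * (sin \<beta> * cos \<theta> + cos \<beta> * sin \<theta>)" by (simp add: distrib_left)
      also have "\<dots> = R * sin (\<beta> + \<theta>)" by (simp add: sin_add)
      finally show ?thesis by (simp add: \<theta>_def)
    qed
    have e3: "cos \<theta> * cos \<omega> + sin \<theta> * sin \<omega> = 1 / R"
    proof -
      have "cos \<theta> * cos \<omega> + sin \<theta> * sin \<omega> = cos (\<omega> - \<theta>)" by (simp add: cos_diff)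
      also have "\<dots> = cos \<beta>" by (simp add: \<theta>_def)
      also have "\<dots> = 1 / R" using R\<beta>(1) R by (simp add: field_simps)
      finally show ?thesis .
    qed
    have "shear t ** rot \<theta> = mk (R * cos \<omega>) (R * sin \<omega>) (- sin \<theta>) (cos \<theta>)"
      using e1 e2 by (simp add: shear_mk rot_mk algebra_simps)
    also have "\<dots> = Q ** dg R ** shear (tan \<omega>)"
    proof -
      have "cos \<theta> = - (sin \<theta> * (sin \<omega> / cos \<omega>)) + 1 / (cos \<omega> * R)"
        using e3 c0 R by (simp add: field_simps)
      then show ?thesis using c0 R by (simp add: Q_def dg_def shear_mk tan_def)
    qed
    finally have "(shear t ** rot \<theta>) \<star> z = (Q ** dg R ** shear (tan \<omega>)) \<star> z" by (rule arg_cong)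
    then have "shear t \<star> rot \<theta> \<star> z = Q \<star> dg R \<star> shear (tan \<omega>) \<star> z"
      by (simp add: act_mult)
    then have "g (shear t \<star> rot \<theta> \<star> z) \<le> G (tan \<omega>) + K * dev Q"
      using K(1)[of "dg R \<star> shear (tan \<omega>) \<star> z" Q] dQ z R by (simp add: G_def)
    also have "K * dev Q \<le> K * (3 * \<delta> + 1 / R)"
    proof (intro mult_left_mono K)
      have "\<bar>cos \<omega> - 1\<bar> \<le> \<delta>" using one_minus_cos_le[of \<omega>] \<omega> by auto
      moreover have "\<bar>1 / cos \<omega> - 1\<bar> \<le> 2 * \<delta>"
      proof -
        have "\<bar>1 / cos \<omega> - 1\<bar> = \<bar>cos \<omega> - 1\<bar> / cos \<omega>"
        proof -
          have "1 / cos \<omega> - 1 = (1 - cos \<omega>) / cos \<omega>" using c0 by (simp add: field_simps)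
          then show ?thesis using c0 by (simp add: abs_minus_commute)
        qed
        also have "\<dots> \<le> \<delta> / (1/2)" using c0 \<open>\<bar>cos \<omega> - 1\<bar> \<le> \<delta>\<close> \<delta> by (intro frac_le) auto
        finally show ?thesis by simp
      qed
      moreover have "\<bar>sin \<theta> / R\<bar> \<le> 1 / R" using R by (simp add: divide_right_mono)
      ultimately show "dev Q \<le> 3 * \<delta> + 1 / R" by (simp add: Q_def)
    qed
    finally show ?thesis by (simp add: \<theta>_def)
  qed
  have "integral {0..\<delta>} (\<lambda>\<omega>. g (shear t \<star> rot (\<omega> - \<beta>) \<star> z)) \<le> integral {0..\<delta>} (\<lambda>\<omega>. G (tan \<omega>) + K * (3 * \<delta> + 1 / R))"
    using close by (intro integral_le integrable_continuous_real continuous_intros cont Gtc)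
  also have "\<dots> = integral {0..\<delta>} (\<lambda>\<omega>. G (tan \<omega>)) + K * (3 * \<delta> + 1 / R) * \<delta>"
    using \<delta> by (subst integral_add) (auto intro!: integrable_continuous_real Gtc)
  \<comment> \<open>The Jacobian of \<open>tan\<close> is at least one, so inserting it can only
    increase the integral of a nonnegative function and creates no error term.\<close>
  also have "integral {0..\<delta>} (\<lambda>\<omega>. G (tan \<omega>)) \<le> integral {0..\<delta>} (\<lambda>\<omega>. inverse ((cos \<omega>)\<^sup>2) *\<^sub>R G (tan \<omega>))"
  proof (intro integral_le integrable_continuous_real)
    show "continuous_on {0..\<delta>} (\<lambda>\<omega>. inverse ((cos \<omega>)\<^sup>2) *\<^sub>R G (tan \<omega>))"
      using cos by (intro continuous_intros Gtc) force
    fix \<omega> assume "\<omega> \<in> {0..\<delta>}"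
    then have c0: "cos \<omega> \<ge> 1/2" by (rule cos)
    have "(cos \<omega>)\<^sup>2 \<le> 1" by (simp add: abs_square_le_1)
    then have "1 \<le> inverse ((cos \<omega>)\<^sup>2)" using c0 by (intro one_le_inverse) auto
    then show "G (tan \<omega>) \<le> inverse ((cos \<omega>)\<^sup>2) *\<^sub>R G (tan \<omega>)"
      using mult_right_mono[OF _ G0, of 1 "inverse ((cos \<omega>)\<^sup>2)" "tan \<omega>"] by simp
  qed (rule Gtc)
  also have "\<dots> = integral {tan 0..tan \<delta>} G"
  proof (rule integral_unique, rule has_integral_substitution[of 0 \<delta> tan 0 "tan \<delta>"])
    have tm: "0 \<le> tan \<omega>" "tan \<omega> \<le> tan \<delta>" if "\<omega> \<in> {0..\<delta>}" for \<omega>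
      using tan_mono_le[of 0 \<omega>] tan_mono_le[of \<omega> \<delta>] that \<open>\<delta> < pi / 2\<close> by auto
    then show "tan ` {0..\<delta>} \<subseteq> {0..tan \<delta>}" "tan 0 \<le> tan \<delta>" using \<delta> by auto
    show "(tan has_field_derivative inverse ((cos \<omega>)\<^sup>2)) (at \<omega> within {0..\<delta>})" if "\<omega> \<in> {0..\<delta>}" for \<omega>
      using cos[OF that] by (intro has_field_derivative_at_within[OF DERIV_tan]) auto
  qed (use \<delta> Gc in auto)
  also have "integral {tan 0..tan \<delta>} G = horo_avg R (tan \<delta>) g z" by (simp add: horo_avg_def G_def[abs_def])
  finally show ?thesis by (simp add: R_def \<beta>_def)
qed

text \<open>The circle is cut into finitely many arcs, each compared with an equidistributing
  horocycle. The constant 6 * pi in place of 2 * pi results from integrating over length 3 * pi and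
  from tan \<delta> \<le> 2 \<delta>.\<close>

lemma circle_bound:
  assumes g: "BL g" "\<And>y. y \<in> X \<Longrightarrow> 0 \<le> g y" and x: "x \<in> X" and \<epsilon>: "\<epsilon> > 0"
  shows "\<forall>\<^sub>F t in at_top. integral {0..2*pi} (\<lambda>\<theta>. g (shear t \<star> rot \<theta> \<star> x)) \<le> 6 * pi * (\<integral>y. g y \<partial>\<mu>) + \<epsilon>"
proof -
  obtain K where K1: "K \<ge> 1" and K: "\<And>y h. y \<in> X \<Longrightarrow> det h = 1 \<Longrightarrow> \<bar>g (h \<star> y) - g y\<bar> \<le> K * dev h"
    using BL_E[OF g(1)] by metis
  define c where "c = (\<integral>y. g y \<partial>\<mu>)"
  have c0: "c \<ge> 0" unfolding c_def using g(2) by (intro Bochner_Integration.integral_nonneg_AE AE_I2) simp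
  \<comment> \<open>The two entries of the maximum guarantee \<delta> \<le> 1/2 and a Lipschitz
    error 9 pi K \<delta> of at most \<epsilon>/3 over the total length.\<close>
  obtain J :: nat where J: "real J > 3 * pi * max 2 (27 * pi * K / \<epsilon>)" using reals_Archimedean2 by blast
  have J0: "real J > 0" by (rule le_less_trans[OF _ J]) simp
  define \<delta> where "\<delta> = 3 * pi / real J"
  have \<delta>0: "\<delta> > 0" using J0 by (simp add: \<delta>_def)
  have J\<delta>: "real J * \<delta> = 3 * pi" using J0 by (simp add: \<delta>_def)
  have "\<delta> * max 2 (27 * pi * K / \<epsilon>) \<le> 1" using J J0 by (simp add: \<delta>_def field_simps)
  moreover have "\<delta> * 2 \<le> \<delta> * max 2 (27 * pi * K / \<epsilon>)" "\<delta> * (27 * pi * K / \<epsilon>) \<le> \<delta> * max 2 (27 * pi * K / \<epsilon>)"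
    by (rule mult_left_mono, use \<delta>0 in simp, use \<delta>0 in simp)+
  ultimately have "\<delta> * 2 \<le> 1" "\<delta> * (27 * pi * K / \<epsilon>) \<le> 1" by linarith+
  then have \<delta>: "\<delta> \<le> 1/2" "3 * pi * (K * (3 * \<delta>)) \<le> \<epsilon> / 3" using \<epsilon> by (auto simp: field_simps)
  have cos\<delta>: "cos \<delta> \<ge> 1/2" using one_minus_cos_le[of \<delta>] \<delta> \<delta>0 by auto
  have tan\<delta>: "tan \<delta> > 0" "tan \<delta> \<le> 2 * \<delta>"
  proof -
    show "tan \<delta> > 0" using \<delta> \<delta>0 pi_gt3 by (intro tan_gt_zero) auto
    have "tan \<delta> \<le> \<delta> / (1/2)" unfolding tan_def using cos\<delta> \<delta>0 sin_x_le_x[of \<delta>] by (intro frac_le) auto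
    then show "tan \<delta> \<le> 2 * \<delta>" by simp
  qed
  define z where "z j = rot (real j * \<delta>) \<star> x" for j :: nat
  have z: "z j \<in> X" for j unfolding z_def using x by simp
  have Rlim: "filterlim (\<lambda>t::real. sqrt (1 + t\<^sup>2)) at_top at_top"
  proof (rule filterlim_at_top_mono[OF filterlim_ident])
    show "\<forall>\<^sub>F t :: real in at_top. t \<le> sqrt (1 + t\<^sup>2)" by (intro always_eventually allI real_le_rsqrt) simp
  qed
  have "((\<lambda>t. \<Sum>j<J. horo_avg (sqrt (1 + t\<^sup>2)) (tan \<delta>) g (z j)) \<longlongrightarrow> (\<Sum>j<J. tan \<delta> * c)) at_top"
    unfolding c_def by (intro tendsto_sum filterlim_compose[OF horo_pointwise[OF g(1) tan\<delta>(1) z] Rlim])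
  moreover have "(\<Sum>j<J. tan \<delta> * c) < 6 * pi * c + \<epsilon> / 3"
  proof -
    have "(\<Sum>j<J. tan \<delta> * c) = real J * tan \<delta> * c" by simp
    also have "\<dots> \<le> real J * (2 * \<delta>) * c" using tan\<delta> c0 by (intro mult_right_mono mult_left_mono) auto
    also have "\<dots> = 2 * (real J * \<delta>) * c" by simp
    also have "\<dots> = 6 * pi * c" unfolding J\<delta> by simp
    finally show ?thesis using \<epsilon> by simp
  qed
  ultimately have ev1: "\<forall>\<^sub>F t in at_top. (\<Sum>j<J. horo_avg (sqrt (1 + t\<^sup>2)) (tan \<delta>) g (z j)) < 6 * pi * c + \<epsilon> / 3"
    by (rule order_tendstoD)
  have "((\<lambda>t::real. 3 * pi * K * inverse (sqrt (1 + t\<^sup>2))) \<longlongrightarrow> 3 * pi * K * 0) at_top"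
    by (intro tendsto_mult tendsto_const filterlim_compose[OF tendsto_inverse_0_at_top[OF filterlim_ident] Rlim])
  then have ev2: "\<forall>\<^sub>F t :: real in at_top. 3 * pi * K * inverse (sqrt (1 + t\<^sup>2)) < \<epsilon> / 3"
    using \<epsilon> by (intro order_tendstoD) auto
  show ?thesis using ev1 ev2 eventually_gt_at_top[of 0]
  proof eventually_elim
    case (elim t)
    define \<Phi> where "\<Phi> \<theta> = g (shear t \<star> rot \<theta> \<star> x)" for \<theta>
    have \<Phi>c: "continuous_on UNIV \<Phi>" unfolding \<Phi>_def by (rule arc_continuous[OF g(1) x])
    have \<Phi>0: "\<Phi> \<theta> \<ge> 0" for \<theta> unfolding \<Phi>_def using x by (intro g act_X) auto
    define \<beta> where "\<beta> = arctan t"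
    have \<beta>: "0 \<le> \<beta>" "\<beta> \<le> pi / 2" using elim(3) arctan_ubound[of t] by (auto simp: \<beta>_def)
    define \<Psi> where "\<Psi> \<omega> = \<Phi> (\<omega> - \<beta>)" for \<omega>
    have \<Psi>c: "continuous_on UNIV \<Psi>" unfolding \<Psi>_def
      by (rule continuous_on_compose2[OF \<Phi>c]) (auto intro!: continuous_intros)
    have \<Psi>I: "\<Psi> integrable_on {p..q}" for p q
      by (rule integrable_continuous_real) (rule continuous_on_subset[OF \<Psi>c], simp)
    have "integral {0..2*pi} \<Phi> = integral {\<beta>..2*pi + \<beta>} \<Psi>"
      using integral_shift[of 0 \<beta> "2*pi" \<Psi>] continuous_on_subset[OF \<Psi>c] by (simp add: o_def \<Psi>_def)
    \<comment> \<open>The shift \<open>\<beta>\<close> depends on \<open>t\<close> but stays in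
      [0, pi/2]. By positivity a fixed interval covers every case, so that the base points
      \<open>z j\<close> of the horocycles do not move as \<open>t\<close> grows.\<close>
    also have "\<dots> \<le> integral {0..3 * pi} \<Psi>"
      using \<beta> \<Phi>0 by (intro integral_subset_le \<Psi>I) (auto simp: \<Psi>_def)
    also have "\<dots> = integral {0..real J * \<delta>} \<Psi>" by (simp add: J\<delta>)
    also have "\<dots> = (\<Sum>j<J. integral {0..\<delta>} (\<lambda>\<omega>. \<Psi> (\<omega> + real j * \<delta>)))"
      using \<delta>0 by (intro integral_pieces \<Psi>c) auto
    also have "\<dots> \<le> (\<Sum>j<J. horo_avg (sqrt (1 + t\<^sup>2)) (tan \<delta>) g (z j) + K * (3 * \<delta> + 1 / sqrt (1 + t\<^sup>2)) * \<delta>)"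
    proof (intro sum_mono)
      fix j
      have "\<Psi> (\<omega> + real j * \<delta>) = g (shear t \<star> rot (\<omega> - arctan t) \<star> z j)" for \<omega>
      proof -
        have "rot (\<omega> + real j * \<delta> - \<beta>) = rot (\<omega> - \<beta>) ** rot (real j * \<delta>)"
          by (subst rot_add[symmetric]) (simp add: algebra_simps)
        then show ?thesis by (simp add: \<Psi>_def \<Phi>_def z_def \<beta>_def act_mult)
      qed
      then show "integral {0..\<delta>} (\<lambda>\<omega>. \<Psi> (\<omega> + real j * \<delta>)) \<le>
          horo_avg (sqrt (1 + t\<^sup>2)) (tan \<delta>) g (z j) + K * (3 * \<delta> + 1 / sqrt (1 + t\<^sup>2)) * \<delta>"
        using arc_le_horo[OF g K _ z elim(3) \<delta>0 \<delta>(1)] K1 by simp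
    qed
    also have "\<dots> = (\<Sum>j<J. horo_avg (sqrt (1 + t\<^sup>2)) (tan \<delta>) g (z j)) + K * (3 * \<delta> + 1 / sqrt (1 + t\<^sup>2)) * (real J * \<delta>)"
      by (simp add: sum.distrib)
    also have "K * (3 * \<delta> + 1 / sqrt (1 + t\<^sup>2)) * (real J * \<delta>) = 3 * pi * (K * (3 * \<delta>)) + 3 * pi * K * inverse (sqrt (1 + t\<^sup>2))"
      unfolding J\<delta> by (simp add: algebra_simps inverse_eq_divide)
    finally have "integral {0..2*pi} \<Phi> \<le> 6 * pi * c + \<epsilon>" using elim(1,2) \<delta>(2) by linarith
    then show ?case by (simp add: \<Phi>_def[abs_def] c_def)
  qed
qed

section \<open>Cesaro averages along the orbit\<close>

text \<open>For \<open>N = 0\<close> the quotient is zero by convention, so constants are reproduced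
  only for positive \<open>N\<close>.\<close>

definition ces :: "real \<Rightarrow> ((real^2^2) set \<Rightarrow> real) \<Rightarrow> (real^2^2) set \<Rightarrow> nat \<Rightarrow> real \<Rightarrow> real" where
  "ces l f x N \<theta> = (\<Sum>n=1..N. f (shear (exp (l * real n)) \<star> rot \<theta> \<star> x)) / real N"

lemma ces_continuous: "BL f \<Longrightarrow> x \<in> X \<Longrightarrow> continuous_on S (ces l f x N)"
  unfolding ces_def[abs_def] divide_inverse by (intro continuous_intros arc_continuous)

lemma ces_linear: "ces l (\<lambda>y. a * f y + b * g y) x N \<theta> = a * ces l f x N \<theta> + b * ces l g x N \<theta>"
  by (simp add: ces_def sum.distrib sum_distrib_left add_divide_distrib)

lemma ces_add: "ces l (\<lambda>y. f y + g y) x N \<theta> = ces l f x N \<theta> + ces l g x N \<theta>"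
  using ces_linear[of l 1 f 1 g] by simp

lemma ces_diff: "ces l (\<lambda>y. f y - g y) x N \<theta> = ces l f x N \<theta> - ces l g x N \<theta>"
  using ces_linear[of l 1 f "-1" g] by simp

lemma ces_abs_le: "\<bar>ces l f x N \<theta>\<bar> \<le> ces l (\<lambda>y. \<bar>f y\<bar>) x N \<theta>"
  by (simp add: ces_def abs_divide divide_right_mono)

lemma ces_mono: "(\<And>y. y \<in> X \<Longrightarrow> f y \<le> g y) \<Longrightarrow> x \<in> X \<Longrightarrow> ces l f x N \<theta> \<le> ces l g x N \<theta>"
  by (auto simp: ces_def intro!: divide_right_mono sum_mono)

lemma ces_const: "N > 0 \<Longrightarrow> ces l (\<lambda>y. c) x N \<theta> = c"
  by (simp add: ces_def)

lemma ces_bound: "(\<And>y. y \<in> X \<Longrightarrow> \<bar>f y\<bar> \<le> K) \<Longrightarrow> K \<ge> 0 \<Longrightarrow> x \<in> X \<Longrightarrow> \<bar>ces l f x N \<theta>\<bar> \<le> K"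
proof (cases "N = 0")
  case False
  assume a: "\<And>y. y \<in> X \<Longrightarrow> \<bar>f y\<bar> \<le> K" "K \<ge> 0" "x \<in> X"
  have "\<bar>ces l f x N \<theta>\<bar> \<le> ces l (\<lambda>y. \<bar>f y\<bar>) x N \<theta>" by (rule ces_abs_le)
  also have "\<dots> \<le> ces l (\<lambda>y. K) x N \<theta>" by (intro ces_mono a)
  finally show ?thesis using False by (simp add: ces_const)
qed (simp add: ces_def)

text \<open>Exponential growth enters here: the ratio of the times \<open>n\<close> and
  \<open>m\<close> is exp (- l) to the power m - n, so the correlations are summable and the second
  moment of the average is of order 1 / N.\<close>

lemma ces_shear_sq:
  assumes f: "BL f" and x: "x \<in> X" and l: "l > 0"
  obtains D where "D \<ge> 0"
    "\<And>N. integral {0..2*pi} (\<lambda>\<theta>. (ces l (\<lambda>y. f y - f (shear s \<star> y)) x N \<theta>)\<^sup>2) \<le> D / real N"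
proof -
  define h where "h = (\<lambda>y. f y - f (shear s \<star> y))"
  have h: "BL h" unfolding h_def by (intro BL_diff f BL_act det_shear)
  obtain K where K1: "K \<ge> 1" and KB: "\<And>y. y \<in> X \<Longrightarrow> \<bar>f y\<bar> \<le> K" and
    K: "\<And>y h. y \<in> X \<Longrightarrow> det h = 1 \<Longrightarrow> \<bar>f (h \<star> y) - f y\<bar> \<le> K * dev h" using BL_E[OF f] by metis
  obtain L where L1: "L \<ge> 1" and LB: "\<And>y. y \<in> X \<Longrightarrow> \<bar>h y\<bar> \<le> L" and
    L: "\<And>y k. y \<in> X \<Longrightarrow> det k = 1 \<Longrightarrow> \<bar>h (k \<star> y) - h y\<bar> \<le> L * dev k" using BL_E[OF h] by metis
  define M where "M = max K L"
  define t where "t n = exp (l * real n)" for n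
  have t1: "t n \<ge> 1" for n using l by (simp add: t_def)
  define y where "y n \<theta> = shear (t n) \<star> rot \<theta> \<star> x" for n \<theta>
  have yX: "y n \<theta> \<in> X" for n \<theta> unfolding y_def using x by simp
  define E where "E = K * (6 * \<bar>s\<bar> + 4 * s\<^sup>2)"
  have E0: "E \<ge> 0" using K1 by (simp add: E_def)
  define C where "C = M * E * (2*pi) + 2 * M\<^sup>2 * \<bar>s\<bar> + 7 * L * M * \<bar>s\<bar> * (2*pi)"
  have M0: "M \<ge> 0" using K1 by (simp add: M_def)
  have C0: "C \<ge> 0" unfolding C_def using M0 E0 L1 by (intro add_nonneg_nonneg mult_nonneg_nonneg) auto
  define q where "q = exp (- l)"
  have q: "0 < q" "q < 1" using l by (simp_all add: q_def)
  define D where "D = 2 * C / (1 - q) + M\<^sup>2 * (2*pi)"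
  have hc: "continuous_on UNIV (\<lambda>\<theta>. h (y n \<theta>))" for n unfolding y_def by (rule arc_continuous[OF h x])
  have fc: "continuous_on UNIV (\<lambda>\<theta>. f (y n \<theta>))" for n unfolding y_def by (rule arc_continuous[OF f x])
  have sq: "integral {0..2*pi} (\<lambda>\<theta>. (\<Sum>n=1..N. h (y n \<theta>))\<^sup>2) \<le> D * real N" for N
    unfolding D_def
  proof (rule geometric_correlation_sum[OF hc _ q C0])
    show "\<bar>h (y n \<theta>)\<bar> \<le> M" for n \<theta> using LB[OF yX[of n \<theta>]] by (simp add: M_def)
    fix n m :: nat assume nm: "n < m"
    have "\<bar>integral {0..2*pi} (\<lambda>\<theta>. h (y n \<theta>) * h (y m \<theta>))\<bar> \<le> C * (t n / t m)"
      unfolding C_def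
    proof (rule correlation_bound[OF hc hc fc])
      show "\<bar>h (y n \<theta>)\<bar> \<le> M" "\<bar>f (y m \<theta>)\<bar> \<le> M" for \<theta>
        using LB[OF yX[of n \<theta>]] KB[OF yX[of m \<theta>]] by (auto simp: M_def)
      show "\<bar>h (y n (\<theta> + \<eta>)) - h (y n \<theta>)\<bar> \<le> 7 * L * (t n)\<^sup>2 * \<bar>\<eta>\<bar>" for \<theta> \<eta>
        unfolding y_def using L1 by (intro arc_lipschitz[OF L _ x t1]) auto
      show "\<bar>h (y m \<theta>) - (f (y m \<theta>) - f (y m (\<theta> + s / (t m)\<^sup>2)))\<bar> \<le> E / t m" for \<theta>
        using arc_shear[OF K _ x t1[of m], where \<theta>=\<theta> and s=s] K1 by (simp add: h_def y_def E_def)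
      show "t n \<le> t m" using nm l by (simp add: t_def)
    qed (use t1 L1 E0 in auto)
    also have "t n / t m = q ^ (m - n)"
    proof -
      have "t n / t m = exp (real (m - n) * (- l))"
        using nm by (simp add: t_def of_nat_diff algebra_simps flip: exp_diff)
      then show ?thesis by (simp only: q_def exp_of_nat_mult)
    qed
    finally show "\<bar>integral {0..2*pi} (\<lambda>\<theta>. h (y n \<theta>) * h (y m \<theta>))\<bar> \<le> C * q ^ (m - n)" .
  qed simp
  have "D \<ge> 0" unfolding D_def using C0 q by (intro add_nonneg_nonneg divide_nonneg_nonneg mult_nonneg_nonneg) auto
  moreover have "integral {0..2*pi} (\<lambda>\<theta>. (ces l h x N \<theta>)\<^sup>2) \<le> D / real N" for N
  proof (cases "N = 0")
    case False
    have "integral {0..2*pi} (\<lambda>\<theta>. (ces l h x N \<theta>)\<^sup>2) = integral {0..2*pi} (\<lambda>\<theta>. (\<Sum>n=1..N. h (y n \<theta>))\<^sup>2) / (real N)\<^sup>2"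
      by (simp add: ces_def y_def t_def power_divide)
    also have "\<dots> \<le> D * real N / (real N)\<^sup>2" by (intro divide_right_mono sq) simp
    also have "\<dots> = D / real N" using False by (simp add: power2_eq_square)
    finally show ?thesis .
  qed (simp add: ces_def)
  ultimately show ?thesis using that unfolding h_def by blast
qed

text \<open>Second moments of order 1 / N are not summable, but along the squares they are;
  boundedness fills the gaps between consecutive squares.\<close>

lemma ces_shear_AE:
  assumes f: "BL f" and x: "x \<in> X" and l: "l > 0"
  shows "AE \<theta> in lebesgue_on {0..2*pi}. (\<lambda>N. ces l (\<lambda>y. f y - f (shear s \<star> y)) x N \<theta>) \<longlonglongrightarrow> 0"
proof -
  define h where "h = (\<lambda>y. f y - f (shear s \<star> y))"
  have h: "BL h" unfolding h_def by (intro BL_diff f BL_act det_shear)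
  obtain M where M: "M \<ge> 1" "\<And>y. y \<in> X \<Longrightarrow> \<bar>h y\<bar> \<le> M" using BL_E[OF h] by metis
  obtain D where D: "D \<ge> 0" "\<And>N. integral {0..2*pi} (\<lambda>\<theta>. (ces l h x N \<theta>)\<^sup>2) \<le> D / real N"
    using ces_shear_sq[OF f x l] unfolding h_def by metis
  have I: "integrable (lebesgue_on {0..2*pi}) (\<lambda>\<theta>. (ces l h x N \<theta>)\<^sup>2)" for N
    by (intro continuous_imp_integrable_real continuous_intros ces_continuous h x)
  have "AE \<theta> in lebesgue_on {0..2*pi}. summable (\<lambda>k. (ces l h x (k\<^sup>2) \<theta>)\<^sup>2)"
  proof (rule L1_summable_AE[OF I])
    show "summable (\<lambda>k. integral\<^sup>L (lebesgue_on {0..2*pi}) (\<lambda>\<theta>. (ces l h x (k\<^sup>2) \<theta>)\<^sup>2))"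
    proof (rule summable_comparison_test')
      show "summable (\<lambda>k. D * inverse (real k ^ 2))" by (intro summable_mult inverse_power_summable) simp
      fix k :: nat
      have "integral\<^sup>L (lebesgue_on {0..2*pi}) (\<lambda>\<theta>. (ces l h x (k\<^sup>2) \<theta>)\<^sup>2) \<le> D / real (k\<^sup>2)"
        by (subst lebesgue_integral_eq_integral[OF I]) (use D(2)[of "k\<^sup>2"] in auto)
      then show "norm (integral\<^sup>L (lebesgue_on {0..2*pi}) (\<lambda>\<theta>. (ces l h x (k\<^sup>2) \<theta>)\<^sup>2)) \<le> D * inverse (real k ^ 2)"
        by (simp add: divide_inverse)
    qed
  qed simp
  then have "AE \<theta> in lebesgue_on {0..2*pi}. (\<lambda>N. ces l h x N \<theta>) \<longlonglongrightarrow> 0"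
  proof eventually_elim
    case (elim \<theta>)
    then have "(\<lambda>k. (ces l h x (k\<^sup>2) \<theta>)\<^sup>2) \<longlonglongrightarrow> 0" by (rule summable_LIMSEQ_zero)
    then have "(\<lambda>k. sqrt ((ces l h x (k\<^sup>2) \<theta>)\<^sup>2)) \<longlonglongrightarrow> sqrt 0" by (rule tendsto_real_sqrt)
    then have "(\<lambda>k. ces l h x (k\<^sup>2) \<theta>) \<longlonglongrightarrow> 0" by (simp add: tendsto_rabs_zero_iff)
    then show ?case unfolding ces_def
      by (intro cesaro_squares[of _ M]) (use M x in auto)
  qed
  then show ?thesis by (simp add: h_def)
qed

lemma ces_shear_L1:
  assumes f: "BL f" and x: "x \<in> X" and l: "l > 0"
  shows "(\<lambda>N. integral {0..2*pi} (\<lambda>\<theta>. \<bar>ces l (\<lambda>y. f y - f (shear s \<star> y)) x N \<theta>\<bar>)) \<longlonglongrightarrow> 0"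
proof -
  define h where "h = (\<lambda>y. f y - f (shear s \<star> y))"
  have h: "BL h" unfolding h_def by (intro BL_diff f BL_act det_shear)
  obtain D where D: "D \<ge> 0" "\<And>N. integral {0..2*pi} (\<lambda>\<theta>. (ces l h x N \<theta>)\<^sup>2) \<le> D / real N"
    using ces_shear_sq[OF f x l] unfolding h_def by metis
  have "(\<lambda>N. integral {0..2*pi} (\<lambda>\<theta>. \<bar>ces l h x N \<theta>\<bar>)) \<longlonglongrightarrow> 0"
  proof (rule LIMSEQ_I)
    fix \<epsilon> :: real assume \<epsilon>: "\<epsilon> > 0"
    \<comment> \<open>In \<open>\<bar>v\<bar> \<le> v\<^sup>2 / (2 * \<eta>) + \<eta> / 2\<close>
      the last term, integrated over length 2 * pi, becomes \<epsilon>/4.\<close>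
    define \<eta> where "\<eta> = \<epsilon> / (4 * pi)"
    have \<eta>: "\<eta> > 0" using \<epsilon> by (simp add: \<eta>_def)
    have bound: "integral {0..2*pi} (\<lambda>\<theta>. \<bar>ces l h x N \<theta>\<bar>) \<le> D / (2 * \<eta>) * (1 / real N) + \<epsilon> / 4" for N
    proof -
      have "integral {0..2*pi} (\<lambda>\<theta>. \<bar>ces l h x N \<theta>\<bar>) \<le> integral {0..2*pi} (\<lambda>\<theta>. (ces l h x N \<theta>)\<^sup>2 / (2 * \<eta>) + \<eta> / 2)"
      proof (intro integral_le integrable_continuous_real continuous_intros ces_continuous h x)
        fix \<theta>
        let ?v = "\<bar>ces l h x N \<theta>\<bar>"
        have "0 \<le> (?v - \<eta>)\<^sup>2" by simp
        then have "2 * \<eta> * ?v \<le> ?v\<^sup>2 + \<eta>\<^sup>2" by (simp add: power2_diff mult_ac)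
        then have "2 * \<eta> * ?v / (2 * \<eta>) \<le> (?v\<^sup>2 + \<eta>\<^sup>2) / (2 * \<eta>)" using \<eta> by (intro divide_right_mono) auto
        then show "?v \<le> (ces l h x N \<theta>)\<^sup>2 / (2 * \<eta>) + \<eta> / 2"
          using \<eta> by (simp add: add_divide_distrib power2_eq_square)
      qed (use \<eta> in auto)
      also have "\<dots> = integral {0..2*pi} (\<lambda>\<theta>. (ces l h x N \<theta>)\<^sup>2) / (2 * \<eta>) + \<eta> / 2 * (2 * pi)"
        using \<eta> by (subst integral_add) (auto intro!: integrable_continuous_real continuous_intros ces_continuous h x)
      also have "\<dots> \<le> (D / real N) / (2 * \<eta>) + \<eta> / 2 * (2 * pi)"
        using \<eta> D(2)[of N] by (intro add_right_mono divide_right_mono) auto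
      also have "\<dots> = D / (2 * \<eta>) * (1 / real N) + \<epsilon> / 4" by (simp add: \<eta>_def)
      finally show ?thesis .
    qed
    have "(\<lambda>N. D / (2 * \<eta>) * (1 / real N) + \<epsilon> / 4) \<longlonglongrightarrow> D / (2 * \<eta>) * 0 + \<epsilon> / 4"
      by (intro tendsto_intros lim_1_over_n)
    then have "\<forall>\<^sub>F N in sequentially. D / (2 * \<eta>) * (1 / real N) + \<epsilon> / 4 < \<epsilon>"
      by (rule order_tendstoD(2)) (use \<epsilon> in simp)
    then obtain N0 where N0: "\<And>N. N \<ge> N0 \<Longrightarrow> D / (2 * \<eta>) * (1 / real N) + \<epsilon> / 4 < \<epsilon>"
      by (auto simp: eventually_sequentially)
    have nonneg: "0 \<le> integral {0..2*pi} (\<lambda>\<theta>. \<bar>ces l h x N \<theta>\<bar>)" for N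
      by (intro Henstock_Kurzweil_Integration.integral_nonneg integrable_continuous_real continuous_intros ces_continuous h x) auto
    show "\<exists>N0. \<forall>N\<ge>N0. norm (integral {0..2*pi} (\<lambda>\<theta>. \<bar>ces l h x N \<theta>\<bar>) - 0) < \<epsilon>"
    proof (intro exI[of _ N0] allI impI)
      fix N assume "N \<ge> N0"
      then show "norm (integral {0..2*pi} (\<lambda>\<theta>. \<bar>ces l h x N \<theta>\<bar>) - 0) < \<epsilon>"
        using N0[of N] bound[of N] nonneg[of N] by simp
    qed
  qed
  then show ?thesis by (simp add: h_def)
qed

end

lemma cesaro_le:
  fixes a :: "nat \<Rightarrow> real"
  assumes M: "\<And>n. \<bar>a n\<bar> \<le> M" and B: "B \<ge> 0" "\<forall>\<^sub>F n in sequentially. a n \<le> B" and \<epsilon>: "\<epsilon> > 0"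
  shows "\<forall>\<^sub>F N in sequentially. (\<Sum>n=1..N. a n) / real N < B + \<epsilon>"
proof -
  have M0: "M \<ge> 0" using M[of 0] by linarith
  obtain n0 where n0: "\<And>n. n \<ge> n0 \<Longrightarrow> a n \<le> B" using B(2) by (auto simp: eventually_sequentially)
  have le: "(\<Sum>n=1..N. a n) / real N \<le> B + real n0 * M * (1 / real N)" if N: "N > 0" for N
  proof -
    have "(\<Sum>n=1..N. a n) \<le> (\<Sum>n=1..N. B + (if n < n0 then M else 0))"
    proof (rule sum_mono)
      fix n
      show "a n \<le> B + (if n < n0 then M else 0)"
        using n0[of n] M[of n] B(1) by (auto simp: not_less)
    qed
    also have "\<dots> = real N * B + (\<Sum>n\<in>{1..N} \<inter> {..<n0}. M)"
      by (simp add: sum.distrib sum.If_cases Int_def)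
    also have "\<dots> \<le> real N * B + real n0 * M"
      using M0 card_mono[of "{..<n0}" "{1..N} \<inter> {..<n0}"] by (simp add: mult_right_mono)
    finally have "(\<Sum>n=1..N. a n) / real N \<le> (real N * B + real n0 * M) / real N" by (rule divide_right_mono) simp
    then show ?thesis using N by (simp add: add_divide_distrib)
  qed
  have "(\<lambda>N. B + real n0 * M * (1 / real N)) \<longlonglongrightarrow> B + real n0 * M * 0"
    by (intro tendsto_intros lim_1_over_n)
  then have "\<forall>\<^sub>F N in sequentially. B + real n0 * M * (1 / real N) < B + \<epsilon>"
    by (rule order_tendstoD(2)) (use \<epsilon> in simp)
  then show ?thesis using eventually_gt_at_top[of 0]
  proof eventually_elim
    case (elim N)
    then show ?case using le[of N] by linarith
  qed
qed

lemma riemann_sum_error: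
  fixes G :: "real \<Rightarrow> real"
  assumes G: "continuous_on UNIV G" and L: "\<And>s s'. \<bar>G s - G s'\<bar> \<le> L * \<bar>s - s'\<bar>" and n: "n > 0"
  shows "\<bar>integral {0..1} G - (\<Sum>j<n. G (real j / real n)) / real n\<bar> \<le> L / real n"
proof -
  define \<delta> where "\<delta> = 1 / real n"
  have \<delta>: "\<delta> > 0" "real n * \<delta> = 1" using n by (simp_all add: \<delta>_def)
  have "L * \<bar>0 - 1\<bar> \<ge> 0" by (rule order.trans[OF abs_ge_zero L])
  then have L0: "L \<ge> 0" by simp
  have "\<bar>(\<Sum>j<n. integral {0..\<delta>} (\<lambda>\<omega>. G (\<omega> + real j * \<delta>)) - G (real j / real n) * \<delta>)\<bar> \<le> (\<Sum>j<n. L * \<delta> * \<delta>)"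
  proof (intro order.trans[OF sum_abs] sum_mono)
    fix j :: nat
    have "\<bar>integral {0..\<delta>} (\<lambda>\<omega>. G (\<omega> + real j * \<delta>)) - integral {0..\<delta>} (\<lambda>\<omega>. G (real j / real n))\<bar> \<le> (L * \<delta>) * (\<delta> - 0)"
    proof (rule integral_abs_diff_le)
      show "continuous_on {0..\<delta>} (\<lambda>\<omega>. G (\<omega> + real j * \<delta>))"
        by (rule continuous_on_compose2[OF G]) (auto intro!: continuous_intros)
      fix \<omega> assume "\<omega> \<in> {0..\<delta>}"
      then have "\<bar>(\<omega> + real j * \<delta>) - real j / real n\<bar> \<le> \<delta>" by (simp add: \<delta>_def)
      then show "\<bar>G (\<omega> + real j * \<delta>) - G (real j / real n)\<bar> \<le> L * \<delta>"
        using L0 by (intro order.trans[OF L] mult_left_mono)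
    qed (use \<delta> in auto)
    then show "\<bar>integral {0..\<delta>} (\<lambda>\<omega>. G (\<omega> + real j * \<delta>)) - G (real j / real n) * \<delta>\<bar> \<le> L * \<delta> * \<delta>"
      using \<delta> by (simp add: mult.commute)
  qed
  also have "\<dots> = L * (real n * \<delta>) * \<delta>" by simp
  also have "\<dots> = L / real n" unfolding \<delta>(2) by (simp add: \<delta>_def)
  also have "(\<Sum>j<n. integral {0..\<delta>} (\<lambda>\<omega>. G (\<omega> + real j * \<delta>)) - G (real j / real n) * \<delta>) =
      integral {0..1} G - (\<Sum>j<n. G (real j / real n)) / real n"
    using integral_pieces[OF G, of \<delta> n] \<delta>(1) unfolding \<delta>(2)
    by (simp add: sum_subtractf sum_divide_distrib) (simp add: \<delta>_def)
  finally show ?thesis .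
qed

section \<open>Limits of the Cesaro averages\<close>

context sl2_quotient begin

text \<open>Allows \<open>f\<close> to be exchanged for an average of its translates; along the
  induction each shear costs an error tending to zero by \<open>ces_shear_L1\<close>.\<close>

lemma integral_ces_uhull:
  assumes f: "BL f" and x: "x \<in> X" and l: "l > 0" and g: "g \<in> uhull f"
  shows "(\<lambda>N. integral {0..2*pi} (\<lambda>\<theta>. \<bar>ces l f x N \<theta> - ces l g x N \<theta>\<bar>)) \<longlonglongrightarrow> 0"
proof -
  have sandwich: "a \<longlonglongrightarrow> 0" if "\<And>N. 0 \<le> a N" "\<And>N. a N \<le> b N + c N" "b \<longlonglongrightarrow> 0" "c \<longlonglongrightarrow> 0" for a b c :: "nat \<Rightarrow> real"
  proof (rule real_tendsto_sandwich[of "\<lambda>_. 0" a _ "\<lambda>N. b N + c N"])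
    show "(\<lambda>N. b N + c N) \<longlonglongrightarrow> 0" using tendsto_add[OF that(3,4)] by simp
  qed (use that in auto)
  show ?thesis using g
  proof induction
    case base
    show ?case by simp
  next
    case (shift g s)
    have BLg: "BL g" by (rule BL_uhull[OF f shift(1)])
    have BLs: "BL (\<lambda>y. g (shear s \<star> y))" by (rule BL_act[OF BLg det_shear])
    note I = integrable_continuous_real continuous_intros ces_continuous f BLg BLs x
    show ?case
    proof (rule sandwich[OF _ _ shift.IH])
      show "(\<lambda>N. integral {0..2*pi} (\<lambda>\<theta>. \<bar>ces l g x N \<theta> - ces l (\<lambda>y. g (shear s \<star> y)) x N \<theta>\<bar>)) \<longlonglongrightarrow> 0"
        using ces_shear_L1[OF BLg x l, of s] by (simp add: ces_diff)
      fix N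
      show "0 \<le> integral {0..2*pi} (\<lambda>\<theta>. \<bar>ces l f x N \<theta> - ces l (\<lambda>y. g (shear s \<star> y)) x N \<theta>\<bar>)"
        by (rule Henstock_Kurzweil_Integration.integral_nonneg) (intro I, simp)
      have "integral {0..2*pi} (\<lambda>\<theta>. \<bar>ces l f x N \<theta> - ces l (\<lambda>y. g (shear s \<star> y)) x N \<theta>\<bar>) \<le>
        integral {0..2*pi} (\<lambda>\<theta>. \<bar>ces l f x N \<theta> - ces l g x N \<theta>\<bar> + \<bar>ces l g x N \<theta> - ces l (\<lambda>y. g (shear s \<star> y)) x N \<theta>\<bar>)"
        by (rule integral_le) (intro I, intro I, simp)
      also have "\<dots> = integral {0..2*pi} (\<lambda>\<theta>. \<bar>ces l f x N \<theta> - ces l g x N \<theta>\<bar>) +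
        integral {0..2*pi} (\<lambda>\<theta>. \<bar>ces l g x N \<theta> - ces l (\<lambda>y. g (shear s \<star> y)) x N \<theta>\<bar>)"
        by (rule integral_add) (intro I)+
      finally show "integral {0..2*pi} (\<lambda>\<theta>. \<bar>ces l f x N \<theta> - ces l (\<lambda>y. g (shear s \<star> y)) x N \<theta>\<bar>) \<le> \<dots>" .
    qed
  next
    case (mid g g')
    have BLg: "BL g" "BL g'" by (rule BL_uhull[OF f mid(1)], rule BL_uhull[OF f mid(2)])
    have BLm: "BL (\<lambda>y. (g y + g' y) / 2)" by (rule BL_uhull[OF f uhull.mid[OF mid(1,2)]])
    have ces_m: "ces l (\<lambda>y. (g y + g' y) / 2) x N \<theta> = (ces l g x N \<theta> + ces l g' x N \<theta>) / 2" for N \<theta>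
      using ces_linear[of l "1/2" g "1/2" g' x N \<theta>] by (simp add: add_divide_distrib)
    have aux: "\<bar>u - (v + w) / 2\<bar> \<le> \<bar>u - v\<bar> + \<bar>u - w\<bar>" for u v w :: real
      by (simp add: abs_if field_simps)
    note I = integrable_continuous_real continuous_intros ces_continuous f BLg BLm x
    show ?case
    proof (rule sandwich[OF _ _ mid.IH])
      fix N
      show "0 \<le> integral {0..2*pi} (\<lambda>\<theta>. \<bar>ces l f x N \<theta> - ces l (\<lambda>y. (g y + g' y) / 2) x N \<theta>\<bar>)"
        by (rule Henstock_Kurzweil_Integration.integral_nonneg) (intro I, simp)
      have "integral {0..2*pi} (\<lambda>\<theta>. \<bar>ces l f x N \<theta> - ces l (\<lambda>y. (g y + g' y) / 2) x N \<theta>\<bar>) \<le>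
        integral {0..2*pi} (\<lambda>\<theta>. \<bar>ces l f x N \<theta> - ces l g x N \<theta>\<bar> + \<bar>ces l f x N \<theta> - ces l g' x N \<theta>\<bar>)"
        by (rule integral_le) (intro I, intro I, unfold ces_m, rule aux)
      also have "\<dots> = integral {0..2*pi} (\<lambda>\<theta>. \<bar>ces l f x N \<theta> - ces l g x N \<theta>\<bar>) +
        integral {0..2*pi} (\<lambda>\<theta>. \<bar>ces l f x N \<theta> - ces l g' x N \<theta>\<bar>)"
        by (rule integral_add) (intro I)+
      finally show "integral {0..2*pi} (\<lambda>\<theta>. \<bar>ces l f x N \<theta> - ces l (\<lambda>y. (g y + g' y) / 2) x N \<theta>\<bar>) \<le> \<dots>" .
    qed
  qed
qed

text \<open>After the exchange of \<open>f\<close> for \<open>g\<close>, the remaining deviation is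
  at most the average of |g - c| along the orbit. Integrated over \<theta> this is a Cesaro mean of
  circle integrals, which \<open>circle_bound\<close> controls.\<close>

lemma ces_L1:
  assumes f: "BL f" and x: "x \<in> X" and l: "l > 0"
  shows "(\<lambda>N. integral {0..2*pi} (\<lambda>\<theta>. \<bar>ces l f x N \<theta> - (\<integral>y. f y \<partial>\<mu>)\<bar>)) \<longlonglongrightarrow> 0"
proof (rule LIMSEQ_I)
  fix \<epsilon> :: real assume \<epsilon>: "\<epsilon> > 0"
  define c where "c = (\<integral>y. f y \<partial>\<mu>)"
  \<comment> \<open>Multiplied by the constant 6 * pi of the circle bound this gives \<epsilon>/4;
    the error of that bound, the Cesaro mean and the exchange of \<open>f\<close> for
    \<open>g\<close> take \<epsilon>/4 each.\<close>
  have "\<epsilon> / (24 * pi) > 0" using \<epsilon> by simp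
  then obtain g where g: "g \<in> uhull f" "(\<integral>y. \<bar>g y - c\<bar> \<partial>\<mu>) < \<epsilon> / (24 * pi)"
    using ex_uhull_close[OF f] c_def by blast
  have BLg: "BL g" by (rule BL_uhull[OF f g(1)])
  define k where "k = (\<lambda>y. \<bar>g y - c\<bar>)"
  have k: "BL k" unfolding k_def by (intro BL_abs BL_diff BL_const BLg)
  obtain M where M: "M \<ge> 1" "\<And>y. y \<in> X \<Longrightarrow> \<bar>k y\<bar> \<le> M" using BL_E[OF k] by metis
  define a where "a n = integral {0..2*pi} (\<lambda>\<theta>. k (shear (exp (l * real n)) \<star> rot \<theta> \<star> x))" for n
  have ac: "continuous_on S (\<lambda>\<theta>. k (shear t \<star> rot \<theta> \<star> x))" for S t by (rule arc_continuous[OF k x])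
  have tlim: "filterlim (\<lambda>n. exp (l * real n)) at_top sequentially"
    by (intro filterlim_compose[OF exp_at_top] filterlim_tendsto_pos_mult_at_top[OF tendsto_const l] filterlim_real_sequentially)
  have "\<forall>\<^sub>F N in sequentially. (\<Sum>n=1..N. a n) / real N < \<epsilon> / 2 + \<epsilon> / 4"
  proof (rule cesaro_le)
    show "\<bar>a n\<bar> \<le> M * (2 * pi - 0)" for n
    proof -
      have "norm (a n) \<le> M * (2 * pi - 0)" unfolding a_def
        using M x by (intro integral_bound ac) auto
      then show ?thesis by simp
    qed
    have "\<forall>\<^sub>F n in sequentially. a n \<le> 6 * pi * (\<integral>y. k y \<partial>\<mu>) + \<epsilon> / 4"
      unfolding a_def
      by (rule eventually_compose_filterlim[OF circle_bound[OF k _ x] tlim]) (use \<epsilon> in \<open>auto simp: k_def\<close>)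
    moreover have "6 * pi * (\<integral>y. k y \<partial>\<mu>) + \<epsilon> / 4 \<le> \<epsilon> / 2"
      using g(2) by (simp add: k_def field_simps)
    ultimately show "\<forall>\<^sub>F n in sequentially. a n \<le> \<epsilon> / 2" by (auto elim: eventually_mono)
  qed (use \<epsilon> in auto)
  moreover have "\<forall>\<^sub>F N in sequentially. integral {0..2*pi} (\<lambda>\<theta>. \<bar>ces l f x N \<theta> - ces l g x N \<theta>\<bar>) < \<epsilon> / 4"
    by (rule order_tendstoD(2)[OF integral_ces_uhull[OF f x l g(1)]]) (use \<epsilon> in simp)
  ultimately have "\<forall>\<^sub>F N in sequentially. norm (integral {0..2*pi} (\<lambda>\<theta>. \<bar>ces l f x N \<theta> - c\<bar>) - 0) < \<epsilon>"
    using eventually_gt_at_top[of 0]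
  proof eventually_elim
    case (elim N)
    note I = integrable_continuous_real continuous_intros ces_continuous f BLg k x
    have nonneg: "0 \<le> integral {0..2*pi} (\<lambda>\<theta>. \<bar>ces l f x N \<theta> - c\<bar>)"
      by (rule Henstock_Kurzweil_Integration.integral_nonneg) (intro I, simp)
    have "integral {0..2*pi} (\<lambda>\<theta>. \<bar>ces l f x N \<theta> - c\<bar>) \<le>
        integral {0..2*pi} (\<lambda>\<theta>. \<bar>ces l f x N \<theta> - ces l g x N \<theta>\<bar> + ces l k x N \<theta>)"
    proof (rule integral_le)
      fix \<theta>
      have "ces l g x N \<theta> - c = ces l (\<lambda>y. g y - c) x N \<theta>" using ces_const[OF elim(3)] by (simp add: ces_diff)
      then have "\<bar>ces l g x N \<theta> - c\<bar> \<le> ces l k x N \<theta>" using ces_abs_le[of l "\<lambda>y. g y - c" x N \<theta>] by (simp add: k_def)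
      then show "\<bar>ces l f x N \<theta> - c\<bar> \<le> \<bar>ces l f x N \<theta> - ces l g x N \<theta>\<bar> + ces l k x N \<theta>" by linarith
    qed (intro I)+
    also have "\<dots> = integral {0..2*pi} (\<lambda>\<theta>. \<bar>ces l f x N \<theta> - ces l g x N \<theta>\<bar>) + integral {0..2*pi} (ces l k x N)"
      by (rule integral_add) (intro I)+
    also have "integral {0..2*pi} (ces l k x N) = (\<Sum>n=1..N. a n) / real N"
    proof -
      have "integral {0..2*pi} (\<lambda>\<theta>. \<Sum>n=1..N. k (shear (exp (l * real n)) \<star> rot \<theta> \<star> x)) = (\<Sum>n=1..N. a n)"
        unfolding a_def by (intro integral_sum integrable_continuous_real ac) simp
      then show ?thesis by (simp add: ces_def[abs_def])
    qed
    finally show ?case using nonneg elim(1,2) unfolding real_norm_def diff_zero by linarith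
  qed
  then show "\<exists>N0. \<forall>N\<ge>N0. norm (integral {0..2*pi} (\<lambda>\<theta>. \<bar>ces l f x N \<theta> - (\<integral>y. f y \<partial>\<mu>)\<bar>) - 0) < \<epsilon>"
    by (simp add: c_def eventually_sequentially)
qed

text \<open>The horocycle average at dg (1/m) y is the average of \<open>f\<close> over shears in
  [0, m^2] applied to y itself. As the estimate is uniform in the base point, this substitution is
  harmless; a Riemann sum then yields a finite average.\<close>

lemma compact_uniform_average:
  assumes f: "BL f" and cpt: "compact_space (coset_topology \<Gamma>)" and \<epsilon>: "\<epsilon> > 0"
  obtains n :: nat and \<sigma> :: "nat \<Rightarrow> real" where "n > 0" "\<And>j. \<sigma> j \<in> \<rat>"
    "\<And>y. y \<in> X \<Longrightarrow> \<bar>(\<Sum>j<n. f (shear (\<sigma> j) \<star> y)) / real n - (\<integral>y. f y \<partial>\<mu>)\<bar> \<le> \<epsilon>"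
proof -
  define c where "c = (\<integral>y. f y \<partial>\<mu>)"
  obtain K where K1: "K \<ge> 1" and K: "\<And>y h. y \<in> X \<Longrightarrow> det h = 1 \<Longrightarrow> \<bar>f (h \<star> y) - f y\<bar> \<le> K * dev h"
    using BL_E[OF f] by metis
  have "\<epsilon> / 2 > 0" using \<epsilon> by simp
  then obtain R where R: "R \<ge> 1" "\<And>r y. r \<ge> R \<Longrightarrow> y \<in> X \<Longrightarrow> \<bar>horo_avg r 1 f y - c\<bar> \<le> \<epsilon> / 2"
    using horo_uniform[OF f _ cpt, of 1 "\<epsilon> / 2"] unfolding c_def by auto
  \<comment> \<open>An integer, so that the shear parameters are rational and one null set of angles
    serves all of them.\<close>
  obtain m :: nat where m: "real m \<ge> R" using real_arch_simple by blast
  define T where "T = (real m)\<^sup>2"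
  have m0: "real m \<noteq> 0" using m R by auto
  obtain n :: nat where n: "real n > 2 * K * T / \<epsilon>" using reals_Archimedean2 by blast
  have "0 \<le> 2 * K * T / \<epsilon>" using K1 \<epsilon> by (simp add: T_def)
  then have n0: "n > 0" using n by (cases n) auto
  show ?thesis
  proof (rule that[OF n0, of "\<lambda>j. T * (real j / real n)"])
    show "T * (real j / real n) \<in> \<rat>" for j by (simp add: T_def)
    fix y assume y: "y \<in> X"
    define G where "G s = f (shear (T * s) \<star> y)" for s
    have G: "\<bar>G s - G s'\<bar> \<le> (K * T) * \<bar>s - s'\<bar>" for s s'
    proof -
      have "shear (T * s) \<star> y = shear (T * (s - s')) \<star> shear (T * s') \<star> y"
        by (simp add: algebra_simps flip: act_mult shear_add)
      then have "\<bar>G s - G s'\<bar> \<le> K * dev (shear (T * (s - s')))" unfolding G_def using y by (auto intro!: K)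
      also have "dev (shear (T * (s - s'))) = T * \<bar>s - s'\<bar>" by (simp add: shear_mk abs_mult T_def)
      finally show ?thesis by simp
    qed
    have Gc: "continuous_on UNIV G" unfolding G_def
      by (rule BL_continuous_on[OF f _ _ y]) (auto simp: shear_mk intro!: continuous_intros)
    have "\<bar>integral {0..1} G - (\<Sum>j<n. G (real j / real n)) / real n\<bar> \<le> K * T / real n"
      by (rule riemann_sum_error[OF Gc G n0])
    also have "\<dots> \<le> \<epsilon> / 2" using n n0 \<epsilon> by (simp add: field_simps)
    finally have 1: "\<bar>integral {0..1} G - (\<Sum>j<n. G (real j / real n)) / real n\<bar> \<le> \<epsilon> / 2" .
    have "horo_avg (real m) 1 f (dg (1 / real m) \<star> y) = integral {0..1} G"
    proof -
      have "dg (real m) \<star> shear s \<star> dg (1 / real m) \<star> y = shear (T * s) \<star> y" for s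
      proof -
        have "dg (real m) ** shear s ** dg (1 / real m) = shear (T * s)"
          using m0 by (simp add: dg_def shear_mk T_def power2_eq_square)
        then show ?thesis by (simp flip: act_mult) (simp add: matrix_mul_assoc)
      qed
      then show ?thesis by (simp add: horo_avg_def G_def[abs_def])
    qed
    then have "\<bar>integral {0..1} G - c\<bar> \<le> \<epsilon> / 2" using R(2)[OF m, of "dg (1 / real m) \<star> y"] y m0 by simp
    then show "\<bar>(\<Sum>j<n. f (shear (T * (real j / real n)) \<star> y)) / real n - (\<integral>y. f y \<partial>\<mu>)\<bar> \<le> \<epsilon>"
      using 1 unfolding G_def c_def by linarith
  qed
qed

text \<open>Off one null set the differences for all rational shears die out. For such an angle and
  any \<epsilon> a suitable finite average is within \<epsilon>/2 of the mean at every point, hence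
  also along the orbit.\<close>

lemma ces_AE_compact:
  assumes f: "BL f" and x: "x \<in> X" and l: "l > 0" and cpt: "compact_space (coset_topology \<Gamma>)"
  shows "AE \<theta> in lebesgue_on {0..2*pi}. (\<lambda>N. ces l f x N \<theta>) \<longlonglongrightarrow> (\<integral>y. f y \<partial>\<mu>)"
proof -
  define c where "c = (\<integral>y. f y \<partial>\<mu>)"
  have "AE \<theta> in lebesgue_on {0..2*pi}. \<forall>s\<in>\<rat>. (\<lambda>N. ces l (\<lambda>y. f y - f (shear s \<star> y)) x N \<theta>) \<longlonglongrightarrow> 0"
    by (intro AE_ball_countable' ces_shear_AE f x l countable_rat)
  then show ?thesis
  proof eventually_elim
    case (elim \<theta>)
    show ?case
    proof (rule LIMSEQ_I)
      fix \<epsilon> :: real assume "\<epsilon> > 0"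
      then have e2: "\<epsilon> / 2 > 0" by simp
      obtain n :: nat and \<sigma> :: "nat \<Rightarrow> real" where n: "n > 0" "\<And>j. \<sigma> j \<in> \<rat>"
        "\<And>y. y \<in> X \<Longrightarrow> \<bar>(\<Sum>j<n. f (shear (\<sigma> j) \<star> y)) / real n - c\<bar> \<le> \<epsilon> / 2"
        using compact_uniform_average[OF f cpt e2] unfolding c_def by metis
      define A where "A = (\<lambda>y. (\<Sum>j<n. f (shear (\<sigma> j) \<star> y)) / real n)"
      have diff: "ces l f x N \<theta> - ces l A x N \<theta> = (\<Sum>j<n. ces l (\<lambda>y. f y - f (shear (\<sigma> j) \<star> y)) x N \<theta>) / real n" for N
      proof -
        have "ces l (\<lambda>y. f y - A y) x N \<theta> = (\<Sum>j<n. ces l (\<lambda>y. f y - f (shear (\<sigma> j) \<star> y)) x N \<theta>) / real n"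
        proof -
          have "f y - A y = (\<Sum>j<n. f y - f (shear (\<sigma> j) \<star> y)) / real n" for y
            using n(1) by (simp add: A_def sum_subtractf field_simps)
          moreover have "(\<Sum>k=1..N. (\<Sum>j<n. d j k) / real n) / real N = (\<Sum>j<n. (\<Sum>k=1..N. d j k) / real N) / real n"
            for d :: "nat \<Rightarrow> nat \<Rightarrow> real"
            unfolding sum_divide_distrib[symmetric] by (subst sum.swap) simp
          ultimately show ?thesis unfolding ces_def by simp
        qed
        then show ?thesis by (simp add: ces_diff)
      qed
      have "(\<lambda>N. (\<Sum>j<n. ces l (\<lambda>y. f y - f (shear (\<sigma> j) \<star> y)) x N \<theta>) / real n) \<longlonglongrightarrow> (\<Sum>j<n. 0) / real n"
        using n elim by (intro tendsto_intros tendsto_sum) auto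
      then have lim: "(\<lambda>N. ces l f x N \<theta> - ces l A x N \<theta>) \<longlonglongrightarrow> 0" unfolding diff by simp
      obtain N0 where N0: "\<And>N. N \<ge> N0 \<Longrightarrow> \<bar>ces l f x N \<theta> - ces l A x N \<theta>\<bar> < \<epsilon> / 2"
        using LIMSEQ_D[OF lim e2] by auto
      have "norm (ces l f x N \<theta> - (\<integral>y. f y \<partial>\<mu>)) < \<epsilon>" if N: "N \<ge> max 1 N0" for N
      proof -
        have "ces l A x N \<theta> - c = ces l (\<lambda>y. A y - c) x N \<theta>" using N ces_const[of N] by (simp add: ces_diff)
        then have "\<bar>ces l A x N \<theta> - c\<bar> \<le> \<epsilon> / 2"
          using ces_bound[of "\<lambda>y. A y - c" "\<epsilon> / 2" x l N \<theta>] n(3) e2 x by (simp add: A_def)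
        moreover have "\<bar>ces l f x N \<theta> - ces l A x N \<theta>\<bar> < \<epsilon> / 2" using N0 N by simp
        ultimately show ?thesis unfolding c_def real_norm_def by linarith
      qed
      then show "\<exists>N0. \<forall>N\<ge>N0. norm (ces l f x N \<theta> - (\<integral>y. f y \<partial>\<mu>)) < \<epsilon>" by blast
    qed
  qed
qed

end

section \<open>Convergence along a set of upper density one\<close>

text \<open>The blocks \<open>{m k<..m (Suc k)}\<close> grow so fast that the exceptional indices of the last
  block dominate all previous ones.\<close>

lemma upper_density_one_subset:
  fixes b :: "nat \<Rightarrow> real"
  assumes b: "\<And>N. b N \<ge> 0"
    and small: "\<And>\<epsilon> n. \<epsilon> > 0 \<Longrightarrow> \<exists>M\<ge>n. (\<Sum>N=1..M. b N) / real M < \<epsilon>"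
  obtains A where "upper_density A = 1" "(b \<longlongrightarrow> 0) (inf sequentially (principal A))"
proof -
  \<comment> \<open>The factor \<open>k + 1\<close> makes the indices up to \<open>m k\<close> a
    fraction of at most 1 / (k + 1). The square pays for Markov's inequality at threshold 1 / (k +
    1), which leaves an exceptional fraction of at most 1 / (k + 1).\<close>
  have "\<exists>m :: nat \<Rightarrow> nat. \<forall>k. m k > 0 \<and> (m (Suc k) \<ge> (k + 1) * m k \<and> m (Suc k) > m k \<and>
      (\<Sum>N=1..m (Suc k). b N) / real (m (Suc k)) < 1 / (real k + 1)\<^sup>2)"
  proof (rule dependent_nat_choice)
    show "\<exists>x :: nat. x > 0" by blast
    fix x k :: nat assume "x > 0"
    obtain M where M: "M \<ge> (k + 1) * x + x + 1" "(\<Sum>N=1..M. b N) / real M < 1 / (real k + 1)\<^sup>2"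
      using small[of "1 / (real k + 1)\<^sup>2" "(k + 1) * x + x + 1"] by auto
    then show "\<exists>y>0. (k + 1) * x \<le> y \<and> x < y \<and> (\<Sum>N=1..y. b N) / real y < 1 / (real k + 1)\<^sup>2"
      by (intro exI[of _ M]) auto
  qed
  then obtain m :: "nat \<Rightarrow> nat" where m: "\<And>k. m k > 0" "\<And>k. m (Suc k) \<ge> (k + 1) * m k" "\<And>k. m (Suc k) > m k"
    "\<And>k. (\<Sum>N=1..m (Suc k). b N) / real (m (Suc k)) < 1 / (real k + 1)\<^sup>2" by metis
  have mono: "strict_mono m" by (rule strict_monoI_Suc) (rule m)
  define A where "A = {N. \<exists>k. m k < N \<and> N \<le> m (Suc k) \<and> b N < 1 / (real k + 1)}"
  have card_A: "real (card (A \<inter> {1..m (Suc k)})) / real (m (Suc k)) \<ge> 1 - 2 / (real k + 1)" for k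
  proof -
    define B where "B = {N \<in> {m k<..m (Suc k)}. b N \<ge> 1 / (real k + 1)}"
    have fin: "finite B" by (simp add: B_def)
    have "{m k<..m (Suc k)} \<subseteq> (A \<inter> {1..m (Suc k)}) \<union> B" by (auto simp: A_def B_def not_less)
    then have "card {m k<..m (Suc k)} \<le> card ((A \<inter> {1..m (Suc k)}) \<union> B)" using fin by (intro card_mono) auto
    also have "\<dots> \<le> card (A \<inter> {1..m (Suc k)}) + card B" by (rule card_Un_le)
    finally have c1: "real (m (Suc k)) - real (m k) \<le> real (card (A \<inter> {1..m (Suc k)})) + real (card B)"
      using m(3)[of k] by simp
    have "real (card B) * (1 / (real k + 1)) = (\<Sum>N\<in>B. 1 / (real k + 1))" by simp
    also have "\<dots> \<le> (\<Sum>N\<in>B. b N)" by (intro sum_mono) (simp add: B_def)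
    also have "\<dots> \<le> (\<Sum>N=1..m (Suc k). b N)" by (intro sum_mono2) (auto simp: B_def b)
    also have "\<dots> \<le> real (m (Suc k)) / (real k + 1)\<^sup>2"
      using m(4)[of k] m(1)[of "Suc k"] by (simp add: divide_less_eq)
    finally have "real (card B) * (1 / (real k + 1)) * (real k + 1) \<le> real (m (Suc k)) / (real k + 1)\<^sup>2 * (real k + 1)"
      by (rule mult_right_mono) simp
    moreover have "real (card B) * (1 / (real k + 1)) * (real k + 1) = real (card B)" by simp
    moreover have "real (m (Suc k)) / (real k + 1)\<^sup>2 * (real k + 1) = real (m (Suc k)) / (real k + 1)"
      by (simp add: power2_eq_square)
    ultimately have c2: "real (card B) \<le> real (m (Suc k)) / (real k + 1)" by linarith
    have "real ((k + 1) * m k) \<le> real (m (Suc k))" using m(2)[of k] by (simp only: of_nat_le_iff)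
    then have c3: "real (m k) \<le> real (m (Suc k)) / (real k + 1)" by (simp add: field_simps)
    have "real (m (Suc k)) * (1 - 2 / (real k + 1)) = real (m (Suc k)) - 2 * (real (m (Suc k)) / (real k + 1))"
      by (simp add: algebra_simps)
    also have "\<dots> \<le> real (card (A \<inter> {1..m (Suc k)}))" using c1 c2 c3 by linarith
    finally show ?thesis using m(1)[of "Suc k"] by (simp add: pos_le_divide_eq mult.commute)
  qed
  let ?X = "\<lambda>N. ereal (real (card (A \<inter> {1..N})) / real N)"
  have le1: "real (card (A \<inter> {1..N})) / real N \<le> 1" for N
  proof -
    have "card (A \<inter> {1..N}) \<le> card {1..N}" by (intro card_mono) auto
    then show ?thesis by (cases "N = 0") (auto simp: divide_le_eq)
  qed
  have "limsup ?X \<le> 1" by (intro Limsup_bounded always_eventually allI) (use le1 in simp)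
  moreover have "1 \<le> limsup ?X"
  proof -
    have sm: "strict_mono (\<lambda>k. m (Suc k))" using mono by (simp add: strict_mono_def)
    have "(\<lambda>k. real (card (A \<inter> {1..m (Suc k)})) / real (m (Suc k))) \<longlonglongrightarrow> 1"
    proof (rule real_tendsto_sandwich)
      show "(\<lambda>k. 1 - 2 / (real k + 1)) \<longlonglongrightarrow> 1" by real_asymp
    qed (use card_A le1 in auto)
    then have "(?X \<circ> (\<lambda>k. m (Suc k))) \<longlonglongrightarrow> ereal 1" by (simp add: o_def)
    then have "limsup (?X \<circ> (\<lambda>k. m (Suc k))) = 1" by (simp add: lim_imp_Limsup)
    then show ?thesis using limsup_subseq_mono[OF sm, of ?X] by simp
  qed
  ultimately have ud: "upper_density A = 1" unfolding upper_density_def by (rule antisym)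
  have "(b \<longlongrightarrow> 0) (inf sequentially (principal A))"
  proof (rule tendstoI)
    fix \<epsilon> :: real assume "\<epsilon> > 0"
    then obtain k0 where k0: "1 / (real k0 + 1) < \<epsilon>" using nat_approx_posE by (metis Suc_eq_plus1 of_nat_Suc add.commute)
    have close: "dist (b N) 0 < \<epsilon>" if N: "N > m k0" "N \<in> A" for N
    proof -
      obtain k where k: "m k < N" "N \<le> m (Suc k)" "b N < 1 / (real k + 1)" using N(2) by (auto simp: A_def)
      have "m k0 < m (Suc k)" using N k by simp
      then have "k0 \<le> k" using strict_mono_less[OF mono] by simp
      then have "1 / (real k + 1) \<le> 1 / (real k0 + 1)" by (intro divide_left_mono) auto
      then show ?thesis using k(3) k0 b[of N] by simp
    qed
    show "\<forall>\<^sub>F N in inf sequentially (principal A). dist (b N) 0 < \<epsilon>"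
      unfolding eventually_inf_principal using eventually_gt_at_top[of "m k0"]
      by eventually_elim (use close in blast)
  qed
  with ud show ?thesis using that by blast
qed

text \<open>Dominated convergence for series: the tails are bounded by a geometric series uniformly
  in \<open>N\<close>. Cutting the sum at \<open>N\<close> itself avoids infinite sums of functions
  later.\<close>

lemma weighted_sum_tendsto_0:
  fixes u :: "nat \<Rightarrow> nat \<Rightarrow> real"
  assumes u: "\<And>j N. 0 \<le> u j N" "\<And>j N. u j N \<le> C" and lim: "\<And>j. u j \<longlonglongrightarrow> 0"
  shows "(\<lambda>N. \<Sum>j<N. (1/2) ^ j * u j N) \<longlonglongrightarrow> 0"
proof (rule LIMSEQ_I)
  fix \<epsilon> :: real assume \<epsilon>: "\<epsilon> > 0"
  have C0: "C \<ge> 0" using u[of 0 0] by linarith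
  have "(\<lambda>J. 2 * C * (1/2) ^ J) \<longlonglongrightarrow> 2 * C * 0" by (intro tendsto_intros LIMSEQ_power_zero) simp
  then have "\<forall>\<^sub>F J in sequentially. 2 * C * (1/2) ^ J < \<epsilon> / 2" by (rule order_tendstoD(2)) (use \<epsilon> in simp)
  then obtain J where J: "2 * C * (1/2) ^ J < \<epsilon> / 2" by (auto simp: eventually_sequentially)
  have "(\<lambda>N. \<Sum>j<J. (1/2) ^ j * u j N) \<longlonglongrightarrow> (\<Sum>j<J. (1/2) ^ j * 0)" by (intro tendsto_intros lim)
  then have "\<forall>\<^sub>F N in sequentially. (\<Sum>j<J. (1/2) ^ j * u j N) < \<epsilon> / 2" by (rule order_tendstoD(2)) (use \<epsilon> in simp)
  then obtain N0 where N0: "\<And>N. N \<ge> N0 \<Longrightarrow> (\<Sum>j<J. (1/2) ^ j * u j N) < \<epsilon> / 2" by (auto simp: eventually_sequentially)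
  show "\<exists>N0. \<forall>N\<ge>N0. norm ((\<Sum>j<N. (1/2) ^ j * u j N) - 0) < \<epsilon>"
  proof (intro exI[of _ "max J N0"] allI impI)
    fix N assume N: "max J N0 \<le> N"
    have "(\<Sum>j<N. (1/2) ^ j * u j N) = (\<Sum>j<J. (1/2) ^ j * u j N) + (\<Sum>j=J..<N. (1/2) ^ j * u j N)"
      using N sum.atLeastLessThan_concat[of 0 J N "\<lambda>j. (1/2) ^ j * u j N"] by (simp add: lessThan_atLeast0)
    moreover have "(\<Sum>j=J..<N. (1/2) ^ j * u j N) \<le> 2 * C * (1/2) ^ J"
    proof -
      have "(\<Sum>j=J..<N. (1/2) ^ j * u j N) \<le> (\<Sum>j=J..<N. (1/2) ^ j * C)" by (intro sum_mono mult_left_mono u) auto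
      also have "\<dots> = (\<Sum>j=J..<N. (1/2) ^ j) * C" by (simp add: sum_distrib_right)
      also have "(\<Sum>j=J..<N. (1/2 :: real) ^ j) \<le> 2 * (1/2) ^ J"
      proof -
        have "(\<Sum>j=J..<J+n. (1/2 :: real) ^ j) = 2 * (1/2) ^ J - 2 * (1/2) ^ (J + n)" for n
          by (induction n) auto
        from this[of "N - J"] show ?thesis using N by simp
      qed
      finally show ?thesis using C0 by (simp add: mult_ac mult_right_mono)
    qed
    moreover have "0 \<le> (\<Sum>j<N. (1/2) ^ j * u j N)" by (intro sum_nonneg mult_nonneg_nonneg u) auto
    ultimately show "norm ((\<Sum>j<N. (1/2) ^ j * u j N) - 0) < \<epsilon>" using J N0[of N] N by simp
  qed
qed

text \<open>One set \<open>A\<close> has to serve all \<open>j\<close>, so the sequences are merged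
  with weights 2^(-j) into a single sequence \<open>b\<close>. Its integrals tend to zero, hence
  also their Cesaro means; along suitable indices these are summable, and almost everywhere the
  Cesaro means of \<open>b\<close> become arbitrarily small along those indices.\<close>

lemma AE_density_one_convergence:
  fixes W :: "nat \<Rightarrow> nat \<Rightarrow> real \<Rightarrow> real"
  assumes c: "\<And>j N. continuous_on {0..p} (W j N)" and p: "p \<ge> 0"
    and lim: "\<And>j. (\<lambda>N. integral {0..p} (\<lambda>\<theta>. \<bar>W j N \<theta>\<bar>)) \<longlonglongrightarrow> 0"
  shows "AE \<theta> in lebesgue_on {0..p}. \<exists>A. upper_density A = 1 \<and>
    (\<forall>j. ((\<lambda>N. W j N \<theta>) \<longlongrightarrow> 0) (inf sequentially (principal A)))"
proof -
  \<comment> \<open>Truncation at one gives the uniform bound that the weighted sum needs and does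
    not affect convergence to zero.\<close>
  define w where "w j N \<theta> = min 1 \<bar>W j N \<theta>\<bar>" for j N \<theta>
  have wc: "continuous_on {0..p} (w j N)" for j N unfolding w_def by (intro continuous_intros c)
  have w01: "0 \<le> w j N \<theta>" "w j N \<theta> \<le> 1" for j N \<theta> by (auto simp: w_def)
  define b where "b N \<theta> = (\<Sum>j<N. (1/2) ^ j * w j N \<theta>)" for N \<theta>
  have bc: "continuous_on {0..p} (b N)" for N unfolding b_def by (intro continuous_intros wc)
  have b0: "b N \<theta> \<ge> 0" for N \<theta> unfolding b_def by (intro sum_nonneg mult_nonneg_nonneg w01) auto
  define B where "B N = integral {0..p} (b N)" for N
  have B: "B N = (\<Sum>j<N. (1/2) ^ j * integral {0..p} (w j N))" for N
    unfolding B_def b_def by (subst integral_sum) (auto intro!: integrable_continuous_real continuous_intros wc)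
  have w0: "0 \<le> integral {0..p} (w j N)" for j N
    by (intro Henstock_Kurzweil_Integration.integral_nonneg integrable_continuous_real wc w01)
  have Blim: "B \<longlonglongrightarrow> 0" unfolding B[abs_def]
  proof (rule weighted_sum_tendsto_0[OF w0])
    fix j
    show "integral {0..p} (w j N) \<le> 1 * (p - 0)" for N
    proof -
      have "norm (integral {0..p} (w j N)) \<le> 1 * (p - 0)" using p w01 by (intro integral_bound wc) auto
      then show ?thesis by simp
    qed
    show "(\<lambda>N. integral {0..p} (w j N)) \<longlonglongrightarrow> 0"
    proof (rule real_tendsto_sandwich[OF _ _ tendsto_const lim])
      show "\<forall>\<^sub>F N in sequentially. integral {0..p} (w j N) \<le> integral {0..p} (\<lambda>\<theta>. \<bar>W j N \<theta>\<bar>)"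
        by (intro always_eventually allI integral_le integrable_continuous_real wc continuous_intros c) (simp add: w_def)
    qed (use w0 in auto)
  qed
  have B0: "B N \<ge> 0" for N unfolding B by (intro sum_nonneg mult_nonneg_nonneg w0) auto
  obtain M where M: "\<And>N. \<bar>B N\<bar> \<le> M" using convergent_imp_Bseq[of B] Blim by (auto simp: convergent_def Bseq_def)
  have cesB: "\<forall>\<^sub>F N in sequentially. (\<Sum>n=1..N. B n) / real N < 0 + \<epsilon>" if \<epsilon>: "\<epsilon> > 0" for \<epsilon>
  proof -
    have "\<epsilon> / 2 > 0" using \<epsilon> by simp
    then have "\<forall>\<^sub>F n in sequentially. B n < \<epsilon> / 2" by (rule order_tendstoD(2)[OF Blim])
    then have "\<forall>\<^sub>F n in sequentially. B n \<le> \<epsilon> / 2" by (auto elim: eventually_mono)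
    then have "\<forall>\<^sub>F N in sequentially. (\<Sum>n=1..N. B n) / real N < \<epsilon> / 2 + \<epsilon> / 2"
      using \<epsilon> by (intro cesaro_le[OF M]) auto
    then show ?thesis by simp
  qed
  \<comment> \<open>No rate is available, so the indices are chosen to make the means summable;
    \<open>r k \<ge> k\<close> ensures that they become arbitrarily large.\<close>
  have "\<exists>r\<ge>k. (\<Sum>n=1..r. B n) / real r < (1/2) ^ k" for k :: nat
    using eventually_conj[OF cesB[of "(1/2) ^ k"] eventually_ge_at_top[of k]] by (auto simp: eventually_sequentially)
  then obtain r where r: "\<And>k. r k \<ge> k" "\<And>k. (\<Sum>n=1..r k. B n) / real (r k) < (1/2) ^ k" by metis
  define a where "a k \<theta> = (\<Sum>n=1..r k. b n \<theta>) / real (r k)" for k \<theta>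
  have ac: "continuous_on {0..p} (a k)" for k unfolding a_def divide_inverse by (intro continuous_intros bc)
  have a0: "a k \<theta> \<ge> 0" for k \<theta> unfolding a_def by (intro divide_nonneg_nonneg sum_nonneg b0) auto
  have aI: "integrable (lebesgue_on {0..p}) (a k)" for k by (rule continuous_imp_integrable_real[OF ac])
  have "AE \<theta> in lebesgue_on {0..p}. summable (\<lambda>k. a k \<theta>)"
  proof (rule L1_summable_AE[OF aI a0])
    show "summable (\<lambda>k. integral\<^sup>L (lebesgue_on {0..p}) (a k))"
    proof (rule summable_comparison_test')
      show "summable (\<lambda>k. (1/2 :: real) ^ k)" by (rule summable_geometric) simp
      fix k
      have "integral\<^sup>L (lebesgue_on {0..p}) (a k) = integral {0..p} (a k)" by (rule lebesgue_integral_eq_integral[OF aI]) simp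
      also have "\<dots> = (\<Sum>n=1..r k. B n) / real (r k)"
        unfolding a_def B_def by (simp add: integral_sum integrable_continuous_real bc)
      finally show "norm (integral\<^sup>L (lebesgue_on {0..p}) (a k)) \<le> (1/2) ^ k"
        using r(2)[of k] B0 by (simp add: abs_of_nonneg sum_nonneg)
    qed
  qed
  then show ?thesis
  proof eventually_elim
    case (elim \<theta>)
    then have a_lim: "(\<lambda>k. a k \<theta>) \<longlonglongrightarrow> 0" by (rule summable_LIMSEQ_zero)
    have "\<exists>M\<ge>n. (\<Sum>N=1..M. b N \<theta>) / real M < \<epsilon>" if "\<epsilon> > 0" for \<epsilon> n
    proof -
      have "\<forall>\<^sub>F k in sequentially. a k \<theta> < \<epsilon> \<and> k \<ge> n"
        by (intro eventually_conj order_tendstoD(2)[OF a_lim] eventually_ge_at_top that)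
      then obtain k where k: "a k \<theta> < \<epsilon>" "k \<ge> n" by (auto simp: eventually_sequentially)
      then show ?thesis using r(1)[of k] by (intro exI[of _ "r k"]) (auto simp: a_def)
    qed
    then obtain A where A: "upper_density A = 1" "((\<lambda>N. b N \<theta>) \<longlongrightarrow> 0) (inf sequentially (principal A))"
      using upper_density_one_subset[of "\<lambda>N. b N \<theta>"] b0 by metis
    have "((\<lambda>N. W j N \<theta>) \<longlongrightarrow> 0) (inf sequentially (principal A))" for j
    proof -
      have "\<forall>\<^sub>F N in sequentially. norm (w j N \<theta>) \<le> 2 ^ j * b N \<theta>"
        using eventually_gt_at_top[of j]
      proof eventually_elim
        case (elim N)
        have "(1/2) ^ j * w j N \<theta> \<le> b N \<theta>" unfolding b_def
          using elim w01 by (intro member_le_sum) auto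
        then have "2 ^ j * ((1/2) ^ j * w j N \<theta>) \<le> 2 ^ j * b N \<theta>" by (rule mult_left_mono) simp
        moreover have "2 ^ j * ((1/2) ^ j * w j N \<theta>) = w j N \<theta>" by (simp add: power_divide)
        ultimately show ?case using w01(1)[of j N \<theta>] by simp
      qed
      then have "\<forall>\<^sub>F N in inf sequentially (principal A). norm (w j N \<theta>) \<le> 2 ^ j * b N \<theta>"
        by (rule filter_leD[OF inf_le1])
      then have w_lim: "((\<lambda>N. w j N \<theta>) \<longlongrightarrow> 0) (inf sequentially (principal A))"
        by (rule Lim_null_comparison) (use tendsto_mult_right_zero[OF A(2)] in simp)
      \<comment> \<open>Once the truncated value lies below one the truncation is inactive, which
        returns the statement to \<open>W\<close>.\<close>
      then have "\<forall>\<^sub>F N in inf sequentially (principal A). w j N \<theta> < 1" by (rule order_tendstoD) simp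
      then have "\<forall>\<^sub>F N in inf sequentially (principal A). w j N \<theta> = \<bar>W j N \<theta>\<bar>"
        by eventually_elim (auto simp: w_def min_def split: if_splits)
      with w_lim have "((\<lambda>N. \<bar>W j N \<theta>\<bar>) \<longlongrightarrow> 0) (inf sequentially (principal A))"
        by (rule Lim_transform_eventually)
      then show ?thesis by (rule tendsto_rabs_zero_cancel)
    qed
    with A(1) show ?case by blast
  qed
qed

context sl2_quotient begin

section \<open>Weak convergence\<close>

text \<open>A substitute for the distance on the quotient: the least displacement of a group element
  carrying \<open>z\<close> to \<open>y\<close>. Such elements exist by transitivity on the
  space.\<close>

definition disp :: "(real^2^2) set \<Rightarrow> (real^2^2) set \<Rightarrow> real" where
  "disp z y = Inf (dev ` {h. det h = 1 \<and> h \<star> z = y})"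

lemma disp_le: "det h = 1 \<Longrightarrow> disp z (h \<star> z) \<le> dev h"
  unfolding disp_def by (intro cInf_lower bdd_belowI[of _ 0]) auto

lemma disp_nonneg: assumes "z \<in> X" "y \<in> X" shows "disp z y \<ge> 0"
proof -
  obtain h where "det h = 1" "y = h \<star> z" using transitive assms by metis
  then show ?thesis unfolding disp_def by (intro cInf_greatest) auto
qed

lemma disp_less:
  assumes "z \<in> X" "y \<in> X" "disp z y < c"
  obtains h where "det h = 1" "y = h \<star> z" "dev h < c"
proof -
  obtain h where "det h = 1" "y = h \<star> z" using transitive assms by metis
  then have "dev ` {h. det h = 1 \<and> h \<star> z = y} \<noteq> {}" by auto
  then have "\<exists>v \<in> dev ` {h. det h = 1 \<and> h \<star> z = y}. v < c"
    using assms(3) unfolding disp_def by (rule cInf_lessD)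
  then show ?thesis using that by auto
qed

text \<open>A triangle inequality with the extra factor inherited from the product term in
  \<open>dev_mult\<close>. An infimum need not be attained, hence the argument with
  \<open>e\<close>.\<close>

lemma disp_act:
  assumes "z \<in> X" "y \<in> X" "det g = 1"
  shows "disp z (g \<star> y) \<le> disp z y + dev g * (1 + disp z y)"
proof (rule field_le_epsilon)
  fix e :: real assume e: "e > 0"
  define e' where "e' = e / (1 + dev g)"
  have e': "e' > 0" using e by (simp add: e'_def add_pos_nonneg)
  obtain h where h: "det h = 1" "y = h \<star> z" "dev h < disp z y + e'"
    using disp_less[OF assms(1,2), of "disp z y + e'"] e' by auto
  have "disp z (g \<star> y) \<le> dev (g ** h)"
    using disp_le[of "g ** h" z] h assms(3) by (simp add: act_mult det_mul)
  also have "\<dots> \<le> dev g + dev h * (1 + dev g)" using dev_mult[of g h] by (simp add: algebra_simps)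
  also have "\<dots> \<le> dev g + (disp z y + e') * (1 + dev g)"
    using h(3) by (intro add_left_mono mult_right_mono) (auto intro: add_nonneg_nonneg)
  also have "\<dots> = disp z y + dev g * (1 + disp z y) + e' * (1 + dev g)" by (simp add: algebra_simps)
  also have "e' * (1 + dev g) = e" using add_pos_nonneg[of 1 "dev g"] by (simp add: e'_def)
  finally show "disp z (g \<star> y) \<le> disp z y + dev g * (1 + disp z y) + e" .
qed

definition bump :: "(real^2^2) set \<Rightarrow> real \<Rightarrow> (real^2^2) set \<Rightarrow> real" where
  "bump z k y = max 0 (1 - k * disp z y)"

lemma BL_bump: assumes z: "z \<in> X" and k: "k \<ge> 1" shows "BL (bump z k)"
proof -
  have half: "bump z k y - bump z k (g \<star> y) \<le> 2 * k * dev g" if "y \<in> X" "det g = 1" for y g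
  proof (cases "k * disp z y < 1")
    case True
    \<comment> \<open>Where the bump is positive, \<open>k \<ge> 1\<close> gives displacement below
      one, so the extra factor in \<open>disp_act\<close> is at most two.\<close>
    have "disp z y \<le> k * disp z y" using mult_right_mono[OF k disp_nonneg[OF z that(1)]] by simp
    then have "dev g * (1 + disp z y) \<le> dev g * 2" using True by (intro mult_left_mono) auto
    then have "disp z (g \<star> y) \<le> disp z y + 2 * dev g" using disp_act[OF z that] by simp
    then have "k * disp z (g \<star> y) \<le> k * (disp z y + 2 * dev g)" using k by (intro mult_left_mono) auto
    then show ?thesis using True unfolding bump_def by (simp add: distrib_left)
  next
    case False
    then have "bump z k y = 0" by (simp add: bump_def)
    moreover have "bump z k (g \<star> y) \<ge> 0" by (simp add: bump_def)
    moreover have "2 * k * dev g \<ge> 0" using k by simp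
    ultimately show ?thesis by linarith
  qed
  show ?thesis
  proof (rule BL_I)
    fix y assume y: "y \<in> X"
    show "\<bar>bump z k y\<bar> \<le> 1" using disp_nonneg[OF z y] k by (simp add: bump_def)
    fix g :: "real^2^2" assume g: "det g = 1"
    show "\<bar>bump z k (g \<star> y) - bump z k y\<bar> \<le> 2 * k * dev g"
      using half[OF y g] half[of "g \<star> y" "inv2 g"] y g by (simp add: abs_le_iff)
  qed
qed

text \<open>The condition on \<open>f\<close> is lower semicontinuity, the natural one for
  approximation from below. The indices \<open>J\<close> do not depend on the point, so the
  approximants belong to the family and their averages along the orbit are known.\<close>

definition determining :: "(nat \<Rightarrow> (real^2^2) set \<Rightarrow> real) \<Rightarrow> bool" where
  "determining F \<longleftrightarrow> (\<forall>j. BL (F j)) \<and>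
    (\<forall>f. (\<forall>a. openin (coset_topology \<Gamma>) {y\<in>X. a < f y}) \<longrightarrow> (\<forall>y\<in>X. 0 \<le> f y) \<longrightarrow>
      (\<exists>J. \<forall>y\<in>X. (\<forall>i :: nat. 0 \<le> F (J i) y \<and> F (J i) y \<le> f y) \<and> (\<lambda>i. F (J i) y) \<longlonglongrightarrow> f y))"

text \<open>Every nonnegative continuous function is the increasing limit of maxima of finitely many
  bumps from a countable family, so these maxima determine weak convergence.\<close>

lemma ex_determining: obtains F where "determining F"
proof -
  obtain Z where Z: "countable Z" "Z \<subseteq> X" "Z \<noteq> {}"
    "\<And>y \<delta>. y \<in> X \<Longrightarrow> \<delta> > 0 \<Longrightarrow> \<exists>z\<in>Z. \<exists>h. det h = 1 \<and> dev h < \<delta> \<and> y = h \<star> z"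
    by (rule dense_points) blast
  \<comment> \<open>A number codes a center, a width and a rational height; negative heights are
    replaced by zero, and \<open>Suc\<close> keeps the slope at least one.\<close>
  define e where "e i = (case from_nat i :: nat \<times> nat \<times> rat of (a, k, q) \<Rightarrow>
      (\<lambda>y. max 0 (real_of_rat q) * bump (from_nat_into Z a) (real (Suc k)) y))" for i :: nat
  have e_eq: "\<exists>i. e i = (\<lambda>y. real_of_rat q * bump z (real (Suc k)) y)" if z: "z \<in> Z" and q: "real_of_rat q \<ge> 0" for z k q
  proof -
    obtain a where "z = from_nat_into Z a" using from_nat_into_surj[OF Z(1) z] by metis
    then have "e (to_nat (a, k, q)) = (\<lambda>y. real_of_rat q * bump z (real (Suc k)) y)" using q by (simp add: e_def)
    then show ?thesis by blast
  qed
  have BL_e: "BL (e i)" for i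
  proof -
    obtain a k q where "(from_nat i :: nat \<times> nat \<times> rat) = (a, k, q)" by (cases "from_nat i :: nat \<times> nat \<times> rat") auto
    then show ?thesis using Z(2) from_nat_into[OF Z(3)] by (auto simp: e_def intro!: BL_cmult BL_bump)
  qed
  define mx where "mx I y = Max (insert 0 ((\<lambda>i. e i y) ` I))" for I y
  have BL_mx: "BL (mx I)" if "finite I" for I
    using that
  proof induction
    case empty
    show ?case using BL_const[of 0] by (simp add: mx_def[abs_def])
  next
    case (insert i I)
    have "mx (insert i I) = (\<lambda>y. max (e i y) (mx I y))"
    proof
      fix y
      have "mx (insert i I) y = Max (insert (e i y) (insert 0 ((\<lambda>i. e i y) ` I)))"
        by (simp add: mx_def insert_commute)
      then show "mx (insert i I) y = max (e i y) (mx I y)" using insert(1) by (simp add: mx_def)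
    qed
    then show ?case using BL_max[OF BL_e insert.IH] by simp
  qed
  define F where "F j = mx (set (from_nat j :: nat list))" for j
  show ?thesis
  proof (rule that[of F], unfold determining_def, intro conjI allI impI)
    show "BL (F j)" for j unfolding F_def by (rule BL_mx) simp
    fix f :: "(real^2^2) set \<Rightarrow> real"
    assume "\<forall>a. openin (coset_topology \<Gamma>) {y\<in>X. a < f y}" and "\<forall>y\<in>X. 0 \<le> f y"
    then have op: "\<And>a. openin (coset_topology \<Gamma>) {y\<in>X. a < f y}" and f0: "\<And>y. y \<in> X \<Longrightarrow> f y \<ge> 0" by auto
    \<comment> \<open>The list of those codes below \<open>i\<close> whose bump lies below
      \<open>f\<close> everywhere; the maximum over it increases with \<open>i\<close>.\<close>
    define J where "J i = to_nat [m \<leftarrow> [0..<i]. \<forall>w\<in>X. e m w \<le> f w]" for i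
    have FJ: "F (J i) y = Max (insert 0 ((\<lambda>m. e m y) ` {m. m < i \<and> (\<forall>w\<in>X. e m w \<le> f w)}))" for i y
      by (simp add: F_def J_def mx_def)
    have fin: "finite (insert 0 ((\<lambda>m. e m y) ` {m. m < i \<and> (\<forall>w\<in>X. e m w \<le> f w)}))" for i :: nat and y by simp
    show "\<exists>J. \<forall>y\<in>X. (\<forall>i :: nat. 0 \<le> F (J i) y \<and> F (J i) y \<le> f y) \<and> (\<lambda>i. F (J i) y) \<longlonglongrightarrow> f y"
    proof (intro exI[of _ J] ballI conjI allI)
      fix y i assume y: "y \<in> X"
      show "0 \<le> F (J i) y" unfolding FJ using fin by (intro Max_ge) auto
      show "F (J i) y \<le> f y" unfolding FJ using fin f0 y by (subst Max_le_iff) auto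
    next
      fix y assume y: "y \<in> X"
      show "(\<lambda>i. F (J i) y) \<longlonglongrightarrow> f y"
      proof (rule order_tendstoI)
        fix a assume "f y < a"
        moreover have "F (J i) y \<le> f y" for i unfolding FJ using fin f0 y by (subst Max_le_iff) auto
        ultimately show "\<forall>\<^sub>F i in sequentially. F (J i) y < a" by (intro always_eventually allI) (rule le_less_trans)
      next
        fix a assume a: "a < f y"
        have "\<exists>m. (\<forall>w\<in>X. e m w \<le> f w) \<and> a < e m y" if "a \<ge> 0"
        proof -
          obtain q where q: "a < real_of_rat q" "real_of_rat q < f y" using of_rat_dense[OF a] by blast
          define Q where "Q = real_of_rat q"
          have Q: "Q > 0" "a < Q" "Q < f y" unfolding Q_def using q that by linarith+
          obtain \<delta> where \<delta>: "\<delta> > 0" "\<And>h. det h = 1 \<Longrightarrow> dev h < \<delta> \<Longrightarrow> h \<star> y \<in> {y\<in>X. Q < f y}"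
            using op[of Q] y Q(3) unfolding openin_iff by blast
          have "min 1 \<delta> / 4 > 0" using \<delta>(1) by simp
          then obtain k :: nat where k: "1 / real (Suc k) < min 1 \<delta> / 4" by (rule nat_approx_posE)
          \<comment> \<open>The first bound keeps the support of the bump around \<open>z\<close>
            within the region near \<open>y\<close> where \<open>f\<close> exceeds \<open>Q\<close>.
            The second makes \<open>y\<close> so close to the center that the bump of height
            \<open>Q\<close> is still above \<open>a\<close> there.\<close>
          define \<eta> where "\<eta> = min (min 1 \<delta> / 4) ((Q - a) / (Q * real (Suc k)))"
          have \<eta>: "\<eta> > 0" using Q \<delta>(1) by (auto simp: \<eta>_def)
          have \<eta>': "\<eta> \<le> min 1 \<delta> / 4" "\<eta> \<le> (Q - a) / (Q * real (Suc k))"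
            unfolding \<eta>_def by (rule min.cobounded1, rule min.cobounded2)
          obtain z h where z: "z \<in> Z" "det h = 1" "dev h < \<eta>" "y = h \<star> z" using Z(4)[OF y \<eta>] by blast
          have zX: "z \<in> X" using z Z(2) by blast
          obtain m where m: "e m = (\<lambda>y. real_of_rat q * bump z (real (Suc k)) y)" using e_eq[OF z(1) less_imp_le[OF Q(1)[unfolded Q_def]], of k] by blast
          have "e m w \<le> f w" if w: "w \<in> X" for w
          proof (cases "real (Suc k) * disp z w < 1")
            case True
            then have "disp z w < 1 / real (Suc k)" by (simp add: field_simps)
            then obtain g where g: "det g = 1" "w = g \<star> z" "dev g < 1 / real (Suc k)" using disp_less[OF zX w] by blast
            have "w = (g ** inv2 h) \<star> y" using z g by (simp add: act_mult)
            moreover have "dev (g ** inv2 h) < \<delta>"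
            proof -
              have g4: "dev g \<le> min 1 \<delta> / 4" and h4: "dev h \<le> min 1 \<delta> / 4" using g k z \<eta>' by linarith+
              have "dev g * dev h \<le> min 1 \<delta> / 4 * 1" using g4 h4 \<delta>(1) by (intro mult_mono) (auto simp: min_def split: if_splits)
              then show ?thesis using dev_mult[of g "inv2 h"] g4 h4 \<delta>(1) by (simp add: min_def split: if_splits)
            qed
            ultimately have "Q < f w" using \<delta>(2)[of "g ** inv2 h"] g z by (simp add: det_mul)
            moreover have "bump z (real (Suc k)) w \<le> 1" using disp_nonneg[OF zX w] by (simp add: bump_def)
            then have "e m w \<le> Q * 1" unfolding m Q_def[symmetric] using Q by (intro mult_left_mono) auto
            ultimately show ?thesis by simp
          next
            case False
            then show ?thesis using f0[OF w] by (simp add: m bump_def max_def)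
          qed
          moreover have "a < e m y"
          proof -
            have "disp z y < \<eta>" using disp_le[OF z(2), of z] z by simp
            then have "real (Suc k) * disp z y < real (Suc k) * \<eta>" by (intro mult_strict_left_mono) auto
            also have "\<dots> \<le> real (Suc k) * ((Q - a) / (Q * real (Suc k)))" using \<eta>' by (intro mult_left_mono) auto
            also have "\<dots> = (Q - a) / Q" by simp
            finally have "Q * (real (Suc k) * disp z y) < Q * ((Q - a) / Q)" using Q by (intro mult_strict_left_mono)
            moreover have "Q * ((Q - a) / Q) = Q - a" using Q by simp
            ultimately have "a < Q * (1 - real (Suc k) * disp z y)" unfolding right_diff_distrib by linarith
            also have "\<dots> \<le> e m y" unfolding m Q_def[symmetric] bump_def using Q by (intro mult_left_mono) auto
            finally show ?thesis .
          qed
          ultimately show ?thesis by blast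
        qed
        then have ex: "\<exists>m0. \<forall>i\<ge>m0. a < F (J i) y"
        proof (cases "a \<ge> 0")
          case True
          then obtain m where m: "\<forall>w\<in>X. e m w \<le> f w" "a < e m y" using \<open>a \<ge> 0 \<Longrightarrow> _\<close> by blast
          have "a < F (J i) y" if "i \<ge> Suc m" for i
          proof -
            have "e m y \<le> F (J i) y" unfolding FJ using fin m(1) that by (intro Max_ge) auto
            then show ?thesis using m(2) by simp
          qed
          then show ?thesis by blast
        next
          case False
          have "0 \<le> F (J i) y" for i unfolding FJ using fin by (intro Max_ge) auto
          then show ?thesis using False by (intro exI[of _ 0]) (auto intro: less_le_trans[of a 0])
        qed
        then show "\<forall>\<^sub>F i in sequentially. a < F (J i) y" by (simp add: eventually_sequentially)
      qed
    qed
  qed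
qed

end

text \<open>The empirical measure is the image under \<open>y\<close> of the uniform probability on
  \<open>{1..N}\<close>.\<close>

lemma integral_empirical_measure:
  assumes N: "N > 0" and y: "\<And>n. y n \<in> topspace X" and f: "f \<in> borel_measurable (borel_of X)"
  shows "integral\<^sup>L (empirical_measure X y N) f = (\<Sum>n=1..N. f (y n)) / real N"
proof -
  let ?U = "uniform_count_measure {1..N}"
  have m: "y \<in> measurable ?U (borel_of X)"
    using y by (auto simp: measurable_def space_uniform_count_measure sets_uniform_count_measure)
  have "empirical_measure X y N = distr ?U (borel_of X) y"
  proof (rule measure_eqI)
    fix B assume "B \<in> sets (empirical_measure X y N)"
    then have B: "B \<in> sets (borel_of X)" by simp
    have "emeasure (empirical_measure X y N) B = (\<Sum>n=1..N. indicator B (y n)) / of_nat N"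
      by (rule emeasure_empirical_measure[OF B])
    also have "(\<Sum>n=1..N. indicator B (y n) :: ennreal) = of_nat (card (y -` B \<inter> {1..N}))"
      by (simp add: indicator_def of_bool_def sum.If_cases vimage_def Int_commute)
    also have "of_nat (card (y -` B \<inter> {1..N})) / of_nat N = emeasure ?U (y -` B \<inter> {1..N})"
      using N by (subst emeasure_uniform_count_measure) (auto simp: ennreal_of_nat_eq_real_of_nat divide_ennreal)
    also have "\<dots> = emeasure (distr ?U (borel_of X) y) B"
      by (subst emeasure_distr[OF m B]) (simp add: space_uniform_count_measure)
    finally show "emeasure (empirical_measure X y N) B = emeasure (distr ?U (borel_of X) y) B" .
  qed simp
  then have "integral\<^sup>L (empirical_measure X y N) f = integral\<^sup>L ?U (\<lambda>n. f (y n))"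
    using integral_distr[OF m f] by simp
  also have "\<dots> = (\<Sum>n=1..N. f (y n)) / real N"
    by (simp add: integral_uniform_count_measure)
  finally show ?thesis .
qed

section \<open>Transfer to continuous test functions\<close>

context sl2_quotient begin

lemma continuous_map_open:
  assumes f: "continuous_map (coset_topology \<Gamma>) euclideanreal f"
  shows "openin (coset_topology \<Gamma>) {y\<in>X. a < f y}"
proof -
  have "openin (coset_topology \<Gamma>) {y \<in> topspace (coset_topology \<Gamma>). f y \<in> {a<..}}"
    by (rule openin_continuous_map_preimage[OF f]) auto
  then show ?thesis by simp
qed

lemma compactly_supported_bounded:
  assumes f: "continuous_map (coset_topology \<Gamma>) euclideanreal f" and s: "compactly_supported (coset_topology \<Gamma>) f"
  obtains M where "\<And>y. y \<in> X \<Longrightarrow> \<bar>f y\<bar> \<le> M"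
proof -
  let ?T = "coset_topology \<Gamma>" and ?S = "{x \<in> X. f x \<noteq> 0}"
  have "compactin euclideanreal (f ` (?T closure_of ?S))"
    using image_compactin[OF s[unfolded compactly_supported_def] f] by simp
  then have "bounded (f ` (?T closure_of ?S))" by (simp add: compact_imp_bounded)
  then obtain M where M: "\<And>y. y \<in> ?T closure_of ?S \<Longrightarrow> \<bar>f y\<bar> \<le> M" by (auto simp: bounded_iff)
  have "?S \<subseteq> ?T closure_of ?S" by (rule closure_of_subset) auto
  then have "\<bar>f y\<bar> \<le> max 0 M" if "y \<in> X" for y
    using M[of y] that by (cases "f y = 0") (auto intro: le_max_iff_disj[THEN iffD2])
  then show ?thesis using that by blast
qed

text \<open>Approximation from below yields only lower bounds for the limit of averages. Applied to
  both \<open>f\<close> and its negative, each raised by \<open>M\<close> to become nonnegative, it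
  gives convergence.\<close>

lemma determining_imp_convergence:
  assumes F: "determining F"
    and \<F>: "\<F> \<le> sequentially" and x: "x \<in> X"
    and lim: "\<And>j. ((\<lambda>N. ces l (F j) x N \<theta>) \<longlongrightarrow> (\<integral>y. F j y \<partial>\<mu>)) \<F>"
    and f: "continuous_map (coset_topology \<Gamma>) euclideanreal f" and M: "\<And>y. y \<in> X \<Longrightarrow> \<bar>f y\<bar> \<le> M"
  shows "((\<lambda>N. ces l f x N \<theta>) \<longlongrightarrow> (\<integral>y. f y \<partial>\<mu>)) \<F>"
proof -
  have BL_F: "BL (F j)" for j using F by (simp add: determining_def)
  have meas: "g \<in> borel_measurable \<mu>" if "\<And>a. openin (coset_topology \<Gamma>) {y\<in>X. a < g y}" for g :: "(real^2^2) set \<Rightarrow> real"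
    unfolding borel_measurable_iff_greater using open_sets_mu[OF that] by simp
  have lower: "\<forall>\<^sub>F N in \<F>. a < ces l g x N \<theta>"
    if g: "\<And>a. openin (coset_topology \<Gamma>) {y\<in>X. a < g y}" "\<And>y. y \<in> X \<Longrightarrow> 0 \<le> g y" "\<And>y. y \<in> X \<Longrightarrow> g y \<le> C"
      and a: "a < (\<integral>y. g y \<partial>\<mu>)" for g a C
  proof -
    have "\<exists>J. \<forall>y\<in>X. (\<forall>i :: nat. 0 \<le> F (J i) y \<and> F (J i) y \<le> g y) \<and> (\<lambda>i. F (J i) y) \<longlonglongrightarrow> g y"
      using F g(1,2) unfolding determining_def by blast
    then obtain J where J: "\<And>y i. y \<in> X \<Longrightarrow> 0 \<le> F (J i) y" "\<And>y i. y \<in> X \<Longrightarrow> F (J i) y \<le> g y"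
      "\<And>y. y \<in> X \<Longrightarrow> (\<lambda>i. F (J i) y) \<longlonglongrightarrow> g y" by blast
    have "(\<lambda>i. \<integral>y. F (J i) y \<partial>\<mu>) \<longlonglongrightarrow> (\<integral>y. g y \<partial>\<mu>)"
    proof (rule integral_dominated_convergence[where w="\<lambda>_. C"])
      show "AE y in \<mu>. norm (F (J i) y) \<le> C" for i
      proof (rule AE_I2)
        fix y assume "y \<in> space \<mu>"
        then show "norm (F (J i) y) \<le> C" using J(1,2)[of y i] g(3)[of y] by simp
      qed
    qed (use meas[OF g(1)] BL_measurable[OF BL_F] J in auto)
    then have "\<forall>\<^sub>F i in sequentially. a < (\<integral>y. F (J i) y \<partial>\<mu>)" using a by (rule order_tendstoD)
    then obtain i where "a < (\<integral>y. F (J i) y \<partial>\<mu>)" by (auto simp: eventually_sequentially)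
    then have "\<forall>\<^sub>F N in \<F>. a < ces l (F (J i)) x N \<theta>" by (rule order_tendstoD[OF lim])
    then show ?thesis
    proof eventually_elim
      case (elim N)
      then show ?case using ces_mono[of "F (J i)" g x l N \<theta>] J(2) x by fastforce
    qed
  qed
  have pos: "\<forall>\<^sub>F N in \<F>. N > 0" by (rule filter_leD[OF \<F>]) (rule eventually_gt_at_top)
  have fm: "f \<in> borel_measurable \<mu>" by (rule meas[OF continuous_map_open[OF f]])
  have fi: "integrable \<mu> f" by (rule integrable_const_bound[of _ M]) (use fm M in auto)
  have low: "\<forall>\<^sub>F N in \<F>. a < ces l g x N \<theta>"
    if g: "continuous_map (coset_topology \<Gamma>) euclideanreal g" "\<And>y. y \<in> X \<Longrightarrow> \<bar>g y\<bar> \<le> M" "integrable \<mu> g"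
      and a: "a < (\<integral>y. g y \<partial>\<mu>)" for a g
  proof -
    \<comment> \<open>The average of the constant \<open>M\<close> equals \<open>M\<close> only for
      positive \<open>N\<close>, whence the combination with \<open>pos\<close> below.\<close>
    have "\<forall>\<^sub>F N in \<F>. a + M < ces l (\<lambda>y. g y + M) x N \<theta>"
    proof (rule lower[of _ "2 * M"])
      show "openin (coset_topology \<Gamma>) {y \<in> X. b < g y + M}" for b
        by (intro continuous_map_open continuous_map_add g) simp
      fix y assume "y \<in> X"
      then show "0 \<le> g y + M" "g y + M \<le> 2 * M" using g(2)[of y] by auto
    qed (use a g(3) prob_space in simp)
    with pos show ?thesis
    proof eventually_elim
      case (elim N)
      then show ?case by (simp add: ces_add ces_const)
    qed
  qed
  show ?thesis
  proof (rule order_tendstoI)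
    fix a assume "a < (\<integral>y. f y \<partial>\<mu>)"
    then show "\<forall>\<^sub>F N in \<F>. a < ces l f x N \<theta>" by (intro low f M fi)
  next
    fix a assume a: "(\<integral>y. f y \<partial>\<mu>) < a"
    have "\<forall>\<^sub>F N in \<F>. - a < ces l (\<lambda>y. - f y) x N \<theta>"
    proof (rule low)
      show "continuous_map (coset_topology \<Gamma>) euclideanreal (\<lambda>y. - f y)" using f by (intro continuous_map_minus) 
    qed (use M fi a in auto)
    then show "\<forall>\<^sub>F N in \<F>. ces l f x N \<theta> < a"
    proof eventually_elim
      case (elim N)
      then show ?case using ces_linear[of l "-1" f 0 f x N \<theta>] by simp
    qed
  qed
qed

text \<open>The filter is left general so that the same transfer serves the full sequence and its
  restriction to a set of indices.\<close>

lemma weak_star_tendsto_orbit: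
  assumes F: "determining F"
    and \<F>: "\<F> \<le> sequentially" and x: "x \<in> X"
    and lim: "\<And>j. ((\<lambda>N. ces l (F j) x N \<theta>) \<longlongrightarrow> (\<integral>y. F j y \<partial>\<mu>)) \<F>"
  shows "weak_star_tendsto (coset_topology \<Gamma>)
    (empirical_measure (coset_topology \<Gamma>) (\<lambda>n. shear (exp (l * real n)) \<star> rot \<theta> \<star> x)) \<mu> \<F>"
  unfolding weak_star_tendsto_def
proof (intro allI impI, elim conjE)
  fix f assume f: "continuous_map (coset_topology \<Gamma>) euclideanreal f" "compactly_supported (coset_topology \<Gamma>) f"
  obtain M where M: "\<And>y. y \<in> X \<Longrightarrow> \<bar>f y\<bar> \<le> M" using compactly_supported_bounded[OF f] by blast
  have "f \<in> borel_measurable (borel_of (coset_topology \<Gamma>))"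
    unfolding measurable_cong_sets[OF sets_mu_borel[symmetric] refl] borel_measurable_iff_greater
    using open_sets_mu[OF continuous_map_open[OF f(1)]] by simp
  then have eq: "ces l f x N \<theta> = integral\<^sup>L (empirical_measure (coset_topology \<Gamma>) (\<lambda>n. shear (exp (l * real n)) \<star> rot \<theta> \<star> x) N) f"
    if "N > 0" for N
    using x that by (subst integral_empirical_measure) (auto simp: ces_def)
  have "\<forall>\<^sub>F N in \<F>. N > 0" by (rule filter_leD[OF \<F>]) (rule eventually_gt_at_top)
  then have "\<forall>\<^sub>F N in \<F>. ces l f x N \<theta> =
      integral\<^sup>L (empirical_measure (coset_topology \<Gamma>) (\<lambda>n. shear (exp (l * real n)) \<star> rot \<theta> \<star> x) N) f"
    by eventually_elim (rule eq)
  then show "((\<lambda>N. integral\<^sup>L (empirical_measure (coset_topology \<Gamma>) (\<lambda>n. shear (exp (l * real n)) \<star> rot \<theta> \<star> x) N) f)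
      \<longlongrightarrow> integral\<^sup>L \<mu> f) \<F>"
    using determining_imp_convergence[OF F \<F> x lim f(1) M] by (rule Lim_transform_eventually[rotated])
qed

end

theorem corollary1p5:
  fixes \<Gamma> :: "(real^2^2) set" and \<mu> :: "(real^2^2) set measure" and l :: real
    and t :: "nat \<Rightarrow> real" and y :: "(real^2^2) set \<Rightarrow> real \<Rightarrow> nat \<Rightarrow> (real^2^2) set"
  assumes lattice: "is_lattice \<Gamma>"
    and haar: "invariant_prob_measure \<Gamma> \<mu>"
    and l_pos: "l > 0"
    and t_def: "\<And>n. t n = exp (l * real n)"
    and y_def: "\<And>x \<theta> n. y x \<theta> n = shear (t n) <#\<^bsub>SL2R\<^esub> (rot \<theta> <#\<^bsub>SL2R\<^esub> x)"
  shows "(\<forall>x \<in> lcosets\<^bsub>SL2R\<^esub> \<Gamma>. AE \<theta> in lebesgue_on {0..2*pi}. \<exists>A :: nat set.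
            upper_density A = 1 \<and>
            weak_star_tendsto (coset_topology \<Gamma>) (empirical_measure (coset_topology \<Gamma>) (y x \<theta>)) \<mu>
              (inf sequentially (principal A)))
       \<and> (compact_space (coset_topology \<Gamma>) \<longrightarrow>
          (\<forall>x \<in> lcosets\<^bsub>SL2R\<^esub> \<Gamma>. AE \<theta> in lebesgue_on {0..2*pi}.
            weak_star_tendsto (coset_topology \<Gamma>) (empirical_measure (coset_topology \<Gamma>) (y x \<theta>)) \<mu>
              sequentially))"
proof -
  interpret sl2_quotient \<Gamma> \<mu>
    by (rule sl2_quotient.intro) (rule haar)
  have y: "y x \<theta> = (\<lambda>n. shear (exp (l * real n)) \<star> rot \<theta> \<star> x)" for x \<theta>
    by (simp add: fun_eq_iff y_def t_def)
  obtain F where F: "determining F" by (rule ex_determining)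
  have BL_F: "BL (F j)" for j using F by (simp add: determining_def)
  note transfer = weak_star_tendsto_orbit[OF F]
  show ?thesis
  proof (intro conjI ballI impI)
    fix x assume x: "x \<in> X"
    let ?W = "\<lambda>j N \<theta>. ces l (F j) x N \<theta> - (\<integral>y. F j y \<partial>\<mu>)"
    \<comment> \<open>Applied to the countable determining family as a whole, so that
      \<open>A\<close> depends on the angle but not on the test function.\<close>
    have "AE \<theta> in lebesgue_on {0..2*pi}. \<exists>A. upper_density A = 1 \<and>
        (\<forall>j. ((\<lambda>N. ?W j N \<theta>) \<longlongrightarrow> 0) (inf sequentially (principal A)))"
      by (rule AE_density_one_convergence[OF _ _ ces_L1[OF BL_F x l_pos]])
        (auto intro!: continuous_intros ces_continuous BL_F x)
    then show "AE \<theta> in lebesgue_on {0..2*pi}. \<exists>A :: nat set. upper_density A = 1 \<and>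
        weak_star_tendsto (coset_topology \<Gamma>) (empirical_measure (coset_topology \<Gamma>) (y x \<theta>)) \<mu>
          (inf sequentially (principal A))"
    proof eventually_elim
      case (elim \<theta>)
      then obtain A where A: "upper_density A = 1" "\<And>j. ((\<lambda>N. ?W j N \<theta>) \<longlongrightarrow> 0) (inf sequentially (principal A))" by blast
      have "weak_star_tendsto (coset_topology \<Gamma>) (empirical_measure (coset_topology \<Gamma>) (y x \<theta>)) \<mu>
          (inf sequentially (principal A))"
        unfolding y by (rule transfer[OF inf_le1 x LIM_zero_cancel[OF A(2)]])
      with A(1) show ?case by blast
    qed
  next
    fix x assume cpt: "compact_space (coset_topology \<Gamma>)" and x: "x \<in> X"
    have "AE \<theta> in lebesgue_on {0..2*pi}. \<forall>j. (\<lambda>N. ces l (F j) x N \<theta>) \<longlonglongrightarrow> (\<integral>y. F j y \<partial>\<mu>)"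
      unfolding AE_all_countable by (intro allI ces_AE_compact BL_F x l_pos cpt)
    then show "AE \<theta> in lebesgue_on {0..2*pi}.
        weak_star_tendsto (coset_topology \<Gamma>) (empirical_measure (coset_topology \<Gamma>) (y x \<theta>)) \<mu> sequentially"
    proof eventually_elim
      case (elim \<theta>)
      then show ?case unfolding y by (intro transfer[OF order_refl x]) blast
    qed
  qed
qed

end
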